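(* Let $\bar U=\bar U^{\bar s}=(\bar v,\bar u)$ be a homoclinic (soliton-type) traveling wave profile of speed $\bar s$ and endstate $U_\infty=(v_\infty,u_\infty)$ of the Korteweg system $$v_t-u_x=0,\qquad u_t+p(v)_x=-\kappa v_{xxx},\qquad \kappa>0 \text{ constant},$$ belonging to the one-parameter family $\{\bar U^s\}$ of homoclinic profiles with the same endstate $U_\infty$. Let $m(s)$ be the associated moment of instability, and let $D(\lambda)$ be the Evans function of the linearized operator $L$ about $\bar U$ (all as defined in the context). Then $$D''(0)=c\,\frac{d^2m}{ds^2}(\bar s)$$ for a nonzero constant $c$.
   Context: **Setting.** $p$ is a smooth real function, $\kappa>0$ is a constant, and $U=(v,u)$. A soliton-type traveling wave is a solution $U(x,t)=\bar U(x-\bar s t)$ with $\bar U$ smooth, nonconstant, and $\lim_{z\to\pm\infty}\bar U(z)=U_\infty=(v_\infty,u_\infty)$. Its profile satisfies $-\bar s v'-u'=0$ and $-\bar s u'+p(v)'=-\kappa v'''$. Hence $\bar u-u_\infty=-\bar s(\bar v-v_\infty)$ and $$\kappa \bar v''=-\big(\bar s^2(\bar v-v_\infty)+p(\bar v)-p(v_\infty)\big).$$ The standing assumption is that the endstate is a saddle: $\bar s^2+p'(v_\infty)<0$. Then $\bar U-U_\infty$ decays exponentially. For $s$ near $\bar s$ and $U_\infty$ fixed, there is a smooth one-parameter family $\bar U^s=(\bar v^s,\bar u^s)$ of such homoclinic profiles of speed $s$, with $\bar U^{\bar s}=\bar U$. **Moment of instability.** Define $$\mathcal H(U)=\int_{\mathbb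 R}\Big(\tfrac12(u-u_\infty)^2-\int_{v_\infty}^{v}(p(z)-p(v_\infty))\,dz+\tfrac12\kappa (v_x)^2\Big)dx,$$ $$\mathcal Q(U)=\int_{\mathbb R}(u-u_\infty)(v-v_\infty)\,dx,$$ and $m(s):=\mathcal H(\bar U^s)+s\,\mathcal Q(\bar U^s)$. (One has $\frac{d^2m}{ds^2}=\frac{d}{ds}\mathcal Q(\bar U^s)$.) **Linearized operator and eigenvalue equation.** In the frame moving with the wave, the linearization about $\bar U$ is $U_t=LU$. Set $\alpha(x):=p'(\bar v(x))$ and $s=\bar s$. The eigenvalue equation $(L-\lambda)U=0$ is $$\lambda v-sv'-u'=0,\qquad \lambda u-su'+(\alpha v)'=-\kappa v'''.$$ With $W=(u,v,v',v'')^{\mathrm T}$, this is a linear first-order system $W'=A(x,\lambda)W$ on $\mathbb R$. Its coefficient matrix $A$ is affine in $\lambda$ and has the same limit $A_\infty(\lambda)$ as $x\to+\infty$ and as $x\to-\infty$. **Evans function.** Let $\Lambda=\{\lambda\in\mathbb C:\operatorname{Re}\lambda>0\}$. For $\lambda\in\Lambda$, the space of solutions of $W'=A(x,\lambda)W$ decaying as $x\to+\infty$ has dimension two, and so does the space of solutions decaying as $x\to-\infty$. For some $r>0$ there are solutions $W_1^+,W_2^+$ and $W_3^-,W_4^-$ of $W'=A(x,\lambda)W$ with the following properties. - They depend analytically on $\lambda\in\Lambda\cup B(0,r)$. - The pair $W_1^+,W_2^+$ is linearly independent for every $\lambda\in\Lambda\cup B(0,r)$, and so is the pair $W_3^-,W_4^-$.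 - For $\lambda\in\Lambda$, $W_1^+,W_2^+$ span the solutions decaying at $+\infty$, and $W_3^-,W_4^-$ span the solutions decaying at $-\infty$. - At $\lambda=0$, they are normalized so that $W_1^+(\cdot,0)=W_4^-(\cdot,0)=\partial_x(\bar u,\bar v,\bar v_x,\bar v_{xx})^{\mathrm T}$. Moreover, with $c_\infty:=\sqrt{-p'(v_\infty)}>0$, $$\lim_{x\to+\infty}W_2^+(x,0)=(-c_\infty,1,0,0)^{\mathrm T},\qquad \lim_{x\to-\infty}W_3^-(x,0)=(c_\infty,1,0,0)^{\mathrm T}.$$ The Evans function is $$D(\lambda):=\det\big(W_1^+\;\,W_2^+\;\,W_3^-\;\,W_4^-\big)\big|_{x=0},$$ an analytic function on $\Lambda\cup B(0,r)$. Here $D''(0)$ is its second derivative in $\lambda$ at $0$. *)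

theory Defs
  imports "HOL-Analysis.Analysis"
begin

text \<open>\<open>k\<close>-fold continuous differentiability and smoothness on an open set \<open>S\<close>, through iterated
  partial derivatives.\<close>

primrec Ck_on :: "nat \<Rightarrow> 'a::euclidean_space set \<Rightarrow> ('a \<Rightarrow> real) \<Rightarrow> bool" where
  "Ck_on 0 S f \<longleftrightarrow> continuous_on S f"
| "Ck_on (Suc k) S f \<longleftrightarrow> (\<forall>x\<in>S. f differentiable (at x)) \<and>
     (\<forall>b\<in>Basis. Ck_on k S (\<lambda>x. frechet_derivative f (at x) b))"

definition smooth_on :: "'a::euclidean_space set \<Rightarrow> ('a \<Rightarrow> real) \<Rightarrow> bool" where
  "smooth_on S f \<longleftrightarrow> (\<forall>k. Ck_on k S f)"

text \<open>The Korteweg system \<open>v\<^sub>t - u\<^sub>x = 0\<close>, \<open>u\<^sub>t + p(v)\<^sub>x = -\<kappa> v\<^sub>x\<^sub>x\<^sub>x\<close>; functions take the arguments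
  \<open>x\<close>, \<open>t\<close> in this order. Classical solutions are meant: the predicate is only used together with
  smoothness of \<open>v\<close>, \<open>u\<close>.\<close>

definition korteweg_solution ::
  "(real \<Rightarrow> real) \<Rightarrow> real \<Rightarrow> (real \<Rightarrow> real \<Rightarrow> real) \<Rightarrow> (real \<Rightarrow> real \<Rightarrow> real) \<Rightarrow> bool" where
  "korteweg_solution p \<kappa> v u \<longleftrightarrow> (\<forall>x t.
     deriv (\<lambda>\<tau>. v x \<tau>) t - deriv (\<lambda>\<xi>. u \<xi> t) x = 0 \<and>
     deriv (\<lambda>\<tau>. u x \<tau>) t + deriv (\<lambda>\<xi>. p (v \<xi> t)) x = - \<kappa> * (deriv ^^ 3) (\<lambda>\<xi>. v \<xi> t) x)"

definition soliton_profile ::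
  "(real \<Rightarrow> real) \<Rightarrow> real \<Rightarrow> real \<Rightarrow> real \<Rightarrow> real \<Rightarrow> (real \<Rightarrow> real) \<Rightarrow> (real \<Rightarrow> real) \<Rightarrow> bool" where
  "soliton_profile p \<kappa> vinf uinf s v u \<longleftrightarrow>
     smooth_on UNIV v \<and> smooth_on UNIV u \<and>
     \<not> (\<lambda>x. (v x, u x)) constant_on UNIV \<and>
     korteweg_solution p \<kappa> (\<lambda>x t. v (x - s * t)) (\<lambda>x t. u (x - s * t)) \<and>
     (v \<longlongrightarrow> vinf) at_top \<and> (v \<longlongrightarrow> vinf) at_bot \<and>
     (u \<longlongrightarrow> uinf) at_top \<and> (u \<longlongrightarrow> uinf) at_bot"

text \<open>A smooth one-parameter family, defined for \<open>\<bar>s - sbar\<bar> < \<delta>\<close>, of profiles \<open>(vs s, us s)\<close> of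
  speed \<open>s\<close> with common endstate; smoothness is joint in \<open>(s, x)\<close>.\<close>

definition soliton_family ::
  "(real \<Rightarrow> real) \<Rightarrow> real \<Rightarrow> real \<Rightarrow> real \<Rightarrow> real \<Rightarrow> real \<Rightarrow>
   (real \<Rightarrow> real \<Rightarrow> real) \<Rightarrow> (real \<Rightarrow> real \<Rightarrow> real) \<Rightarrow> bool" where
  "soliton_family p \<kappa> vinf uinf sbar \<delta> vs us \<longleftrightarrow> \<delta> > 0 \<and>
     smooth_on ({sbar - \<delta><..<sbar + \<delta>} \<times> UNIV) (\<lambda>(s, x). vs s x) \<and>
     smooth_on ({sbar - \<delta><..<sbar + \<delta>} \<times> UNIV) (\<lambda>(s, x). us s x) \<and>
     (\<forall>s\<in>{sbar - \<delta><..<sbar + \<delta>}. soliton_profile p \<kappa> vinf uinf s (vs s) (us s))"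

definition energy ::
  "(real \<Rightarrow> real) \<Rightarrow> real \<Rightarrow> real \<Rightarrow> real \<Rightarrow> (real \<Rightarrow> real) \<Rightarrow> (real \<Rightarrow> real) \<Rightarrow> real" where
  "energy p \<kappa> vinf uinf v u =
     (\<integral>x. (u x - uinf)\<^sup>2 / 2
        - (LBINT z = ereal vinf..ereal (v x). (p z - p vinf))
        + \<kappa> * (deriv v x)\<^sup>2 / 2 \<partial>lborel)"

definition momentum :: "real \<Rightarrow> real \<Rightarrow> (real \<Rightarrow> real) \<Rightarrow> (real \<Rightarrow> real) \<Rightarrow> real" where
  "momentum vinf uinf v u = (\<integral>x. (u x - uinf) * (v x - vinf) \<partial>lborel)"

definition moment_of_instability ::
  "(real \<Rightarrow> real) \<Rightarrow> real \<Rightarrow> real \<Rightarrow> real \<Rightarrow>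
   (real \<Rightarrow> real \<Rightarrow> real) \<Rightarrow> (real \<Rightarrow> real \<Rightarrow> real) \<Rightarrow> real \<Rightarrow> real" where
  "moment_of_instability p \<kappa> vinf uinf vs us s =
     energy p \<kappa> vinf uinf (vs s) (us s) + s * momentum vinf uinf (vs s) (us s)"

text \<open>Coefficient matrix of the eigenvalue equation with spectral parameter \<open>\<mu>\<close>,
  \<open>\<mu> v - s v' - u' = 0\<close>, \<open>\<mu> u - s u' + (\<alpha> v)' = -\<kappa> v'''\<close> with \<open>\<alpha> = p'(v)\<close> evaluated at the profile,
  written as a first-order system for \<open>W = (u, v, v', v'')\<close>: the first equation gives
  \<open>u' = \<mu> v - s v'\<close>, and inserting this in the second one gives
  \<open>v''' = -(\<mu> u + (\<alpha>' - s \<mu>) v + (\<alpha> + s\<^sup>2) v') / \<kappa>\<close>.\<close>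

definition alpha :: "(real \<Rightarrow> real) \<Rightarrow> (real \<Rightarrow> real) \<Rightarrow> real \<Rightarrow> real" where
  "alpha p v x = deriv p (v x)"

definition eigen_matrix ::
  "(real \<Rightarrow> real) \<Rightarrow> real \<Rightarrow> real \<Rightarrow> (real \<Rightarrow> real) \<Rightarrow> real \<Rightarrow> complex \<Rightarrow> complex ^ 4 ^ 4" where
  "eigen_matrix p \<kappa> s v x \<mu> = (let a = alpha p v x; a' = deriv (alpha p v) x in
     vector
      [vector [0, \<mu>, - of_real s, 0],
       vector [0, 0, 1, 0],
       vector [0, 0, 0, 1],
       vector [- \<mu> / of_real \<kappa>,
               - (of_real a' - of_real s * \<mu>) / of_real \<kappa>,
               - of_real (a + s\<^sup>2) / of_real \<kappa>,
               0]])"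

lemma vector_4_nth [simp]:
  "(vector [a, b, c, d] :: 'a::zero ^ 4) $ 1 = a"
  "(vector [a, b, c, d] :: 'a::zero ^ 4) $ 2 = b"
  "(vector [a, b, c, d] :: 'a::zero ^ 4) $ 3 = c"
  "(vector [a, b, c, d] :: 'a::zero ^ 4) $ 4 = d"
  unfolding vector_def by simp_all

text \<open>The right-hand side of the system encodes the eigenvalue equation: \<open>u1, v1, v3\<close> stand for
  \<open>u', v', v'''\<close>, and \<open>a' v + a v1\<close> for \<open>(\<alpha> v)'\<close>.\<close>

lemma eigen_matrix_iff:
  fixes u u1 v v1 v2 v3 \<mu> a a' :: complex
  assumes "\<kappa> > 0" and a: "a = of_real (alpha p vbar x)" "a' = of_real (deriv (alpha p vbar) x)"
  shows "vector [u1, v1, v2, v3] = eigen_matrix p \<kappa> s vbar x \<mu> *v vector [u, v, v1, v2] \<longleftrightarrow>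
    \<mu> * v - of_real s * v1 - u1 = 0 \<and>
    \<mu> * u - of_real s * u1 + (a' * v + a * v1) = - of_real \<kappa> * v3"
proof -
  have k: "complex_of_real \<kappa> \<noteq> 0" using assms(1) by simp
  have "vector [u1, v1, v2, v3] = eigen_matrix p \<kappa> s vbar x \<mu> *v vector [u, v, v1, v2] \<longleftrightarrow>
    u1 = \<mu> * v - of_real s * v1 \<and>
    v3 = - (\<mu> * u + (a' - of_real s * \<mu>) * v + (a + (of_real s)\<^sup>2) * v1) / of_real \<kappa>"
    unfolding vec_eq_iff forall_4 eigen_matrix_def Let_def a
    by (simp add: matrix_vector_mult_def sum_4 add_divide_distrib diff_divide_distrib
        minus_divide_left [symmetric] algebra_simps)
  also have "\<dots> \<longleftrightarrow> \<mu> * v - of_real s * v1 - u1 = 0 \<and>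
    \<mu> * u - of_real s * u1 + (a' * v + a * v1) = - of_real \<kappa> * v3"
  proof (cases "u1 = \<mu> * v - of_real s * v1")
    case True
    have "v3 = - y / of_real \<kappa> \<longleftrightarrow> y = - of_real \<kappa> * v3" for y
      using k by (auto simp: field_simps)
    moreover have "\<mu> * u + (a' - of_real s * \<mu>) * v + (a + (of_real s)\<^sup>2) * v1 =
        \<mu> * u - of_real s * u1 + (a' * v + a * v1)"
      unfolding True by (simp add: power2_eq_square algebra_simps)
    ultimately have "v3 = - (\<mu> * u + (a' - of_real s * \<mu>) * v + (a + (of_real s)\<^sup>2) * v1) / of_real \<kappa> \<longleftrightarrow>
        \<mu> * u - of_real s * u1 + (a' * v + a * v1) = - of_real \<kappa> * v3"
      by metis
    then show ?thesis
      using True by auto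
  qed (auto simp: algebra_simps)
  finally show ?thesis .
qed

definition eigen_solution ::
  "(real \<Rightarrow> real) \<Rightarrow> real \<Rightarrow> real \<Rightarrow> (real \<Rightarrow> real) \<Rightarrow> complex \<Rightarrow> (real \<Rightarrow> complex ^ 4) \<Rightarrow> bool" where
  "eigen_solution p \<kappa> s v \<mu> W \<longleftrightarrow>
     (\<forall>x. (W has_vector_derivative (eigen_matrix p \<kappa> s v x \<mu> *v W x)) (at x))"

definition fun_independent :: "(real \<Rightarrow> complex ^ 4) \<Rightarrow> (real \<Rightarrow> complex ^ 4) \<Rightarrow> bool" where
  "fun_independent V W \<longleftrightarrow> (\<forall>a b. (\<forall>x. a *s V x + b *s W x = 0) \<longrightarrow> a = 0 \<and> b = 0)"

definition fun_span2 ::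
  "(real \<Rightarrow> complex ^ 4) \<Rightarrow> (real \<Rightarrow> complex ^ 4) \<Rightarrow> (real \<Rightarrow> complex ^ 4) set" where
  "fun_span2 V W = {\<lambda>x. a *s V x + b *s W x | a b. True}"

text \<open>Solutions \<open>W\<^sub>1\<^sup>+, W\<^sub>2\<^sup>+, W\<^sub>3\<^sup>-, W\<^sub>4\<^sup>-\<close> entering the Evans function. They take the spectral
  parameter first and the space variable second.\<close>

definition evans_basis ::
  "(real \<Rightarrow> real) \<Rightarrow> real \<Rightarrow> real \<Rightarrow> real \<Rightarrow> (real \<Rightarrow> real) \<Rightarrow> (real \<Rightarrow> real) \<Rightarrow> real \<Rightarrow>
   (complex \<Rightarrow> real \<Rightarrow> complex ^ 4) \<Rightarrow> (complex \<Rightarrow> real \<Rightarrow> complex ^ 4) \<Rightarrow>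
   (complex \<Rightarrow> real \<Rightarrow> complex ^ 4) \<Rightarrow> (complex \<Rightarrow> real \<Rightarrow> complex ^ 4) \<Rightarrow> bool" where
  "evans_basis p \<kappa> vinf s v u r W1 W2 W3 W4 \<longleftrightarrow>
    (let \<Lambda> = {\<mu>. Re \<mu> > 0};
         \<Omega> = \<Lambda> \<union> ball 0 r;
         cinf = sqrt (- deriv p vinf);
         dU = (\<lambda>x. vector [of_real (deriv u x), of_real (deriv v x),
                of_real ((deriv ^^ 2) v x), of_real ((deriv ^^ 3) v x)])
     in
      r > 0 \<and>
      (\<forall>W\<in>{W1, W2, W3, W4}.
         (\<forall>\<mu>\<in>\<Omega>. eigen_solution p \<kappa> s v \<mu> (W \<mu>)) \<and>
         (\<forall>x i. (\<lambda>\<mu>. W \<mu> x $ i) analytic_on \<Omega>)) \<and>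
      (\<forall>\<mu>\<in>\<Omega>. fun_independent (W1 \<mu>) (W2 \<mu>) \<and> fun_independent (W3 \<mu>) (W4 \<mu>)) \<and>
      (\<forall>\<mu>\<in>\<Lambda>.
         fun_span2 (W1 \<mu>) (W2 \<mu>) = {W. eigen_solution p \<kappa> s v \<mu> W \<and> (W \<longlongrightarrow> 0) at_top} \<and>
         fun_span2 (W3 \<mu>) (W4 \<mu>) = {W. eigen_solution p \<kappa> s v \<mu> W \<and> (W \<longlongrightarrow> 0) at_bot}) \<and>
      W1 0 = dU \<and> W4 0 = dU \<and>
      (W2 0 \<longlongrightarrow> vector [- of_real cinf, 1, 0, 0]) at_top \<and>
      (W3 0 \<longlongrightarrow> vector [of_real cinf, 1, 0, 0]) at_bot)"

text \<open>The four vectors are the columns, hence the transpose.\<close>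

definition evans_function ::
  "(complex \<Rightarrow> real \<Rightarrow> complex ^ 4) \<Rightarrow> (complex \<Rightarrow> real \<Rightarrow> complex ^ 4) \<Rightarrow>
   (complex \<Rightarrow> real \<Rightarrow> complex ^ 4) \<Rightarrow> (complex \<Rightarrow> real \<Rightarrow> complex ^ 4) \<Rightarrow> complex \<Rightarrow> complex" where
  "evans_function W1 W2 W3 W4 \<mu> =
     det (transpose (vector [W1 \<mu> 0, W2 \<mu> 0, W3 \<mu> 0, W4 \<mu> 0]))"

end

theory Submission
  imports Defs "HOL-Complex_Analysis.Cauchy_Integral_Formula"
begin

text \<open>Let \<open>y = v - v\<^sub>\<infinity>\<close> and \<open>w = \<partial>\<^sub>s v\<close>. The energy identity \<open>\<kappa> y'\<^sup>2 / 2 + s\<^sup>2 y\<^sup>2 / 2 + G(y) = 0\<close> gives exponential decay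
  of \<open>y\<close> and \<open>w\<close> locally uniformly in \<open>s\<close>, and turns the moment of instability into \<open>m(s) = \<kappa> \<integral>y'\<^sup>2\<close>. Two
  differentiations under the integral yield \<open>m'(s) = - s \<integral>y\<^sup>2\<close> and \<open>m''(s) = - \<integral>(y\<^sup>2 + 2 s y w)\<close>.

  For real \<open>\<lambda> \<rightarrow> 0+\<close> the solutions \<open>W\<^sub>j\<close> are bounded on their half-lines uniformly in \<open>\<lambda>\<close>, by a comparison with
  the slow and fast modes of the limiting system. Apply to the columns of the determinant the two fluxes
  \<open>P = u + s v\<close>, \<open>Q = - s u + \<alpha> v + \<kappa> v''\<close> and the pairing \<open>\<ell>\<close> with the approximate adjoint null function
  \<open>(u - u\<^sub>\<infinity>, v - v\<^sub>\<infinity>) + \<lambda> (\<integral>\<partial>\<^sub>s u, \<integral>\<partial>\<^sub>s v)\<close>. With the antiderivatives taken from \<open>+\<infinity>\<close>, \<open>\<ell>(W\<^sub>j)\<close> is \<open>\<lambda>\<^sup>2\<close> times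
  a convergent integral for \<open>j = 1, 2\<close>; with those taken from \<open>-\<infinity>\<close> the same holds for \<open>j = 3, 4\<close>, and the
  two pairings differ by \<open>\<lambda>\<close> times a constant combination of \<open>P\<close> and \<open>Q\<close>. The growing slow mode forces
  \<open>Q(W\<^sub>1) - c\<^sub>\<infinity> P(W\<^sub>1)\<close> and \<open>Q(W\<^sub>4) + c\<^sub>\<infinity> P(W\<^sub>4)\<close> to have known first-order terms in \<open>\<lambda>\<close>. Consequently \<open>D(\<lambda>) / \<lambda>\<^sup>2\<close> has a
  limit, in which everything not fixed by the normalization cancels, and
  \<open>D''(0) = 4 c\<^sub>\<infinity> (s\<^sup>2 - c\<^sub>\<infinity>\<^sup>2) / \<kappa>\<^sup>2 \<cdot> m''(s)\<close>.\<close>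

section \<open>Uniform bounds for decaying eigenfunctions\<close>


text \<open>Obstacle: the slow exponents are of order \<lambda>, so decay degenerates at \<lambda> =
  0, and \<open>evans_basis\<close> gives analyticity only at each fixed x. Bounds uniform in
  \<lambda> must come from the equation itself; together with exponentially localized weights they
  permit dominated convergence. One real sequence is enough: D is analytic at 0, so a limit of D /
  \<lambda>^2 forces D(0) = D'(0) = 0 and fixes D''(0). Origin of the pairing: the adjoint of L U =
  (s v' + u', s u' - (\<alpha> v)' - \<kappa> v''') annihilates T0 = (u - uinf, v - vinf), tested
  against (v, u) of an eigenfunction, and maps a primitive T1 of the s-derivative of (u, v) to T0.
  Hence T0 + \<lambda> T1 solves the adjoint eigenvalue equation up to \<lambda>^2. T1 cannot vanish
  at both ends unless the s-derivatives have zero integral; this forces two versions of the pairing,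
  whose difference carries these integrals. The normalization at \<lambda> = 0 leaves the
  first-order terms of W1 and W4 free (multiples of \<lambda> W2 or \<lambda> W3 may be added); one
  flux relation at each end is exactly enough to eliminate them.\<close>

text \<open>Integrating factor \<open>exp (\<nu> * (t - x))\<close>. The loss
  \<open>1 / \<nu>\<close> is harmless for the slow modes, because their forcing carries a factor
  \<open>\<nu>\<close>.\<close>

lemma stable_scalar_bound:
  fixes y f :: "real \<Rightarrow> complex"
  assumes nu: "\<nu> > 0" and d: "\<And>x. (y has_vector_derivative f x - of_real \<nu> * y x) (at x)"
    and f: "\<And>x. x \<ge> X \<Longrightarrow> norm (f x) \<le> F" and x: "x \<ge> X"
  shows "norm (y x) \<le> norm (y X) + F / \<nu>"
proof (cases "x = X")
  case True
  have "F \<ge> 0" using f[of X] norm_ge_zero order_trans by blast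
  then show ?thesis using True nu by simp
next
  case False
  with x have xX: "X < x" by simp
  have F0: "F \<ge> 0" using f[of X] norm_ge_zero order_trans by blast
  let ?g = "\<lambda>t. exp (\<nu> * (t - x)) *\<^sub>R y t"
  have dg: "(?g has_vector_derivative exp (\<nu> * (t - x)) *\<^sub>R f t) (at t)" for t
  proof -
    have 1: "((\<lambda>t. exp (\<nu> * (t - x))) has_field_derivative \<nu> * exp (\<nu> * (t - x))) (at t)"
      by (auto intro!: derivative_eq_intros)
    show ?thesis
      by (rule has_vector_derivative_eq_rhs[OF has_vector_derivative_scaleR[OF 1 d]])
        (simp add: scaleR_conv_of_real algebra_simps)
  qed
  have dphi: "((\<lambda>t. F / \<nu> * exp (\<nu> * (t - x))) has_vector_derivative F * exp (\<nu> * (t - x))) (at t)" for t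
    unfolding has_real_derivative_iff_has_vector_derivative[symmetric]
    using nu by (auto intro!: derivative_eq_intros)
  have "norm (?g x - ?g X) \<le> F / \<nu> * exp (\<nu> * (x - x)) - F / \<nu> * exp (\<nu> * (X - x))"
  proof (rule differentiable_bound_general[OF xX])
    show "continuous_on {X..x} ?g"
      by (intro continuous_at_imp_continuous_on ballI has_vector_derivative_continuous[OF dg])
    show "continuous_on {X..x} (\<lambda>t. F / \<nu> * exp (\<nu> * (t - x)))"
      by (intro continuous_intros)
  qed (use dg dphi f in \<open>auto simp: mult.commute mult_left_mono\<close>)
  also have "\<dots> \<le> F / \<nu>" using F0 nu by simp
  finally have 1: "norm (y x - ?g X) \<le> F / \<nu>" by simp
  have "exp (\<nu> * (X - x)) \<le> 1" using nu xX by (simp add: mult_nonneg_nonpos)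
  then have "norm (?g X) \<le> norm (y X)" by (simp add: mult_left_le_one_le)
  then show ?thesis using 1 norm_triangle_ineq2[of "y x" "?g X"] by linarith
qed

text \<open>For a growing mode the condition at infinity replaces the initial value: integrating
  backwards from infinity leaves no boundary term, so only the forcing contributes.\<close>

lemma unstable_scalar_bound:
  fixes y f :: "real \<Rightarrow> complex"
  assumes nu: "\<nu> > 0" and d: "\<And>x. (y has_vector_derivative f x + of_real \<nu> * y x) (at x)"
    and f: "\<And>x. x \<ge> X \<Longrightarrow> norm (f x) \<le> F" and x: "x \<ge> X"
    and lim: "(y \<longlongrightarrow> 0) at_top"
  shows "norm (y x) \<le> F / \<nu>"
proof -
  have F0: "F \<ge> 0" using f[of X] norm_ge_zero order_trans by blast
  let ?g = "\<lambda>t. exp (- \<nu> * (t - x)) *\<^sub>R y t"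
  have dg: "(?g has_vector_derivative exp (- \<nu> * (t - x)) *\<^sub>R f t) (at t)" for t
  proof -
    have 1: "((\<lambda>t. exp (- \<nu> * (t - x))) has_field_derivative - \<nu> * exp (- \<nu> * (t - x))) (at t)"
      by (auto intro!: derivative_eq_intros)
    show ?thesis
      by (rule has_vector_derivative_eq_rhs[OF has_vector_derivative_scaleR[OF 1 d]])
        (simp add: scaleR_conv_of_real algebra_simps)
  qed
  have dphi: "((\<lambda>t. - F / \<nu> * exp (- \<nu> * (t - x))) has_vector_derivative F * exp (- \<nu> * (t - x))) (at t)" for t
    unfolding has_real_derivative_iff_has_vector_derivative[symmetric]
    using nu by (auto intro!: derivative_eq_intros)
  have b: "norm (y x) \<le> F / \<nu> + norm (y t)" if "t > x" for t
  proof -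
    have "norm (?g t - ?g x) \<le> - F / \<nu> * exp (- \<nu> * (t - x)) - (- F / \<nu> * exp (- \<nu> * (x - x)))"
    proof (rule differentiable_bound_general[OF that])
      show "continuous_on {x..t} ?g"
        by (intro continuous_at_imp_continuous_on ballI has_vector_derivative_continuous[OF dg])
      show "continuous_on {x..t} (\<lambda>t. - F / \<nu> * exp (- \<nu> * (t - x)))"
        by (intro continuous_intros)
    qed (use dg dphi f x in \<open>auto simp: mult.commute mult_left_mono\<close>)
    also have "\<dots> \<le> F / \<nu>" using F0 nu by simp
    finally have 1: "norm (?g t - y x) \<le> F / \<nu>" by simp
    have "exp (- \<nu> * (t - x)) \<le> 1" using nu that by simp
    then have "norm (?g t) \<le> norm (y t)" by (simp add: mult_left_le_one_le)
    then show ?thesis using 1 norm_triangle_ineq3[of "y x" "?g t"] by (simp add: norm_minus_commute)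
  qed
  have "((\<lambda>t. F / \<nu> + norm (y t)) \<longlongrightarrow> F / \<nu> + 0) at_top"
    by (intro tendsto_intros tendsto_norm_zero lim)
  moreover have "\<forall>\<^sub>F t in at_top. norm (y x) \<le> F / \<nu> + norm (y t)"
    using eventually_gt_at_top[of x] by eventually_elim (rule b)
  ultimately show ?thesis
    using tendsto_lowerbound by fastforce
qed

text \<open>The eigenvalue equation integrated once: \<open>P = u + s v\<close>, \<open>Q = - s u + a v + \<kappa> v''\<close> and
  \<open>z = v'\<close>. No derivative of the coefficient occurs in these variables.\<close>

definition reduced_solution ::
  "real \<Rightarrow> real \<Rightarrow> (real \<Rightarrow> real) \<Rightarrow> real \<Rightarrow> (real \<Rightarrow> complex) \<Rightarrow> (real \<Rightarrow> complex) \<Rightarrow>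
   (real \<Rightarrow> complex) \<Rightarrow> (real \<Rightarrow> complex) \<Rightarrow> bool" where
  "reduced_solution \<kappa> s a \<mu> P Q v z \<longleftrightarrow> (\<forall>x.
     (P has_vector_derivative of_real \<mu> * v x) (at x) \<and>
     (Q has_vector_derivative - of_real \<mu> * (P x - of_real s * v x)) (at x) \<and>
     (v has_vector_derivative z x) (at x) \<and>
     (z has_vector_derivative
        (Q x + of_real s * P x - of_real (s\<^sup>2 + a x) * v x) / of_real \<kappa>) (at x))"

lemma norm_add_le: "norm a \<le> A \<Longrightarrow> norm b \<le> B \<Longrightarrow> norm (a + b) \<le> A + B"
  for a b :: "'a::real_normed_vector"
  using norm_triangle_ineq[of a b] by linarith

lemma norm_diff_le: "norm a \<le> A \<Longrightarrow> norm b \<le> B \<Longrightarrow> norm (a - b) \<le> A + B"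
  for a b :: "'a::real_normed_vector"
  using norm_triangle_ineq4[of a b] by linarith

lemma norm_of_real_mult_le: "norm v \<le> M \<Longrightarrow> \<bar>r\<bar> \<le> R \<Longrightarrow> norm (of_real r * v) \<le> R * M" for v :: complex
  by (simp add: norm_mult mult_mono)

text \<open>\<open>Q - c P\<close> and \<open>Q + c P\<close> are the slow modes of the limiting constant-coefficient system, with
  exponents \<open>\<mu> / (c + s)\<close> and \<open>- \<mu> / (c - s)\<close> to leading order. The terms in \<open>z\<close> and \<open>v\<close> are the
  next-order corrections that remove \<open>\<kappa> v''\<close> from their equations.\<close>

lemma slow_modes:
  assumes sol: "reduced_solution \<kappa> s a \<mu> P Q v z" and kap: "\<kappa> > 0" and sc: "\<bar>s\<bar> < c"
  shows "((\<lambda>x. Q x - of_real c * P x + of_real (\<mu> / (c + s) * \<kappa>) * z x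
            + of_real ((\<mu> / (c + s))\<^sup>2 * \<kappa>) * v x) has_vector_derivative
          - (of_real ((\<mu> / (c + s))^3 * \<kappa>) * v x + of_real (\<mu> / (c + s) * (a x + c\<^sup>2)) * v x)
          + of_real (\<mu> / (c + s)) * (Q x - of_real c * P x + of_real (\<mu> / (c + s) * \<kappa>) * z x
            + of_real ((\<mu> / (c + s))\<^sup>2 * \<kappa>) * v x)) (at x)"
    and "((\<lambda>x. Q x + of_real c * P x - of_real (\<mu> / (c - s) * \<kappa>) * z x
            + of_real ((\<mu> / (c - s))\<^sup>2 * \<kappa>) * v x) has_vector_derivative
          (of_real ((\<mu> / (c - s))^3 * \<kappa>) * v x + of_real (\<mu> / (c - s) * (a x + c\<^sup>2)) * v x)
          - of_real (\<mu> / (c - s)) * (Q x + of_real c * P x - of_real (\<mu> / (c - s) * \<kappa>) * z x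
            + of_real ((\<mu> / (c - s))\<^sup>2 * \<kappa>) * v x)) (at x)"
proof -
  have d: "(P has_vector_derivative of_real \<mu> * v x) (at x)"
    "(Q has_vector_derivative - of_real \<mu> * (P x - of_real s * v x)) (at x)"
    "(v has_vector_derivative z x) (at x)"
    "(z has_vector_derivative
        (Q x + of_real s * P x - of_real (s\<^sup>2 + a x) * v x) / of_real \<kappa>) (at x)"
    using sol unfolding reduced_solution_def by auto
  define \<nu> where "\<nu> = \<mu> / (c + s)"
  define \<rho> where "\<rho> = \<mu> / (c - s)"
  have m: "\<mu> = \<nu> * (c + s)" and m': "\<mu> = \<rho> * (c - s)" using sc by (auto simp: \<nu>_def \<rho>_def)
  have k: "complex_of_real \<kappa> \<noteq> 0" using kap by simp
  have e1: "of_real (b * \<kappa>) * (X / of_real \<kappa>) = of_real b * X" for b and X :: complex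
    using k by simp
  show "((\<lambda>x. Q x - of_real c * P x + of_real (\<mu> / (c + s) * \<kappa>) * z x
            + of_real ((\<mu> / (c + s))\<^sup>2 * \<kappa>) * v x) has_vector_derivative
          - (of_real ((\<mu> / (c + s))^3 * \<kappa>) * v x + of_real (\<mu> / (c + s) * (a x + c\<^sup>2)) * v x)
          + of_real (\<mu> / (c + s)) * (Q x - of_real c * P x + of_real (\<mu> / (c + s) * \<kappa>) * z x
            + of_real ((\<mu> / (c + s))\<^sup>2 * \<kappa>) * v x)) (at x)"
    unfolding \<nu>_def[symmetric]
    apply (rule has_vector_derivative_eq_rhs)
     apply (rule d derivative_intros has_vector_derivative_mult_right)+
    unfolding e1
    unfolding m of_real_mult of_real_add of_real_diff of_real_power
    by (simp add: algebra_simps power2_eq_square power3_eq_cube)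
  show "((\<lambda>x. Q x + of_real c * P x - of_real (\<mu> / (c - s) * \<kappa>) * z x
            + of_real ((\<mu> / (c - s))\<^sup>2 * \<kappa>) * v x) has_vector_derivative
          (of_real ((\<mu> / (c - s))^3 * \<kappa>) * v x + of_real (\<mu> / (c - s) * (a x + c\<^sup>2)) * v x)
          - of_real (\<mu> / (c - s)) * (Q x + of_real c * P x - of_real (\<mu> / (c - s) * \<kappa>) * z x
            + of_real ((\<mu> / (c - s))\<^sup>2 * \<kappa>) * v x)) (at x)"
    unfolding \<rho>_def[symmetric]
    apply (rule has_vector_derivative_eq_rhs)
     apply (rule d derivative_intros has_vector_derivative_mult_right)+
    unfolding e1
    unfolding m' of_real_mult of_real_add of_real_diff of_real_power
    by (simp add: algebra_simps power2_eq_square power3_eq_cube)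
qed

text \<open>Diagonalizes the pair (v, z) of the limiting equation \<kappa> v'' = (c^2 - s^2) v + Q +
  s P, whose exponents are plus and minus \<open>\<eta>\<close>; the deviation of \<open>a\<close>
  from its limit joins the forcing.\<close>

lemma fast_modes:
  assumes sol: "reduced_solution \<kappa> s a \<mu> P Q v z" and kap: "\<kappa> > 0" and sc: "\<bar>s\<bar> < c"
    and eta: "\<eta> = sqrt ((c\<^sup>2 - s\<^sup>2) / \<kappa>)"
  shows "((\<lambda>x. z x + of_real \<eta> * v x) has_vector_derivative
          (Q x + of_real s * P x - of_real (a x + c\<^sup>2) * v x) / of_real \<kappa>
          + of_real \<eta> * (z x + of_real \<eta> * v x)) (at x)"
    and "((\<lambda>x. z x - of_real \<eta> * v x) has_vector_derivative
          (Q x + of_real s * P x - of_real (a x + c\<^sup>2) * v x) / of_real \<kappa>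
          - of_real \<eta> * (z x - of_real \<eta> * v x)) (at x)"
proof -
  have d: "(v has_vector_derivative z x) (at x)"
    "(z has_vector_derivative
        (Q x + of_real s * P x - of_real (s\<^sup>2 + a x) * v x) / of_real \<kappa>) (at x)"
    using sol unfolding reduced_solution_def by auto
  have "s\<^sup>2 < c\<^sup>2" using sc by (metis abs_ge_zero power2_abs power_strict_mono pos2)
  then have "\<eta>\<^sup>2 = (c\<^sup>2 - s\<^sup>2) / \<kappa>" using eta kap by simp
  then have e: "complex_of_real \<eta> * of_real \<eta> = (of_real (c\<^sup>2) - of_real (s\<^sup>2)) / of_real \<kappa>"
    by (metis of_real_diff of_real_divide of_real_mult power2_eq_square)
  have e2: "of_real \<eta> * (of_real \<eta> * v x) = (of_real (c\<^sup>2) - of_real (s\<^sup>2)) / of_real \<kappa> * v x"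
    by (metis e mult.assoc)
  show "((\<lambda>x. z x + of_real \<eta> * v x) has_vector_derivative
          (Q x + of_real s * P x - of_real (a x + c\<^sup>2) * v x) / of_real \<kappa>
          + of_real \<eta> * (z x + of_real \<eta> * v x)) (at x)"
    apply (rule has_vector_derivative_eq_rhs)
     apply (rule d derivative_intros has_vector_derivative_mult_right)+
    by (simp add: distrib_left e2 diff_divide_distrib add_divide_distrib left_diff_distrib distrib_right)
  show "((\<lambda>x. z x - of_real \<eta> * v x) has_vector_derivative
          (Q x + of_real s * P x - of_real (a x + c\<^sup>2) * v x) / of_real \<kappa>
          - of_real \<eta> * (z x - of_real \<eta> * v x)) (at x)"
    apply (rule has_vector_derivative_eq_rhs)
     apply (rule d derivative_intros has_vector_derivative_mult_right)+
    by (simp add: right_diff_distrib e2 diff_divide_distrib add_divide_distrib left_diff_distrib distrib_right)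
qed


text \<open>Bootstrap on the supremum \<open>M\<close> of the solution over the tail. The four
  scalar modes bound everything by the data at \<open>X\<close> plus a multiple of \<open>M\<close>;
  far enough out, \<open>a\<close> is so close to its limit that this multiple is 1/2 and can be
  absorbed.\<close>

lemma tail_bound:
  assumes kap: "\<kappa> > 0" and sc: "\<bar>s\<bar> < c" and a: "(a \<longlongrightarrow> - c\<^sup>2) at_top"
  shows "\<exists>X C \<epsilon>. \<epsilon> > 0 \<and> X \<ge> 0 \<and> C \<ge> 0 \<and> (\<forall>\<mu> P Q v z. 0 < \<mu> \<longrightarrow> \<mu> < \<epsilon> \<longrightarrow> reduced_solution \<kappa> s a \<mu> P Q v z \<longrightarrow>
    (P \<longlongrightarrow> 0) at_top \<longrightarrow> (Q \<longlongrightarrow> 0) at_top \<longrightarrow> (v \<longlongrightarrow> 0) at_top \<longrightarrow> (z \<longlongrightarrow> 0) at_top \<longrightarrow>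
    (\<forall>x\<ge>X. norm (P x) + norm (Q x) + norm (v x) + norm (z x) \<le>
       C * (norm (P X) + norm (Q X) + norm (v X) + norm (z X))))"
proof -
  define \<eta> where "\<eta> = sqrt ((c\<^sup>2 - s\<^sup>2) / \<kappa>)"
  have "s\<^sup>2 < c\<^sup>2" using sc by (metis abs_ge_zero power2_abs power_strict_mono pos2)
  then have eta: "\<eta> > 0" using kap by (simp add: \<eta>_def)
  have c0: "c > 0" using sc by linarith
  \<comment> \<open>\<open>K1\<close> and \<open>K2\<close> are the constants of inverting the mode
    transformation: \<open>K1\<close> multiplies the slow amplitude \<open>A\<close>,
    \<open>K2\<close> the data at \<open>X\<close>. The tolerance \<open>\<theta>\<close> is tuned
    to \<open>K1 * \<theta> = 1 / 2\<close>.\<close>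
  define K1 where "K1 = 1 + 1 / c + 3 / (\<kappa> * \<eta>) * (1 + 1 / \<eta>)"
  define K2 where "K2 = (1 + \<eta>) * (1 + 1 / \<eta>)"
  have K1: "K1 > 1" using c0 kap eta by (simp add: K1_def add_pos_pos)
  have K2: "K2 > 0" using eta by (simp add: K2_def add_pos_pos)
  define \<theta> where "\<theta> = 1 / (2 * K1)"
  have th: "\<theta> > 0" "\<theta> \<le> 1" "K1 * \<theta> = 1 / 2" using K1 by (auto simp: \<theta>_def)
  have "\<forall>\<^sub>F x in at_top. dist (a x) (- c\<^sup>2) < \<theta> / 2" using a th(1) by (intro tendstoD) auto
  then obtain X0 where X0: "\<And>x. x \<ge> X0 \<Longrightarrow> dist (a x) (- c\<^sup>2) < \<theta> / 2"
    by (auto simp: eventually_at_top_linorder)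
  define X where "X = max X0 0"
  have aX: "\<bar>a x + c\<^sup>2\<bar> \<le> \<theta> / 2" if "x \<ge> X" for x
    using X0[of x] that by (auto simp: X_def dist_real_def)
  \<comment> \<open>An exponent at most \<open>t\<close> makes the correction terms in
    \<open>z\<close> and \<open>v\<close> cost at most \<open>\<theta> / 2\<close>. Both
    \<open>c + s\<close> and \<open>c - s\<close> are at least c - |s|, so the bound
    \<open>\<epsilon>\<close> on \<open>\<mu>\<close> controls both slow exponents.\<close>
  define t where "t = min 1 (\<theta> / (6 * \<kappa>))"
  have t0: "t > 0" using th kap by (simp add: t_def)
  define \<epsilon> where "\<epsilon> = (c - \<bar>s\<bar>) * t"
  have e0: "\<epsilon> > 0" using sc t0 by (simp add: \<epsilon>_def)
  define C where "C = 2 * (K1 * (2 + c) + K2)"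
  have C0: "C \<ge> 0" using K1 K2 c0 by (simp add: C_def)
  have main: "norm (P x) + norm (Q x) + norm (v x) + norm (z x) \<le>
       C * (norm (P X) + norm (Q X) + norm (v X) + norm (z X))"
    if mu: "0 < \<mu>" "\<mu> < \<epsilon>" and sol: "reduced_solution \<kappa> s a \<mu> P Q v z"
      and lim: "(P \<longlongrightarrow> 0) at_top" "(Q \<longlongrightarrow> 0) at_top" "(v \<longlongrightarrow> 0) at_top" "(z \<longlongrightarrow> 0) at_top"
      and x: "x \<ge> X" for \<mu> P Q v z x
  proof -
    define S where "S = (\<lambda>x. norm (P x) + norm (Q x) + norm (v x) + norm (z x))"
    have limS: "(S \<longlongrightarrow> 0) at_top" unfolding S_def
      using tendsto_add[OF tendsto_add[OF tendsto_add[OF tendsto_norm[OF lim(1)] tendsto_norm[OF lim(2)]] tendsto_norm[OF lim(3)]] tendsto_norm[OF lim(4)]]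
      by simp
    have contS: "continuous_on UNIV S" unfolding S_def
      using sol unfolding reduced_solution_def
      by (intro continuous_intros continuous_at_imp_continuous_on ballI) (auto intro!: has_vector_derivative_continuous)
    have "\<forall>\<^sub>F x in at_top. dist (S x) 0 < 1" using limS by (intro tendstoD) auto
    then obtain T where T: "\<And>x. x \<ge> T \<Longrightarrow> \<bar>S x\<bar> < 1"
      by (auto simp: eventually_at_top_linorder)
    have "compact (S ` {X..max X T})" using contS
      by (intro compact_continuous_image continuous_on_subset[OF contS]) auto
    then obtain B where B: "\<And>x. x \<in> {X..max X T} \<Longrightarrow> \<bar>S x\<bar> \<le> B"
      using compact_imp_bounded bounded_iff by (metis image_eqI real_norm_def)
    have "S x \<le> max B 1" if "x \<ge> X" for x
      using B[of x] T[of x] that by (cases "x \<le> T") (auto simp: max_def)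
    then have bdd: "bdd_above (S ` {X..})" by (auto simp: bdd_above_def)
    \<comment> \<open>Absorption needs a finite supremum: compactness handles the bounded part,
      decay of this particular solution the rest. No uniformity in \<open>\<mu>\<close> is claimed
      yet.\<close>
    define M where "M = Sup (S ` {X..})"
    have SM: "S y \<le> M" if "y \<ge> X" for y unfolding M_def using that by (intro cSup_upper bdd) auto
    have S0: "S y \<ge> 0" for y by (simp add: S_def)
    have M0: "M \<ge> 0" using SM[of X] S0[of X] by simp
    have vM: "norm (v y) \<le> M" "norm (z y) \<le> M" if "y \<ge> X" for y using SM[OF that] by (auto simp: S_def add.commute add_increasing2)
      (smt (verit) norm_ge_zero)+
    have at_X: "norm (P X) \<le> S X" "norm (Q X) \<le> S X" "norm (v X) \<le> S X" "norm (z X) \<le> S X"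
      by (auto simp: S_def)
    define \<nu> where "\<nu> = \<mu> / (c + s)"
    define \<rho> where "\<rho> = \<mu> / (c - s)"
    have small: "0 < r \<and> 2 * (r\<^sup>2 * \<kappa>) + r * \<kappa> \<le> \<theta> / 2" if r: "r = \<mu> / b" "b \<ge> c - \<bar>s\<bar>" for r b
    proof -
      have b: "b > 0" using r sc by linarith
      have "\<mu> \<le> b * t" using mu(2) r(2) t0 unfolding \<epsilon>_def
        by (smt (verit, best) mult_right_mono)
      then have rt: "r \<le> t" using b r(1) by (simp add: divide_le_eq mult.commute)
      have r0: "r > 0" using r(1) b mu by simp
      have "r \<le> 1" using rt by (simp add: t_def)
      then have "r\<^sup>2 \<le> r" using r0 by (simp add: power2_eq_square mult_left_le)
      then have "r\<^sup>2 * \<kappa> \<le> r * \<kappa>" using kap by simp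
      moreover have "r * \<kappa> \<le> \<theta> / 6" using rt kap by (simp add: t_def field_simps)
      ultimately show ?thesis using r0 by linarith
    qed
    have nu: "0 < \<nu>" "2 * (\<nu>\<^sup>2 * \<kappa>) + \<nu> * \<kappa> \<le> \<theta> / 2" using small[OF \<nu>_def] by auto
    have rho: "0 < \<rho>" "2 * (\<rho>\<^sup>2 * \<kappa>) + \<rho> * \<kappa> \<le> \<theta> / 2" using small[OF \<rho>_def] by auto
    have forcing: "norm (of_real (r^3 * \<kappa>) * v y + of_real (r * (a y + c\<^sup>2)) * v y) \<le> r^3 * \<kappa> * M + r * (\<theta> / 2) * M"
      if "r > 0" "y \<ge> X" for r y
      using that kap aX[of y] vM[of y]
      by (intro norm_add_le norm_of_real_mult_le) (auto simp: abs_mult)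
    \<comment> \<open>The growing slow mode contributes no data at \<open>X\<close>, only a part of
      \<open>M\<close>; all dependence on \<open>S X\<close> enters through the two decaying
      modes.\<close>
    have bR: "norm (Q y - of_real c * P y) \<le> \<theta> * M" if y: "y \<ge> X" for y
    proof -
      have l: "((\<lambda>x. Q x - of_real c * P x + of_real (\<nu> * \<kappa>) * z x
            + of_real (\<nu>\<^sup>2 * \<kappa>) * v x) \<longlongrightarrow> 0) at_top"
        using tendsto_add[OF tendsto_add[OF tendsto_diff[OF lim(2) tendsto_mult_right_zero[OF lim(1)]]
              tendsto_mult_right_zero[OF lim(4)]] tendsto_mult_right_zero[OF lim(3)]] by simp
      have "norm (Q y - of_real c * P y + of_real (\<nu> * \<kappa>) * z y + of_real (\<nu>\<^sup>2 * \<kappa>) * v y)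
          \<le> (\<nu>^3 * \<kappa> * M + \<nu> * (\<theta> / 2) * M) / \<nu>"
        by (rule unstable_scalar_bound[OF nu(1) slow_modes(1)[OF sol kap sc, folded \<nu>_def] _ y l])
          (subst norm_minus_cancel, rule forcing[OF nu(1)])
      also have "\<dots> = (\<nu>\<^sup>2 * \<kappa> + \<theta> / 2) * M"
        using nu(1) by (simp add: power2_eq_square power3_eq_cube field_simps)
      finally have 1: "norm (Q y - of_real c * P y + of_real (\<nu> * \<kappa>) * z y + of_real (\<nu>\<^sup>2 * \<kappa>) * v y)
          \<le> (\<nu>\<^sup>2 * \<kappa> + \<theta> / 2) * M" .
      have 2: "norm (of_real (\<nu> * \<kappa>) * z y) \<le> \<nu> * \<kappa> * M" "norm (of_real (\<nu>\<^sup>2 * \<kappa>) * v y) \<le> \<nu>\<^sup>2 * \<kappa> * M"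
        using nu(1) kap by (auto intro: norm_of_real_mult_le[OF vM(2)[OF y]] norm_of_real_mult_le[OF vM(1)[OF y]] simp del: of_real_mult of_real_power simp: abs_mult)
      have "norm (Q y - of_real c * P y) \<le> ((\<nu>\<^sup>2 * \<kappa> + \<theta> / 2) * M + \<nu>\<^sup>2 * \<kappa> * M) + \<nu> * \<kappa> * M"
        using norm_diff_le[OF norm_diff_le[OF 1 2(2)] 2(1)] by simp
      also have "\<dots> = (2 * (\<nu>\<^sup>2 * \<kappa>) + \<nu> * \<kappa> + \<theta> / 2) * M" by (simp add: algebra_simps)
      also have "\<dots> \<le> \<theta> * M" using nu(2) M0 by (intro mult_right_mono) auto
      finally show ?thesis .
    qed
    have bS: "norm (Q y + of_real c * P y) \<le> (2 + c) * S X + \<theta> * M" if y: "y \<ge> X" for y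
    proof -
      let ?h = "\<lambda>x. Q x + of_real c * P x - of_real (\<rho> * \<kappa>) * z x + of_real (\<rho>\<^sup>2 * \<kappa>) * v x"
      have "norm (?h y) \<le> norm (?h X) + (\<rho>^3 * \<kappa> * M + \<rho> * (\<theta> / 2) * M) / \<rho>"
        by (rule stable_scalar_bound[OF rho(1) slow_modes(2)[OF sol kap sc, folded \<rho>_def] _ y])
          (rule forcing[OF rho(1)])
      moreover have "(\<rho>^3 * \<kappa> * M + \<rho> * (\<theta> / 2) * M) / \<rho> = (\<rho>\<^sup>2 * \<kappa> + \<theta> / 2) * M"
        using rho(1) by (simp add: power2_eq_square power3_eq_cube field_simps)
      moreover have "norm (?h X) \<le> S X + c * S X + \<rho> * \<kappa> * S X + \<rho>\<^sup>2 * \<kappa> * S X"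
        using c0 rho(1) kap at_X
        by (intro norm_add_le norm_diff_le norm_of_real_mult_le) (auto simp: abs_mult)
      moreover have "\<dots> \<le> (2 + c) * S X"
      proof -
        have "(1 + c + \<rho> * \<kappa> + \<rho>\<^sup>2 * \<kappa>) * S X \<le> (2 + c) * S X"
        proof (rule mult_right_mono[OF _ S0])
          have "0 \<le> \<rho>\<^sup>2 * \<kappa>" using kap by simp
          then show "1 + c + \<rho> * \<kappa> + \<rho>\<^sup>2 * \<kappa> \<le> 2 + c" using rho(2) th(2) by linarith
        qed
        then show ?thesis by (simp add: algebra_simps)
      qed
      ultimately have 1: "norm (?h y) \<le> (2 + c) * S X + (\<rho>\<^sup>2 * \<kappa> + \<theta> / 2) * M" by linarith
      have 2: "norm (of_real (\<rho> * \<kappa>) * z y) \<le> \<rho> * \<kappa> * M" "norm (of_real (\<rho>\<^sup>2 * \<kappa>) * v y) \<le> \<rho>\<^sup>2 * \<kappa> * M"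
        using rho(1) kap by (auto intro: norm_of_real_mult_le[OF vM(2)[OF y]] norm_of_real_mult_le[OF vM(1)[OF y]] simp del: of_real_mult of_real_power simp: abs_mult)
      have "norm (Q y + of_real c * P y) \<le> ((2 + c) * S X + (\<rho>\<^sup>2 * \<kappa> + \<theta> / 2) * M + \<rho>\<^sup>2 * \<kappa> * M) + \<rho> * \<kappa> * M"
        using norm_add_le[OF norm_diff_le[OF 1 2(2)] 2(1)] by simp
      also have "\<dots> = (2 + c) * S X + (2 * (\<rho>\<^sup>2 * \<kappa>) + \<rho> * \<kappa> + \<theta> / 2) * M" by (simp add: algebra_simps)
      also have "\<dots> \<le> (2 + c) * S X + \<theta> * M" using rho(2) M0 by (intro add_left_mono mult_right_mono) auto
      finally show ?thesis .
    qed
    define A where "A = (2 + c) * S X + \<theta> * M"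
    have A0: "A \<ge> 0" and AM: "\<theta> * M \<le> A" using S0[of X] M0 th c0 by (auto simp: A_def)
    have bQ: "norm (Q y) \<le> A" and bP: "norm (P y) \<le> A / c" if y: "y \<ge> X" for y
    proof -
      have "norm (2 * Q y) \<le> \<theta> * M + A"
        using norm_add_le[OF bR[OF y] bS[OF y]] by (simp add: A_def)
      then show "norm (Q y) \<le> A" using AM by (simp add: norm_mult)
      have "norm (2 * of_real c * P y) \<le> A + \<theta> * M"
      proof -
        have "2 * of_real c * P y = Q y + of_real c * P y - (Q y - of_real c * P y)" by simp
        then show ?thesis using norm_diff_le[OF bS[OF y] bR[OF y]] unfolding A_def by metis
      qed
      then have "2 * c * norm (P y) \<le> A + A" using AM c0 by (simp add: norm_mult)
      then show "norm (P y) \<le> A / c" using c0 by (simp add: field_simps)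
    qed
    have bg: "norm ((Q y + of_real s * P y - of_real (a y + c\<^sup>2) * v y) / of_real \<kappa>) \<le> 3 * A / \<kappa>"
      if y: "y \<ge> X" for y
    proof -
      have "norm (Q y + of_real s * P y - of_real (a y + c\<^sup>2) * v y) \<le> A + c * (A / c) + \<theta> / 2 * M"
        using sc bQ[OF y] bP[OF y] aX[OF y] vM(1)[OF y]
        by (intro norm_add_le norm_diff_le norm_of_real_mult_le) auto
      also have "\<dots> \<le> 3 * A" using AM A0 c0 M0 th by simp
      finally show ?thesis using kap by (simp add: norm_divide divide_right_mono)
    qed
    have zp: "norm (z y + of_real \<eta> * v y) \<le> 3 * A / (\<kappa> * \<eta>)" if y: "y \<ge> X" for y
    proof -
      have l: "((\<lambda>x. z x + of_real \<eta> * v x) \<longlongrightarrow> 0) at_top"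
        using tendsto_add[OF lim(4) tendsto_mult_right_zero[OF lim(3)]] by simp
      show ?thesis
        using unstable_scalar_bound[OF eta fast_modes(1)[OF sol kap sc \<eta>_def] bg y l] by simp
    qed
    have zm: "norm (z y - of_real \<eta> * v y) \<le> (1 + \<eta>) * S X + 3 * A / (\<kappa> * \<eta>)" if y: "y \<ge> X" for y
    proof -
      have "norm (z X - of_real \<eta> * v X) \<le> S X + \<eta> * S X"
        using eta at_X by (intro norm_diff_le norm_of_real_mult_le) auto
      then show ?thesis
        using stable_scalar_bound[OF eta fast_modes(2)[OF sol kap sc \<eta>_def] bg y] by (simp add: algebra_simps)
    qed
    define B where "B = (1 + \<eta>) * S X + 3 * A / (\<kappa> * \<eta>)"
    have pB: "3 * A / (\<kappa> * \<eta>) \<le> B" using eta S0[of X] by (simp add: B_def)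
    have bz: "norm (z y) \<le> B" and bv: "norm (v y) \<le> B / \<eta>" if y: "y \<ge> X" for y
    proof -
      have 1: "norm (z y + of_real \<eta> * v y) \<le> B" using zp[OF y] pB by linarith
      have 2: "norm (z y - of_real \<eta> * v y) \<le> B" using zm[OF y] by (simp add: B_def)
      have "norm (2 * z y) \<le> B + B" using norm_add_le[OF 1 2] by simp
      then show "norm (z y) \<le> B" by (simp add: norm_mult)
      have "2 * of_real \<eta> * v y = z y + of_real \<eta> * v y - (z y - of_real \<eta> * v y)" by simp
      then have "norm (2 * of_real \<eta> * v y) \<le> B + B" using norm_diff_le[OF 1 2] by metis
      then have "2 * \<eta> * norm (v y) \<le> B + B" using eta by (simp add: norm_mult)
      then show "norm (v y) \<le> B / \<eta>" using eta by (simp add: field_simps)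
    qed
    have Sall: "S y \<le> C / 2 * S X + M / 2" if y: "y \<ge> X" for y
    proof -
      have "S y \<le> A / c + A + B / \<eta> + B" unfolding S_def using bP[OF y] bQ[OF y] bv[OF y] bz[OF y] by linarith
      also have "\<dots> = K1 * A + K2 * S X" using eta c0 kap by (simp add: K1_def K2_def B_def field_simps)
      also have "K1 * A = K1 * (2 + c) * S X + (K1 * \<theta>) * M" by (simp add: A_def algebra_simps)
      also have "\<dots> + K2 * S X = C / 2 * S X + M / 2" unfolding th(3) C_def by (simp add: algebra_simps)
      finally show ?thesis .
    qed
    have "M \<le> C / 2 * S X + M / 2" unfolding M_def by (intro cSup_least) (use Sall M_def in auto)
    then have "M \<le> C * S X" by simp
    then show ?thesis using SM[OF x] by (simp add: S_def)
  qed
  have X0: "X \<ge> 0" by (simp add: X_def)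
  show ?thesis
    by (rule exI[of _ X], rule exI[of _ C], rule exI[of _ \<epsilon>]) (use e0 X0 C0 main in blast)
qed

lemma gronwall_norm:
  fixes W :: "real \<Rightarrow> 'a::real_inner"
  assumes ab: "a \<le> b"
    and d: "\<And>x. a \<le> x \<Longrightarrow> x \<le> b \<Longrightarrow> (W has_vector_derivative W' x) (at x)"
    and le: "\<And>x. a \<le> x \<Longrightarrow> x \<le> b \<Longrightarrow> norm (W' x) \<le> K * norm (W x)"
  shows "norm (W b) \<le> exp (K * (b - a)) * norm (W a)"
proof -
  let ?h = "\<lambda>x. exp (- (2 * K) * (x - a)) * (W x \<bullet> W x)"
  have "?h b \<le> ?h a"
  proof (rule DERIV_nonpos_imp_nonincreasing[OF ab])
    fix x assume x: "a \<le> x" "x \<le> b"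
    have dW: "((\<lambda>x. W x \<bullet> W x) has_real_derivative 2 * (W x \<bullet> W' x)) (at x)"
      using bounded_bilinear.has_vector_derivative[OF bounded_bilinear_inner d[OF x] d[OF x]]
      by (simp add: has_real_derivative_iff_has_vector_derivative inner_commute)
    have "(?h has_real_derivative exp (- (2 * K) * (x - a)) * (2 * (W x \<bullet> W' x) - 2 * K * (W x \<bullet> W x))) (at x)"
      by (auto intro!: derivative_eq_intros dW simp: algebra_simps)
    moreover have "W x \<bullet> W' x \<le> K * (W x \<bullet> W x)"
    proof -
      have "W x \<bullet> W' x \<le> norm (W x) * norm (W' x)" by (rule norm_cauchy_schwarz)
      also have "\<dots> \<le> norm (W x) * (K * norm (W x))" by (intro mult_left_mono le x) auto
      finally show ?thesis by (simp add: power2_norm_eq_inner[symmetric] power2_eq_square algebra_simps)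
    qed
    ultimately show "\<exists>y. (?h has_real_derivative y) (at x) \<and> y \<le> 0"
      by (intro exI conjI) (auto simp: mult_le_0_iff)
  qed
  then have "exp (- (2 * K) * (b - a)) * (norm (W b))\<^sup>2 \<le> (norm (W a))\<^sup>2"
    by (simp add: power2_norm_eq_inner)
  then have "exp (2 * K * (b - a)) * (exp (- (2 * K) * (b - a)) * (norm (W b))\<^sup>2) \<le> exp (2 * K * (b - a)) * (norm (W a))\<^sup>2"
    by (intro mult_left_mono) auto
  then have "(norm (W b))\<^sup>2 \<le> exp (2 * K * (b - a)) * (norm (W a))\<^sup>2"
    by (simp add: mult.assoc[symmetric] exp_add[symmetric])
  also have "\<dots> = (exp (K * (b - a)) * norm (W a))\<^sup>2"
    by (simp add: power_mult_distrib exp_double[symmetric] mult.assoc)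
  finally show ?thesis by (rule power2_le_imp_le) simp
qed

text \<open>\<open>X\<close> in the tail bound does not depend on \<open>\<mu>\<close>, so
  Gronwall's inequality on the fixed interval from 0 to \<open>X\<close> moves the reference point
  to 0 with a constant uniform in \<open>\<mu>\<close> < 1.\<close>

lemma half_line_bound:
  assumes kap: "\<kappa> > 0" and sc: "\<bar>s\<bar> < c" and a: "(a \<longlongrightarrow> - c\<^sup>2) at_top" and cont: "continuous_on UNIV a"
  shows "\<exists>C \<epsilon>. \<epsilon> > 0 \<and> (\<forall>\<mu> P Q v z. 0 < \<mu> \<longrightarrow> \<mu> < \<epsilon> \<longrightarrow> reduced_solution \<kappa> s a \<mu> P Q v z \<longrightarrow>
    (P \<longlongrightarrow> 0) at_top \<longrightarrow> (Q \<longlongrightarrow> 0) at_top \<longrightarrow> (v \<longlongrightarrow> 0) at_top \<longrightarrow> (z \<longlongrightarrow> 0) at_top \<longrightarrow>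
    (\<forall>x\<ge>0. norm (P x) + norm (Q x) + norm (v x) + norm (z x) \<le>
       C * (norm (P 0) + norm (Q 0) + norm (v 0) + norm (z 0))))"
proof -
  obtain X C \<epsilon> where e0: "\<epsilon> > 0" and X0: "X \<ge> 0" and C0: "C \<ge> 0"
    and tail: "\<And>\<mu> P Q v z x. \<lbrakk>0 < \<mu>; \<mu> < \<epsilon>; reduced_solution \<kappa> s a \<mu> P Q v z;
      (P \<longlongrightarrow> 0) at_top; (Q \<longlongrightarrow> 0) at_top; (v \<longlongrightarrow> 0) at_top; (z \<longlongrightarrow> 0) at_top; x \<ge> X\<rbrakk> \<Longrightarrow>
      norm (P x) + norm (Q x) + norm (v x) + norm (z x) \<le>
       C * (norm (P X) + norm (Q X) + norm (v X) + norm (z X))"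
    using tail_bound[OF kap sc a] by metis
  have "compact (a ` {0..X})" by (intro compact_continuous_image continuous_on_subset[OF cont]) auto
  then obtain A where A: "\<And>x. x \<in> {0..X} \<Longrightarrow> \<bar>a x\<bar> \<le> A"
    using compact_imp_bounded bounded_iff by (metis image_eqI real_norm_def)
  have A0: "A \<ge> 0" using A[of 0] X0 by simp
  define K where "K = 4 + 2 * \<bar>s\<bar> + (1 + \<bar>s\<bar> + s\<^sup>2 + A) / \<kappa>"
  have K0: "K \<ge> 0" using kap A0 by (simp add: K_def)
  define C1 where "C1 = 4 * exp (K * X)"
  have main: "norm (P x) + norm (Q x) + norm (v x) + norm (z x) \<le>
       (C1 + C * C1) * (norm (P 0) + norm (Q 0) + norm (v 0) + norm (z 0))"
    if mu: "0 < \<mu>" "\<mu> < min \<epsilon> 1" and sol: "reduced_solution \<kappa> s a \<mu> P Q v z"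
      and lim: "(P \<longlongrightarrow> 0) at_top" "(Q \<longlongrightarrow> 0) at_top" "(v \<longlongrightarrow> 0) at_top" "(z \<longlongrightarrow> 0) at_top"
      and x: "x \<ge> 0" for \<mu> P Q v z x
  proof -
    define S where "S = (\<lambda>x. norm (P x) + norm (Q x) + norm (v x) + norm (z x))"
    have S0: "S y \<ge> 0" for y by (simp add: S_def)
    have d: "(P has_vector_derivative of_real \<mu> * v x) (at x)"
      "(Q has_vector_derivative - of_real \<mu> * (P x - of_real s * v x)) (at x)"
      "(v has_vector_derivative z x) (at x)"
      "(z has_vector_derivative
        (Q x + of_real s * P x - of_real (s\<^sup>2 + a x) * v x) / of_real \<kappa>) (at x)" for x
      using sol unfolding reduced_solution_def by auto
    define W where "W = (\<lambda>x. (P x, Q x, v x, z x))"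
    define W' where "W' = (\<lambda>x. (of_real \<mu> * v x, - of_real \<mu> * (P x - of_real s * v x), z x,
        (Q x + of_real s * P x - of_real (s\<^sup>2 + a x) * v x) / of_real \<kappa>))"
    have dW: "(W has_vector_derivative W' x) (at x)" for x
      unfolding W_def W'_def by (intro has_vector_derivative_Pair d)
    have n4: "norm (p, q, r, t) \<le> norm p + norm q + norm r + norm t" for p q r t :: complex
      using norm_Pair_le[of p "(q, r, t)"] norm_Pair_le[of q "(r, t)"] norm_Pair_le[of r t] by linarith
    have c4: "norm (P y) \<le> norm (W y)" "norm (Q y) \<le> norm (W y)" "norm (v y) \<le> norm (W y)" "norm (z y) \<le> norm (W y)" for y
      unfolding W_def
      using norm_fst_le[of "P y" "(Q y, v y, z y)"] norm_snd_le[of "(Q y, v y, z y)" "P y"]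
        norm_fst_le[of "Q y" "(v y, z y)"] norm_snd_le[of "(v y, z y)" "Q y"]
        norm_fst_le[of "v y" "z y"] norm_snd_le[of "z y" "v y"] by linarith+
    have gr: "norm (W' y) \<le> K * norm (W y)" if y: "0 \<le> y" "y \<le> X" for y
    proof -
      let ?n = "norm (W y)"
      have 1: "norm (of_real \<mu> * v y) \<le> 1 * ?n" using mu c4 by (intro norm_of_real_mult_le) auto
      have "norm (P y - of_real s * v y) \<le> ?n + \<bar>s\<bar> * ?n" using c4 by (intro norm_diff_le norm_of_real_mult_le) auto
      then have 2: "norm (of_real \<mu> * (P y - of_real s * v y)) \<le> 1 * (?n + \<bar>s\<bar> * ?n)"
        using mu by (intro norm_of_real_mult_le) auto
      have aa: "\<bar>s\<^sup>2 + a y\<bar> \<le> s\<^sup>2 + A"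
        using A[of y] y zero_le_power2[of s] unfolding abs_le_iff atLeastAtMost_iff by linarith
      have "norm (Q y + of_real s * P y - of_real (s\<^sup>2 + a y) * v y) \<le> ?n + \<bar>s\<bar> * ?n + (s\<^sup>2 + A) * ?n"
        using c4 aa by (intro norm_add_le norm_diff_le norm_of_real_mult_le) auto
      then have 3: "norm ((Q y + of_real s * P y - of_real (s\<^sup>2 + a y) * v y) / of_real \<kappa>) \<le> (?n + \<bar>s\<bar> * ?n + (s\<^sup>2 + A) * ?n) / \<kappa>"
        using kap by (simp add: norm_divide divide_right_mono)
      have "norm (W' y) \<le> 1 * ?n + 1 * (?n + \<bar>s\<bar> * ?n) + ?n + (?n + \<bar>s\<bar> * ?n + (s\<^sup>2 + A) * ?n) / \<kappa>"
        unfolding W'_def using n4[of "of_real \<mu> * v y" "- of_real \<mu> * (P y - of_real s * v y)" "z y"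
          "(Q y + of_real s * P y - of_real (s\<^sup>2 + a y) * v y) / of_real \<kappa>"] 1 2 3 c4(4)[of y]
        by (simp only: mult_minus_left norm_minus_cancel)
      also have "\<dots> = (3 + \<bar>s\<bar> + (1 + \<bar>s\<bar> + s\<^sup>2 + A) / \<kappa>) * ?n"
        using kap by (simp add: field_simps)
      also have "\<dots> \<le> K * ?n" unfolding K_def by (intro mult_right_mono) auto
      finally show ?thesis .
    qed
    have near: "S y \<le> C1 * S 0" if y: "0 \<le> y" "y \<le> X" for y
    proof -
      have "norm (W y) \<le> exp (K * (y - 0)) * norm (W 0)"
        by (rule gronwall_norm[OF y(1)]) (use dW gr y in auto)
      also have "\<dots> \<le> exp (K * X) * S 0"
        using y K0 n4[of "P 0" "Q 0" "v 0" "z 0"]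
        by (intro mult_mono) (auto simp: W_def S_def mult_left_mono)
      finally show ?thesis unfolding C1_def S_def using c4[of y] by (simp add: S_def)
    qed
    have C10: "C1 \<ge> 0" by (simp add: C1_def)
    show ?thesis
    proof (cases "x \<le> X")
      case True
      have "0 \<le> C * C1 * S 0" using C0 C10 S0[of 0] by simp
      then show ?thesis using near[OF x True] by (simp add: S_def algebra_simps)
    next
      case False
      have "S x \<le> C * S X" using tail[OF mu(1) _ sol lim, of x] mu(2) False by (simp add: S_def)
      also have "\<dots> \<le> C * (C1 * S 0)" using near[of X] X0 C0 by (intro mult_left_mono) auto
      finally have "S x \<le> C * C1 * S 0" by (simp add: mult.assoc)
      moreover have "0 \<le> C1 * S 0" using C10 S0[of 0] by simp
      ultimately have "S x \<le> (C1 + C * C1) * S 0" by (simp add: algebra_simps)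
      then show ?thesis by (simp add: S_def)
    qed
  qed
  show ?thesis
    by (rule exI[of _ "C1 + C * C1"], rule exI[of _ "min \<epsilon> 1"]) (use main e0 in auto)
qed

section \<open>Adjoint pairing on a half-line\<close>


lemma einterval_0_infinity: "einterval 0 \<infinity> = {0<..}"
  by (auto simp: einterval_def zero_ereal_def)

lemma exp_decay_tendsto_0:
  assumes "k > 0" shows "((\<lambda>x::real. C * exp (- (k * x))) \<longlongrightarrow> 0) at_top"
proof -
  have "filterlim (\<lambda>x. k * x) at_top at_top"
    by (rule filterlim_tendsto_pos_mult_at_top[OF tendsto_const assms filterlim_ident])
  then have "((\<lambda>x. exp (- (k * x))) \<longlongrightarrow> 0) at_top"
    by (rule filterlim_compose[OF exp_at_bot filterlim_compose[OF filterlim_uminus_at_bot_at_top]])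
  from tendsto_mult_right_zero[OF this] show ?thesis .
qed

lemma tendsto_0_exp_decay:
  fixes F :: "real \<Rightarrow> 'a::real_normed_vector"
  assumes "k > 0" "\<And>x. x \<ge> 0 \<Longrightarrow> norm (F x) \<le> C * exp (- (k * x))"
  shows "(F \<longlongrightarrow> 0) at_top"
  by (rule Lim_null_comparison[OF eventually_mono[OF eventually_ge_at_top[of 0] assms(2)]
        exp_decay_tendsto_0[OF assms(1)]])

lemma set_integrable_exp_decay:
  fixes k C :: real
  assumes k: "k > 0" shows "set_integrable lborel {0<..} (\<lambda>x. C * exp (- (k * x)))"
    and "(LINT x:{0<..}|lborel. C * exp (- (k * x))) = C / k"
proof -
  have 1: "((\<lambda>x::real. - (1 / k) * exp (- (k * x))) \<longlongrightarrow> - (1 / k)) (at_right 0)"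
    by (rule tendsto_eq_intros | simp)+
  have 2: "((\<lambda>x. - (1 / k) * exp (- (k * x))) \<longlongrightarrow> 0) at_top"
    by (rule exp_decay_tendsto_0[OF k])
  have d: "((\<lambda>x. - (1 / k) * exp (- (k * x))) has_real_derivative exp (- (k * x))) (at x)" for x
    using k by (auto intro!: derivative_eq_intros)
  have A: "(((\<lambda>x. - (1 / k) * exp (- (k * x))) \<circ> real_of_ereal) \<longlongrightarrow> - (1 / k)) (at_right 0)"
    "(((\<lambda>x. - (1 / k) * exp (- (k * x))) \<circ> real_of_ereal) \<longlongrightarrow> 0) (at_left \<infinity>)"
    using 1 2 by (simp_all add: ereal_tendsto_simps zero_ereal_def)
  note F = interval_integral_FTC_nonneg[of 0 \<infinity> "\<lambda>x. - (1 / k) * exp (- (k * x))" "\<lambda>x. exp (- (k * x))", OF _ d _ _ A]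
  have i: "set_integrable lborel {0<..} (\<lambda>x. exp (- (k * x)))"
    using F(1) by (simp add: einterval_0_infinity)
  then show "set_integrable lborel {0<..} (\<lambda>x. C * exp (- (k * x)))"
    by (rule set_integrable_mult_right)
  have "(LBINT x=0..\<infinity>. exp (- (k * x))) = 1 / k" using F(2) by simp
  then have "(LINT x:{0<..}|lborel. exp (- (k * x))) = 1 / k"
    by (simp add: interval_lebesgue_integral_0_infty)
  then show "(LINT x:{0<..}|lborel. C * exp (- (k * x))) = C / k" by simp
qed

lemma set_integrable_continuous_exp_decay:
  fixes f :: "real \<Rightarrow> 'a::euclidean_space"
  assumes k: "k > 0" and cont: "continuous_on UNIV f"
    and le: "\<And>x. x \<ge> 0 \<Longrightarrow> norm (f x) \<le> C * exp (- (k * x))"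
  shows "set_integrable lborel {0<..} f"
proof (rule set_integrable_bound[OF set_integrable_exp_decay(1)[OF k, of C]])
  show "set_borel_measurable lborel {0<..} f"
    unfolding set_borel_measurable_def using borel_measurable_continuous_onI[OF cont] by measurable
  show "AE x in lborel. x \<in> {0<..} \<longrightarrow> norm (f x) \<le> norm (C * exp (- (k * x)))"
    using le by (intro AE_I2 impI order_trans[OF le]) auto
qed

lemma half_line_FTC:
  fixes f F :: "real \<Rightarrow> 'a::euclidean_space"
  assumes d: "\<And>x. (F has_vector_derivative f x) (at x)" and cont: "continuous_on UNIV f"
    and int: "set_integrable lborel {0<..} f" and lim: "(F \<longlongrightarrow> L) at_top"
  shows "(LINT x:{0<..}|lborel. f x) = L - F 0"
proof -
  have "isCont F 0" using d has_vector_derivative_continuous by blast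
  then have "(F \<longlongrightarrow> F 0) (at_right 0)"
    by (simp add: isCont_def filterlim_at_split)
  then have A: "((F \<circ> real_of_ereal) \<longlongrightarrow> F 0) (at_right 0)" "((F \<circ> real_of_ereal) \<longlongrightarrow> L) (at_left \<infinity>)"
    using lim by (simp_all add: ereal_tendsto_simps zero_ereal_def)
  have "(LBINT x=0..\<infinity>. f x) = L - F 0"
    by (rule interval_integral_FTC_integrable[OF _ d _ _ A])
      (use cont int in \<open>auto simp: einterval_0_infinity continuous_on_eq_continuous_at\<close>)
  then show ?thesis by (simp add: interval_lebesgue_integral_0_infty)
qed

text \<open>Dominated convergence for integrals over the half-line, phrased through antiderivatives that
  vanish at infinity. The perturbation \<open>h\<close> is only dominated with slowly vanishing exponents \<open>\<nu>\<close>,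
  but its integral is at most \<open>\<delta>\<close>.\<close>

lemma antiderivative_limit:
  fixes f h F :: "nat \<Rightarrow> real \<Rightarrow> 'a::euclidean_space"
  assumes k: "k > 0" and nu: "\<And>n. \<nu> n > 0" and del: "\<delta> \<longlonglongrightarrow> 0"
    and dF: "\<And>n x. (F n has_vector_derivative f n x + h n x) (at x)"
    and dG: "\<And>x. (G has_vector_derivative g x) (at x)"
    and cont: "\<And>n. continuous_on UNIV (f n)" "\<And>n. continuous_on UNIV (h n)" "continuous_on UNIV g"
    and le: "\<And>n x. x \<ge> 0 \<Longrightarrow> norm (f n x) \<le> C * exp (- (k * x))"
      "\<And>n x. x \<ge> 0 \<Longrightarrow> norm (h n x) \<le> \<delta> n * \<nu> n * exp (- (\<nu> n * x))"
    and lim: "\<And>n. (F n \<longlongrightarrow> 0) at_top" "(G \<longlongrightarrow> 0) at_top" "\<And>x. x \<ge> 0 \<Longrightarrow> (\<lambda>n. f n x) \<longlonglongrightarrow> g x"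
  shows "(\<lambda>n. F n 0) \<longlonglongrightarrow> G 0"
proof -
  have leg: "norm (g x) \<le> C * exp (- (k * x))" if "x \<ge> 0" for x
    by (rule Lim_bounded[OF tendsto_norm[OF lim(3)[OF that]]]) (use le(1)[OF that] in auto)
  have if': "set_integrable lborel {0<..} (f n)" for n
    by (rule set_integrable_continuous_exp_decay[OF k cont(1) le(1)])
  have ih: "set_integrable lborel {0<..} (h n)" for n
    by (rule set_integrable_continuous_exp_decay[OF nu cont(2) le(2)])
  have ig: "set_integrable lborel {0<..} g"
    by (rule set_integrable_continuous_exp_decay[OF k cont(3) leg])
  have F0: "F n 0 = - (LINT x:{0<..}|lborel. f n x) - (LINT x:{0<..}|lborel. h n x)" for n
    using half_line_FTC[OF dF continuous_on_add[OF cont(1,2)] _ lim(1)] set_integral_add[OF if' ih]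
    by (metis add.commute diff_0 minus_add_distrib minus_minus uminus_add_conv_diff)
  have G0: "G 0 = - (LINT x:{0<..}|lborel. g x)"
    using half_line_FTC[OF dG cont(3) ig lim(2)] by simp
  have 1: "(\<lambda>n. (LINT x:{0<..}|lborel. f n x)) \<longlonglongrightarrow> (LINT x:{0<..}|lborel. g x)"
    unfolding set_lebesgue_integral_def
  proof (rule integral_dominated_convergence)
    show "integrable lborel (\<lambda>x. indicator {0<..} x *\<^sub>R (C * exp (- (k * x))))"
      using set_integrable_exp_decay(1)[OF k] unfolding set_integrable_def .
    show "AE x in lborel. (\<lambda>n. indicator {0<..} x *\<^sub>R f n x) \<longlonglongrightarrow> indicator {0<..} x *\<^sub>R g x"
      using lim(3) by (intro AE_I2) (auto simp: indicator_def)
    show "AE x in lborel. norm (indicator {0<..} x *\<^sub>R f n x) \<le> indicator {0<..} x *\<^sub>R (C * exp (- (k * x)))" for n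
      using le(1) by (intro AE_I2) (auto simp: indicator_def)
    show "(\<lambda>x. indicator {0<..} x *\<^sub>R g x) \<in> borel_measurable lborel"
      using borel_measurable_continuous_onI[OF cont(3)] by measurable
    show "(\<lambda>x. indicator {0<..} x *\<^sub>R f n x) \<in> borel_measurable lborel" for n
      using borel_measurable_continuous_onI[OF cont(1)[of n]] by measurable
  qed
  have 2: "norm (LINT x:{0<..}|lborel. h n x) \<le> \<delta> n" for n
  proof -
    have "norm (LINT x:{0<..}|lborel. h n x) \<le> (LINT x:{0<..}|lborel. norm (h n x))"
      by (rule set_integral_norm_bound[OF ih])
    also have "\<dots> \<le> (LINT x:{0<..}|lborel. \<delta> n * \<nu> n * exp (- (\<nu> n * x)))"
      using le(2) by (intro set_integral_mono set_integrable_norm ih set_integrable_exp_decay nu) auto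
    also have "\<dots> = \<delta> n" using nu[of n] by (subst set_integrable_exp_decay(2)[OF nu]) simp
    finally show ?thesis .
  qed
  have 3: "(\<lambda>n. LINT x:{0<..}|lborel. h n x) \<longlonglongrightarrow> 0"
    by (rule Lim_null_comparison[OF _ del]) (use 2 in auto)
  show ?thesis unfolding F0 G0 using tendsto_diff[OF tendsto_minus[OF 1] 3] by simp
qed

text \<open>Exponential decay makes any primitive Cauchy at infinity; subtracting its limit keeps
  the rate. This lemma supplies the primitives \<open>f\<close>, \<open>g\<close>, \<open>h\<close>
  normalized at infinity.\<close>

lemma exp_decay_antiderivative:
  fixes f :: "real \<Rightarrow> real"
  assumes k: "k > 0" and cont: "continuous_on UNIV f"
    and le: "\<And>x. x \<ge> 0 \<Longrightarrow> \<bar>f x\<bar> \<le> C * exp (- (k * x))"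
  shows "\<exists>F. (\<forall>x. (F has_real_derivative f x) (at x)) \<and> (\<forall>x\<ge>0. \<bar>F x\<bar> \<le> C / k * exp (- (k * x)))"
proof -
  obtain F0 where F0: "\<And>x. (F0 has_real_derivative f x) (at x)"
    using einterval_antiderivative[of "-\<infinity>" \<infinity> f] cont
    by (auto simp: continuous_on_eq_continuous_at has_real_derivative_iff_has_vector_derivative)
  have diff: "\<bar>F0 t - F0 x\<bar> \<le> C / k * exp (- (k * x)) - C / k * exp (- (k * t))" if "0 \<le> x" "x \<le> t" for x t
  proof (cases "x = t")
    case False
    then have "x < t" using that by simp
    have dphi: "((\<lambda>t. - (C / k) * exp (- (k * t))) has_vector_derivative C * exp (- (k * t))) (at t)" for t
      unfolding has_real_derivative_iff_has_vector_derivative[symmetric]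
      using k by (auto intro!: derivative_eq_intros)
    have "norm (F0 t - F0 x) \<le> - (C / k) * exp (- (k * t)) - (- (C / k) * exp (- (k * x)))"
      by (rule differentiable_bound_general[OF \<open>x < t\<close> _ _ _ dphi])
        (use F0 le that k in \<open>auto intro!: continuous_intros DERIV_continuous_on[of _ F0 f]
           simp: has_real_derivative_iff_has_vector_derivative[symmetric] intro: has_field_derivative_at_within\<close>)
    then show ?thesis by simp
  qed auto
  have C0: "C \<ge> 0" using le[of 0] by simp
  have "\<exists>L. (F0 \<longlongrightarrow> L) at_top"
  proof -
    have "Cauchy (\<lambda>n. F0 (real n))"
    proof (rule metric_CauchyI)
      fix e :: real assume e: "e > 0"
      have "\<forall>\<^sub>F x in at_top. dist (C / k * exp (- (k * x))) 0 < e"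
        by (rule tendstoD[OF exp_decay_tendsto_0[OF k] e])
      then obtain N where N: "\<And>x. x \<ge> N \<Longrightarrow> \<bar>C / k * exp (- (k * x))\<bar> < e"
        by (auto simp: eventually_at_top_linorder)
      have *: "dist (F0 (real m)) (F0 (real n)) < e" if "nat \<lceil>N\<rceil> \<le> n" "n \<le> m" for m n
      proof -
        have "C / k * exp (- (k * real m)) \<ge> 0" using C0 k by simp
        then have "dist (F0 (real m)) (F0 (real n)) \<le> \<bar>C / k * exp (- (k * real n))\<bar>"
          using diff[OF of_nat_0_le_iff of_nat_mono[OF that(2)]] unfolding dist_real_def by linarith
        also have "\<dots> < e" by (rule N) (use that in linarith)
        finally show ?thesis .
      qed
      then show "\<exists>M. \<forall>m\<ge>M. \<forall>n\<ge>M. dist (F0 (real m)) (F0 (real n)) < e"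
        by (intro exI[of _ "nat \<lceil>N\<rceil>"]) (metis dist_commute nle_le)
    qed
    then obtain L where L: "(\<lambda>n. F0 (real n)) \<longlonglongrightarrow> L" using Cauchy_convergent convergent_def by blast
    have near: "\<bar>F0 x - L\<bar> \<le> C / k * exp (- (k * x))" if "x \<ge> 0" for x
    proof (rule Lim_bounded[of "\<lambda>n. \<bar>F0 x - F0 (real n)\<bar>"])
      show "(\<lambda>n. \<bar>F0 x - F0 (real n)\<bar>) \<longlonglongrightarrow> \<bar>F0 x - L\<bar>" by (intro tendsto_intros L)
      show "\<forall>n\<ge>nat \<lceil>x\<rceil>. \<bar>F0 x - F0 (real n)\<bar> \<le> C / k * exp (- (k * x))"
      proof (intro allI impI)
        fix n assume "nat \<lceil>x\<rceil> \<le> n"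
        then have "x \<le> real n" by linarith
        moreover have "C / k * exp (- (k * real n)) \<ge> 0" using C0 k by simp
        ultimately show "\<bar>F0 x - F0 (real n)\<bar> \<le> C / k * exp (- (k * x))"
          using diff[of x "real n"] that by (simp add: abs_minus_commute)
      qed
    qed
    have "((\<lambda>x. F0 x - L) \<longlongrightarrow> 0) at_top"
      by (rule tendsto_0_exp_decay[OF k, of _ "C / k"]) (use near in simp)
    then show ?thesis using LIM_zero_iff by blast
  qed
  then obtain L where L: "(F0 \<longlongrightarrow> L) at_top" ..
  have near: "\<bar>F0 x - L\<bar> \<le> C / k * exp (- (k * x))" if "x \<ge> 0" for x
  proof (rule tendsto_upperbound[of "\<lambda>t. \<bar>F0 x - F0 t\<bar>" _ at_top])
    show "((\<lambda>t. \<bar>F0 x - F0 t\<bar>) \<longlongrightarrow> \<bar>F0 x - L\<bar>) at_top" by (intro tendsto_intros L)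
    show "\<forall>\<^sub>F t in at_top. \<bar>F0 x - F0 t\<bar> \<le> C / k * exp (- (k * x))"
      using eventually_ge_at_top[of x]
    proof eventually_elim
      case (elim t)
      moreover have "C / k * exp (- (k * t)) \<ge> 0" using C0 k by simp
      ultimately show ?case using diff[of x t] that by (simp add: abs_minus_commute)
    qed
  qed auto
  show ?thesis
    by (rule exI[of _ "\<lambda>x. F0 x - L"]) (use near in \<open>auto intro!: derivative_eq_intros F0\<close>)
qed


text \<open>The functions \<open>y\<close>, \<open>w\<close> stand for \<open>v - v\<^sub>\<infinity>\<close> and \<open>\<partial>\<^sub>s v\<close>, and \<open>f\<close>, \<open>g\<close> for antiderivatives of
  \<open>\<partial>\<^sub>s u\<close>, \<open>\<partial>\<^sub>s v\<close>.\<close>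

locale half_line =
  fixes \<kappa> s c k K :: real and a y y1 y2 w w1 f g h :: "real \<Rightarrow> real"
  assumes kap: "\<kappa> > 0" and sc: "\<bar>s\<bar> < c" and k: "k > 0" and cont: "continuous_on UNIV a"
    and dy: "\<And>x. (y has_real_derivative y1 x) (at x)"
      "\<And>x. (y1 has_real_derivative y2 x) (at x)"
      "\<And>x. (y2 has_real_derivative - ((s\<^sup>2 + a x) * y1 x) / \<kappa>) (at x)"
    and dw: "\<And>x. (w has_real_derivative w1 x) (at x)"
      "\<And>x. (w1 has_real_derivative - ((s\<^sup>2 + a x) * w x + 2 * s * y x) / \<kappa>) (at x)"
    and dg: "\<And>x. (g has_real_derivative w x) (at x)"
    and df: "\<And>x. (f has_real_derivative - s * w x - y x) (at x)"
    and dh: "\<And>x. (h has_real_derivative 2 * s * y x * w x + (y x)\<^sup>2) (at x)"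
    and decay: "\<And>x. x \<ge> 0 \<Longrightarrow> \<bar>a x + c\<^sup>2\<bar> \<le> K * exp (- (k * x))"
      "\<And>x. x \<ge> 0 \<Longrightarrow> \<bar>y x\<bar> \<le> K * exp (- (k * x))"
      "\<And>x. x \<ge> 0 \<Longrightarrow> \<bar>y1 x\<bar> \<le> K * exp (- (k * x))"
      "\<And>x. x \<ge> 0 \<Longrightarrow> \<bar>y2 x\<bar> \<le> K * exp (- (k * x))"
      "\<And>x. x \<ge> 0 \<Longrightarrow> \<bar>w x\<bar> \<le> K * exp (- (k * x))"
      "\<And>x. x \<ge> 0 \<Longrightarrow> \<bar>w1 x\<bar> \<le> K * exp (- (k * x))"
      "\<And>x. x \<ge> 0 \<Longrightarrow> \<bar>f x\<bar> \<le> K * exp (- (k * x))"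
      "\<And>x. x \<ge> 0 \<Longrightarrow> \<bar>g x\<bar> \<le> K * exp (- (k * x))"
    and h0: "(h \<longlongrightarrow> 0) at_top"
begin

lemma lims: "((\<lambda>x. a x + c\<^sup>2) \<longlongrightarrow> 0) at_top" "(y \<longlongrightarrow> 0) at_top" "(y1 \<longlongrightarrow> 0) at_top" "(y2 \<longlongrightarrow> 0) at_top"
  "(w \<longlongrightarrow> 0) at_top" "(w1 \<longlongrightarrow> 0) at_top" "(f \<longlongrightarrow> 0) at_top" "(g \<longlongrightarrow> 0) at_top"
  by (rule tendsto_0_exp_decay[OF k, where C = K], use decay in simp)+

lemma a_lim: "(a \<longlongrightarrow> - c\<^sup>2) at_top"
  using tendsto_add[OF lims(1) tendsto_const[of "- c\<^sup>2"]] by simp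

lemma K0: "K \<ge> 0" using decay(2)[of 0] by simp

lemma conts: "continuous_on UNIV y" "continuous_on UNIV y1" "continuous_on UNIV y2"
  "continuous_on UNIV w" "continuous_on UNIV w1" "continuous_on UNIV f" "continuous_on UNIV g"
  by (rule DERIV_continuous_on[OF has_field_derivative_at_within[OF dy(1)]]
      DERIV_continuous_on[OF has_field_derivative_at_within[OF dy(2)]]
      DERIV_continuous_on[OF has_field_derivative_at_within[OF dy(3)]]
      DERIV_continuous_on[OF has_field_derivative_at_within[OF dw(1)]]
      DERIV_continuous_on[OF has_field_derivative_at_within[OF dw(2)]]
      DERIV_continuous_on[OF has_field_derivative_at_within[OF df]]
      DERIV_continuous_on[OF has_field_derivative_at_within[OF dg]])+

text \<open>Pairing of the solution with the approximate null function \<open>T\<^sub>0 + \<mu> T\<^sub>1\<close> of the adjoint operator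
  minus \<open>\<mu>\<close>, where \<open>L\<^sup>* T\<^sub>0 = 0\<close> and \<open>L\<^sup>* T\<^sub>1 = T\<^sub>0\<close>; therefore its derivative is of order \<open>\<mu>\<^sup>2\<close>.\<close>

definition pairing :: "real \<Rightarrow> (real \<Rightarrow> complex) \<Rightarrow> (real \<Rightarrow> complex) \<Rightarrow> (real \<Rightarrow> complex) \<Rightarrow> (real \<Rightarrow> complex) \<Rightarrow> real \<Rightarrow> complex" where
  "pairing \<mu> P Q v z x = P x * of_real (s * y x - \<mu> * f x) + Q x * of_real (y x + \<mu> * g x)
     - of_real \<kappa> * z x * of_real (y1 x + \<mu> * w x) + of_real \<kappa> * v x * of_real (y2 x + \<mu> * w1 x)"

text \<open>Lagrange identity. With T_v = -s y + \<mu> f and T_u = y + \<mu> g the pairing reads -P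
  T_v + Q T_u - \<kappa> v' T_u' + \<kappa> v T_u'', and its derivative is (v, u) tested against (L*
  - \<mu>)(T0 + \<mu> T1) = -\<mu>^2 T1. On the right, \<open>P x - of_real s * v x\<close> is
  u.\<close>

lemma pairing_derivative:
  assumes "reduced_solution \<kappa> s a \<mu> P Q v z"
  shows "(pairing \<mu> P Q v z has_vector_derivative
    - of_real (\<mu>\<^sup>2) * (v x * of_real (f x) + (P x - of_real s * v x) * of_real (g x))) (at x)"
proof -
  have d: "(P has_vector_derivative of_real \<mu> * v x) (at x)"
    "(Q has_vector_derivative - of_real \<mu> * (P x - of_real s * v x)) (at x)"
    "(v has_vector_derivative z x) (at x)"
    "(z has_vector_derivative
        (Q x + of_real s * P x - of_real (s\<^sup>2 + a x) * v x) / of_real \<kappa>) (at x)"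
    using assms unfolding reduced_solution_def by auto
  have r: "((\<lambda>x. s * y x - \<mu> * f x) has_real_derivative s * y1 x - \<mu> * (- s * w x - y x)) (at x)"
    "((\<lambda>x. y x + \<mu> * g x) has_real_derivative y1 x + \<mu> * w x) (at x)"
    "((\<lambda>x. y1 x + \<mu> * w x) has_real_derivative y2 x + \<mu> * w1 x) (at x)"
    "((\<lambda>x. y2 x + \<mu> * w1 x) has_real_derivative - ((s\<^sup>2 + a x) * y1 x) / \<kappa> + \<mu> * (- ((s\<^sup>2 + a x) * w x + 2 * s * y x) / \<kappa>)) (at x)"
    by (auto intro!: derivative_eq_intros dy dw df dg)
  note r = r[THEN has_vector_derivative_of_real]
  have k0: "complex_of_real \<kappa> \<noteq> 0" using kap by simp
  have e: "of_real \<kappa> * (X / of_real \<kappa>) = X" for X :: complex using k0 by simp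
  have e2: "of_real \<kappa> * v x * complex_of_real (- ((s\<^sup>2 + a x) * y1 x) / \<kappa> + \<mu> * (- ((s\<^sup>2 + a x) * w x + 2 * s * y x) / \<kappa>))
    = v x * complex_of_real (- ((s\<^sup>2 + a x) * y1 x) - \<mu> * ((s\<^sup>2 + a x) * w x + 2 * s * y x))"
    using kap k0 by (simp add: field_simps)
  show ?thesis
    unfolding pairing_def[abs_def]
    apply (rule has_vector_derivative_eq_rhs)
     apply (rule d r derivative_intros has_vector_derivative_mult_right has_vector_derivative_mult)+
    unfolding e e2
    apply (simp add: algebra_simps power2_eq_square)
    done
qed

text \<open>Sequences of parameters replace a continuous one because dominated convergence is
  applied along them. Convergence is demanded only at x = 0, where it makes the data bounded; the
  half-line bound then propagates boundedness.\<close>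

definition decaying_solutions :: "(nat \<Rightarrow> real) \<Rightarrow> (nat \<Rightarrow> real \<Rightarrow> complex) \<Rightarrow> (nat \<Rightarrow> real \<Rightarrow> complex) \<Rightarrow>
    (nat \<Rightarrow> real \<Rightarrow> complex) \<Rightarrow> (nat \<Rightarrow> real \<Rightarrow> complex) \<Rightarrow> bool" where
  "decaying_solutions \<mu> P Q v z \<longleftrightarrow> (\<forall>n. \<mu> n > 0) \<and> \<mu> \<longlonglongrightarrow> 0 \<and>
     (\<forall>n. reduced_solution \<kappa> s a (\<mu> n) (P n) (Q n) (v n) (z n) \<and>
       (P n \<longlongrightarrow> 0) at_top \<and> (Q n \<longlongrightarrow> 0) at_top \<and> (v n \<longlongrightarrow> 0) at_top \<and> (z n \<longlongrightarrow> 0) at_top) \<and>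
     convergent (\<lambda>n. P n 0) \<and> convergent (\<lambda>n. Q n 0) \<and> convergent (\<lambda>n. v n 0) \<and> convergent (\<lambda>n. z n 0)"

lemma uniform_bound:
  assumes "decaying_solutions \<mu> P Q v z"
  shows "\<exists>M. M \<ge> 0 \<and> (\<forall>\<^sub>F n in sequentially. \<forall>x\<ge>0. norm (P n x) \<le> M \<and> norm (Q n x) \<le> M \<and> norm (v n x) \<le> M \<and> norm (z n x) \<le> M)"
proof -
  obtain C \<epsilon> where e: "\<epsilon> > 0" and C: "\<And>\<mu> P Q v z x. \<lbrakk>0 < \<mu>; \<mu> < \<epsilon>; reduced_solution \<kappa> s a \<mu> P Q v z;
    (P \<longlongrightarrow> 0) at_top; (Q \<longlongrightarrow> 0) at_top; (v \<longlongrightarrow> 0) at_top; (z \<longlongrightarrow> 0) at_top; x \<ge> 0\<rbrakk> \<Longrightarrow>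
    norm (P x) + norm (Q x) + norm (v x) + norm (z x) \<le>
       C * (norm (P 0) + norm (Q 0) + norm (v 0) + norm (z 0))"
    using half_line_bound[OF kap sc a_lim cont] by metis
  have "Bseq (\<lambda>n. P n 0)" "Bseq (\<lambda>n. Q n 0)" "Bseq (\<lambda>n. v n 0)" "Bseq (\<lambda>n. z n 0)"
    using assms unfolding decaying_solutions_def by (auto intro: convergent_imp_Bseq)
  then obtain B1 B2 B3 B4 where B: "\<And>n. norm (P n 0) \<le> B1" "\<And>n. norm (Q n 0) \<le> B2" "\<And>n. norm (v n 0) \<le> B3" "\<And>n. norm (z n 0) \<le> B4"
    unfolding Bseq_def by blast
  define M where "M = \<bar>C\<bar> * (B1 + B2 + B3 + B4)"
  have nn: "0 \<le> B1" "0 \<le> B2" "0 \<le> B3" "0 \<le> B4" using B norm_ge_zero order_trans by blast+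
  have "\<forall>\<^sub>F n in sequentially. \<mu> n < \<epsilon>"
    using assms e unfolding decaying_solutions_def by (auto intro: order_tendstoD)
  then have "\<forall>\<^sub>F n in sequentially. \<forall>x\<ge>0. norm (P n x) \<le> M \<and> norm (Q n x) \<le> M \<and> norm (v n x) \<le> M \<and> norm (z n x) \<le> M"
  proof eventually_elim
    case (elim n)
    show ?case
    proof (intro allI impI)
      fix x :: real assume x: "x \<ge> 0"
      have "norm (P n x) + norm (Q n x) + norm (v n x) + norm (z n x) \<le>
         C * (norm (P n 0) + norm (Q n 0) + norm (v n 0) + norm (z n 0))"
        by (rule C[OF _ elim _ _ _ _ _ x]) (use assms in \<open>auto simp: decaying_solutions_def\<close>)
      also have "\<dots> \<le> M" unfolding M_def
        using B(1)[of n] B(2)[of n] B(3)[of n] B(4)[of n] by (intro mult_mono) auto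
      finally have S: "norm (P n x) + norm (Q n x) + norm (v n x) + norm (z n x) \<le> M" .
      show "norm (P n x) \<le> M \<and> norm (Q n x) \<le> M \<and> norm (v n x) \<le> M \<and> norm (z n x) \<le> M"
        using S norm_ge_zero[of "P n x"] norm_ge_zero[of "Q n x"] norm_ge_zero[of "v n x"] norm_ge_zero[of "z n x"]
        by linarith
    qed
  qed
  moreover have "M \<ge> 0" using nn by (simp add: M_def)
  ultimately show ?thesis by blast
qed

lemma reduced_continuous:
  assumes "reduced_solution \<kappa> s a \<mu> P Q v z"
  shows "continuous_on UNIV P" "continuous_on UNIV Q" "continuous_on UNIV v" "continuous_on UNIV z"
  using assms unfolding reduced_solution_def
  by (auto intro!: continuous_at_imp_continuous_on intro: has_vector_derivative_continuous)

lemma pairing_tendsto_0: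
  assumes "(P \<longlongrightarrow> 0) at_top" "(Q \<longlongrightarrow> 0) at_top" "(v \<longlongrightarrow> 0) at_top" "(z \<longlongrightarrow> 0) at_top"
  shows "(pairing \<mu> P Q v z \<longlongrightarrow> 0) at_top"
proof -
  have "((\<lambda>x. of_real (s * y x - \<mu> * f x)) \<longlongrightarrow> complex_of_real (s * 0 - \<mu> * 0)) at_top"
    "((\<lambda>x. of_real (y x + \<mu> * g x)) \<longlongrightarrow> complex_of_real (0 + \<mu> * 0)) at_top"
    "((\<lambda>x. of_real (y1 x + \<mu> * w x)) \<longlongrightarrow> complex_of_real (0 + \<mu> * 0)) at_top"
    "((\<lambda>x. of_real (y2 x + \<mu> * w1 x)) \<longlongrightarrow> complex_of_real (0 + \<mu> * 0)) at_top"
    by (intro tendsto_of_real tendsto_intros lims)+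
  note r = this
  have "((\<lambda>x. pairing \<mu> P Q v z x) \<longlongrightarrow> 0 * complex_of_real (s * 0 - \<mu> * 0) + 0 * complex_of_real (0 + \<mu> * 0)
    - of_real \<kappa> * 0 * complex_of_real (0 + \<mu> * 0) + of_real \<kappa> * 0 * complex_of_real (0 + \<mu> * 0)) at_top"
    unfolding pairing_def by (intro tendsto_intros assms r)
  then show ?thesis by simp
qed

lemma pairing_integrand_le:
  fixes P v :: "real \<Rightarrow> complex"
  assumes "x \<ge> 0" "norm (P x) \<le> M" "norm (v x) \<le> M" "M \<ge> 0"
  shows "norm (v x * of_real (f x) + (P x - of_real s * v x) * of_real (g x)) \<le> (2 + \<bar>s\<bar>) * M * K * exp (- (k * x))"
proof -
  let ?e = "K * exp (- (k * x))"
  have e0: "?e \<ge> 0" using K0 by simp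
  have "norm (v x * of_real (f x)) \<le> M * ?e"
    using assms decay(7)[of x] e0 unfolding norm_mult by (intro mult_mono) auto
  moreover have "norm (P x - of_real s * v x) \<le> M + \<bar>s\<bar> * M"
    using assms by (intro norm_diff_le norm_of_real_mult_le) auto
  then have "norm ((P x - of_real s * v x) * of_real (g x)) \<le> (M + \<bar>s\<bar> * M) * ?e"
    using assms decay(8)[of x] e0 unfolding norm_mult by (intro mult_mono) auto
  ultimately have "norm (v x * of_real (f x) + (P x - of_real s * v x) * of_real (g x)) \<le> M * ?e + (M + \<bar>s\<bar> * M) * ?e"
    by (rule norm_add_le)
  then show ?thesis by (simp add: algebra_simps)
qed

text \<open>Vanishing at infinity turns the value at 0 into an integral of order
  \<open>\<mu>\<^sup>2\<close>, since \<open>f\<close> and \<open>g\<close> decay at a rate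
  independent of \<open>\<mu>\<close>. No pointwise limits are needed for one power of
  \<open>\<mu>\<close>.\<close>

lemma pairing_over_mu:
  assumes sol: "decaying_solutions \<mu> P Q v z"
  shows "(\<lambda>n. pairing (\<mu> n) (P n) (Q n) (v n) (z n) 0 / of_real (\<mu> n)) \<longlonglongrightarrow> 0"
proof -
  obtain M where M: "M \<ge> 0" "\<forall>\<^sub>F n in sequentially. \<forall>x\<ge>0. norm (P n x) \<le> M \<and> norm (Q n x) \<le> M \<and> norm (v n x) \<le> M \<and> norm (z n x) \<le> M"
    using uniform_bound[OF sol] by blast
  have mu: "\<mu> n > 0" "\<mu> \<longlonglongrightarrow> 0" and rs: "reduced_solution \<kappa> s a (\<mu> n) (P n) (Q n) (v n) (z n)"
    and l: "(P n \<longlongrightarrow> 0) at_top" "(Q n \<longlongrightarrow> 0) at_top" "(v n \<longlongrightarrow> 0) at_top" "(z n \<longlongrightarrow> 0) at_top" for n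
    using sol unfolding decaying_solutions_def by auto
  define A where "A = (2 + \<bar>s\<bar>) * M * K / k"
  have b: "\<forall>\<^sub>F n in sequentially. norm (pairing (\<mu> n) (P n) (Q n) (v n) (z n) 0 / of_real (\<mu> n)) \<le> A * \<mu> n"
    using M(2)
  proof eventually_elim
    case (elim n)
    define i where "i = (\<lambda>x. - of_real ((\<mu> n)\<^sup>2) * (v n x * of_real (f x) + (P n x - of_real s * v n x) * of_real (g x)))"
    have d: "(pairing (\<mu> n) (P n) (Q n) (v n) (z n) has_vector_derivative i x) (at x)" for x
      unfolding i_def by (rule pairing_derivative[OF rs])
    have c: "continuous_on UNIV i" unfolding i_def
      by (intro continuous_intros reduced_continuous[OF rs] conts)
    have le: "norm (i x) \<le> (\<mu> n)\<^sup>2 * ((2 + \<bar>s\<bar>) * M * K) * exp (- (k * x))" if x: "x \<ge> 0" for x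
      using pairing_integrand_le[OF x, of "P n" M "v n"] elim x M(1)
      unfolding i_def by (simp add: norm_mult norm_power mult.assoc mult_left_mono del: of_real_power)
    have int: "set_integrable lborel {0<..} i"
      by (rule set_integrable_continuous_exp_decay[OF k c le])
    have "pairing (\<mu> n) (P n) (Q n) (v n) (z n) 0 = - (LINT x:{0<..}|lborel. i x)"
      using half_line_FTC[OF d c int pairing_tendsto_0[OF l]] by simp
    also have "norm \<dots> \<le> (LINT x:{0<..}|lborel. norm (i x))"
      using set_integral_norm_bound[OF int] by simp
    also have "\<dots> \<le> (LINT x:{0<..}|lborel. (\<mu> n)\<^sup>2 * ((2 + \<bar>s\<bar>) * M * K) * exp (- (k * x)))"
      using le by (intro set_integral_mono set_integrable_norm int set_integrable_exp_decay k) auto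
    also have "\<dots> = (\<mu> n)\<^sup>2 * A" unfolding set_integrable_exp_decay(2)[OF k] by (simp add: A_def)
    finally show ?case using mu(1)[of n] by (simp add: norm_divide power2_eq_square divide_le_eq mult_ac)
  qed
  have "(\<lambda>n. A * \<mu> n) \<longlonglongrightarrow> 0" using tendsto_mult_right_zero[OF mu(2)] .
  then show ?thesis by (rule Lim_null_comparison[OF b])
qed

text \<open>Here the columns tend to the profile derivative, so v tends to y1 and u to -s y1. Since
  (f - s g)' = -2 s w - y, the limiting integrand -y1 (f - s g) has the primitive -y (f - s g) - h;
  this integration by parts is the source of the density 2 s y w + y^2.\<close>

lemma pairing_over_mu_squared:
  assumes sol: "decaying_solutions \<mu> P Q v z"
    and lim: "\<And>x. x \<ge> 0 \<Longrightarrow> (\<lambda>n. P n x) \<longlonglongrightarrow> 0" "\<And>x. x \<ge> 0 \<Longrightarrow> (\<lambda>n. v n x) \<longlonglongrightarrow> of_real (y1 x)"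
  shows "(\<lambda>n. pairing (\<mu> n) (P n) (Q n) (v n) (z n) 0 / of_real ((\<mu> n)\<^sup>2)) \<longlonglongrightarrow>
    of_real (- (y 0 * (f 0 - s * g 0)) - h 0)"
proof -
  obtain M N where M: "M \<ge> 0" and N: "\<And>n x. n \<ge> N \<Longrightarrow> x \<ge> 0 \<Longrightarrow> norm (P n x) \<le> M \<and> norm (Q n x) \<le> M \<and> norm (v n x) \<le> M \<and> norm (z n x) \<le> M"
    using uniform_bound[OF sol] unfolding eventually_sequentially by blast
  have mu: "\<mu> n > 0" "\<mu> \<longlonglongrightarrow> 0" and rs: "reduced_solution \<kappa> s a (\<mu> n) (P n) (Q n) (v n) (z n)"
    and l: "(P n \<longlongrightarrow> 0) at_top" "(Q n \<longlongrightarrow> 0) at_top" "(v n \<longlongrightarrow> 0) at_top" "(z n \<longlongrightarrow> 0) at_top" for n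
    using sol unfolding decaying_solutions_def by auto
  let ?i = "\<lambda>n x. - (v n x * of_real (f x) + (P n x - of_real s * v n x) * of_real (g x))"
  let ?F = "\<lambda>n x. pairing (\<mu> n) (P n) (Q n) (v n) (z n) x / of_real ((\<mu> n)\<^sup>2)"
  let ?G = "\<lambda>x. - (y x * (f x - s * g x)) - h x"
  \<comment> \<open>The shift by \<open>N\<close> discards the finitely many indices not covered by
    the uniform bound. There is no slowly decaying perturbation here, hence \<open>h = 0\<close> in
    the limit lemma.\<close>
  have "(\<lambda>n. ?F (n + N) 0) \<longlonglongrightarrow> of_real (?G 0)"
  proof (rule antiderivative_limit[OF k, where \<nu> = "\<lambda>_. 1" and \<delta> = "\<lambda>_. 0" and h = "\<lambda>_ _. 0" and f = "\<lambda>n. ?i (n + N)"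
        and g = "\<lambda>x. - (of_real (y1 x) * of_real (f x) + (0 - of_real s * of_real (y1 x)) * of_real (g x))"])
    fix n x
    have "(?F (n + N) has_vector_derivative (- of_real ((\<mu> (n + N))\<^sup>2) * (v (n + N) x * of_real (f x) + (P (n + N) x - of_real s * v (n + N) x) * of_real (g x))) / of_real ((\<mu> (n + N))\<^sup>2)) (at x)"
      by (rule has_vector_derivative_divide pairing_derivative rs)+
    moreover have "complex_of_real ((\<mu> (n + N))\<^sup>2) \<noteq> 0" using mu(1)[of "n + N"] by simp
    ultimately show "(?F (n + N) has_vector_derivative ?i (n + N) x + 0) (at x)"
      by (simp del: of_real_power)
    show "((\<lambda>x. complex_of_real (?G x)) has_vector_derivative - (of_real (y1 x) * of_real (f x) + (0 - of_real s * of_real (y1 x)) * of_real (g x))) (at x)"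
    proof -
      have "(?G has_real_derivative - (y1 x * f x - s * y1 x * g x)) (at x)"
        by (auto intro!: derivative_eq_intros dy df dg dh simp: algebra_simps power2_eq_square)
      from has_vector_derivative_of_real[OF this, where 'a = complex] show ?thesis by simp
    qed
    show "norm (?i (n + N) x) \<le> ((2 + \<bar>s\<bar>) * M * K) * exp (- (k * x))" if x: "x \<ge> 0"
      using pairing_integrand_le[OF x, of "P (n + N)" M "v (n + N)"] N[of "n + N", OF _ x] M
      unfolding norm_minus_cancel by simp
    show "(?F (n + N) \<longlongrightarrow> 0) at_top"
      using tendsto_divide_zero[OF pairing_tendsto_0[OF l]] by simp
    show "(\<lambda>n. ?i (n + N) x) \<longlonglongrightarrow> - (of_real (y1 x) * of_real (f x) + (0 - of_real s * of_real (y1 x)) * of_real (g x))" if x: "x \<ge> 0"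
      by (intro tendsto_intros LIMSEQ_ignore_initial_segment lim x)
  next
    have "(?G \<longlongrightarrow> - (0 * (0 - s * 0)) - 0) at_top" by (intro tendsto_intros lims h0)
    then have "((\<lambda>x. complex_of_real (?G x)) \<longlongrightarrow> of_real (- (0 * (0 - s * 0)) - 0)) at_top" by (rule tendsto_of_real)
    then show "((\<lambda>x. complex_of_real (?G x)) \<longlongrightarrow> 0) at_top" by simp
  qed (auto intro!: continuous_intros reduced_continuous[OF rs] conts)
  then show ?thesis by (rule LIMSEQ_offset)
qed

text \<open>The corrected growing mode \<open>R\<close> vanishes at infinity, so
  \<open>R n 0\<close> is minus the integral of its damped forcing. Divided by \<open>\<mu>\<close>,
  the part with a + c^2 is exponentially localized and converges, while the remaining part has size
  \<open>\<nu>\<^sup>2\<close> over a length of order \<open>1 / \<nu>\<close> and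
  disappears.\<close>

lemma growing_mode_limit:
  assumes sol: "decaying_solutions \<mu> P Q v z"
    and lim: "\<And>x. x \<ge> 0 \<Longrightarrow> (\<lambda>n. v n x) \<longlonglongrightarrow> of_real (y1 x)" "(\<lambda>n. z n 0) \<longlonglongrightarrow> of_real (y2 0)"
  shows "(\<lambda>n. (Q n 0 - of_real c * P n 0) / of_real (\<mu> n)) \<longlonglongrightarrow> of_real ((s - c) * y 0)"
proof -
  obtain M N where M: "M \<ge> 0" and N: "\<And>n x. n \<ge> N \<Longrightarrow> x \<ge> 0 \<Longrightarrow> norm (P n x) \<le> M \<and> norm (Q n x) \<le> M \<and> norm (v n x) \<le> M \<and> norm (z n x) \<le> M"
    using uniform_bound[OF sol] unfolding eventually_sequentially by blast
  have mu: "\<mu> n > 0" "\<mu> \<longlonglongrightarrow> 0" and rs: "reduced_solution \<kappa> s a (\<mu> n) (P n) (Q n) (v n) (z n)"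
    and l: "(P n \<longlongrightarrow> 0) at_top" "(Q n \<longlongrightarrow> 0) at_top" "(v n \<longlongrightarrow> 0) at_top" "(z n \<longlongrightarrow> 0) at_top" for n
    using sol unfolding decaying_solutions_def by auto
  have cs: "c + s > 0" using sc by linarith
  have c0: "complex_of_real c + complex_of_real s \<noteq> 0" using cs by (metis less_irrefl of_real_add of_real_eq_0_iff)
  define \<nu> where "\<nu> = (\<lambda>n. \<mu> n / (c + s))"
  have nu: "\<nu> n > 0" for n using mu cs by (simp add: \<nu>_def)
  have mnu: "\<mu> n = \<nu> n * (c + s)" for n using cs by (simp add: \<nu>_def)
  have nu0: "\<nu> \<longlonglongrightarrow> 0" unfolding \<nu>_def using tendsto_divide_zero[OF mu(2)] .
  define R where "R = (\<lambda>n x. Q n x - of_real c * P n x + of_real (\<nu> n * \<kappa>) * z n x + of_real ((\<nu> n)\<^sup>2 * \<kappa>) * v n x)"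
  have dR: "(R n has_vector_derivative - (of_real ((\<nu> n)^3 * \<kappa>) * v n x + of_real (\<nu> n * (a x + c\<^sup>2)) * v n x) + of_real (\<nu> n) * R n x) (at x)" for n x
  proof -
    have "\<mu> n / (c + s) = \<nu> n" by (simp add: \<nu>_def)
    then show ?thesis unfolding R_def using slow_modes(1)[OF rs[of n] kap sc, of x] by metis
  qed
  define F where "F = (\<lambda>n x. (exp (- (\<nu> n * x)) / \<mu> n) *\<^sub>R R n x)"
  define f1 where "f1 = (\<lambda>n x. - (of_real (exp (- (\<nu> n * x)) * (a x + c\<^sup>2) / (c + s)) * v n x))"
  define f2 where "f2 = (\<lambda>n x. - (of_real (exp (- (\<nu> n * x)) * (\<nu> n)\<^sup>2 * \<kappa> / (c + s)) * v n x))"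
  have dF: "(F n has_vector_derivative f1 n x + f2 n x) (at x)" for n x
  proof -
    have 1: "((\<lambda>x. exp (- (\<nu> n * x)) / \<mu> n) has_field_derivative - (\<nu> n * (exp (- (\<nu> n * x)) / \<mu> n))) (at x)"
      using mu(1)[of n] by (auto intro!: derivative_eq_intros)
    have r: "exp (- (\<nu> n * x)) * (\<nu> n)\<^sup>2 * \<kappa> / (c + s) = exp (- (\<nu> n * x)) / \<mu> n * ((\<nu> n)^3 * \<kappa>)"
      "exp (- (\<nu> n * x)) * (a x + c\<^sup>2) / (c + s) = exp (- (\<nu> n * x)) / \<mu> n * (\<nu> n * (a x + c\<^sup>2))"
      using nu[of n] cs unfolding mnu by (simp_all add: power2_eq_square power3_eq_cube divide_simps)
    have alg: "e *\<^sub>R (- (of_real A * V + of_real B * V) + of_real m * S) + (- (m * e)) *\<^sub>R S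
        = - (of_real (e * B) * V) + - (of_real (e * A) * V)" for e A B m :: real and V S :: complex
      by (simp add: scaleR_conv_of_real algebra_simps)
    show ?thesis unfolding F_def
      by (rule has_vector_derivative_eq_rhs[OF has_vector_derivative_scaleR[OF 1 dR]])
        (simp only: f1_def f2_def r alg)
  qed
  \<comment> \<open>Primitive, vanishing at infinity, of the limiting forcing: by the third-order
    equation for \<open>y\<close>, the numerator has derivative -(a + c^2) y1.\<close>
  let ?G = "\<lambda>x. (\<kappa> * y2 x + s\<^sup>2 * y x - c\<^sup>2 * y x) / (c + s)"
  have "(\<lambda>n. F (n + N) 0) \<longlonglongrightarrow> of_real (?G 0)"
  proof (rule antiderivative_limit[OF k, where \<nu> = "\<lambda>n. \<nu> (n + N)" and \<delta> = "\<lambda>n. \<nu> (n + N) * \<kappa> / (c + s) * M"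
        and f = "\<lambda>n. f1 (n + N)" and h = "\<lambda>n. f2 (n + N)"
        and g = "\<lambda>x. - (of_real ((a x + c\<^sup>2) / (c + s)) * of_real (y1 x))"])
    show "\<nu> (n + N) > 0" for n by (rule nu)
    show "(\<lambda>n. \<nu> (n + N) * \<kappa> / (c + s) * M) \<longlonglongrightarrow> 0"
    proof -
      have "(\<lambda>n. \<nu> (n + N) * \<kappa> / (c + s) * M) \<longlonglongrightarrow> 0 * \<kappa> / (c + s) * M"
        using cs by (intro tendsto_intros LIMSEQ_ignore_initial_segment nu0) auto
      then show ?thesis by simp
    qed
    show "(F (n + N) has_vector_derivative f1 (n + N) x + f2 (n + N) x) (at x)" for n x by (rule dF)
    show "((\<lambda>x. complex_of_real (?G x)) has_vector_derivative - (of_real ((a x + c\<^sup>2) / (c + s)) * of_real (y1 x))) (at x)" for x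
    proof -
      have "((\<lambda>x. \<kappa> * y2 x + s\<^sup>2 * y x - c\<^sup>2 * y x) has_real_derivative - ((a x + c\<^sup>2) * y1 x)) (at x)"
        using kap by (auto intro!: derivative_eq_intros dy simp: field_simps)
      from DERIV_cdivide[OF this, of "c + s"]
      have "(?G has_real_derivative - ((a x + c\<^sup>2) / (c + s) * y1 x)) (at x)" by simp
      from has_vector_derivative_of_real[OF this, where 'a = complex] show ?thesis by simp
    qed
    show "norm (f1 (n + N) x) \<le> (K / (c + s) * M) * exp (- (k * x))" if x: "x \<ge> 0" for n x
    proof -
      have "exp (- (\<nu> (n + N) * x)) \<le> 1" using nu[of "n + N"] x by simp
      then have "exp (- (\<nu> (n + N) * x)) * \<bar>a x + c\<^sup>2\<bar> \<le> 1 * (K * exp (- (k * x)))"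
        using decay(1)[OF x] by (intro mult_mono) auto
      then have "\<bar>exp (- (\<nu> (n + N) * x)) * (a x + c\<^sup>2) / (c + s)\<bar> \<le> K * exp (- (k * x)) / (c + s)"
        using cs by (simp add: abs_mult divide_right_mono)
      then have "norm (f1 (n + N) x) \<le> K * exp (- (k * x)) / (c + s) * M"
        unfolding f1_def norm_minus_cancel using N[of "n + N", OF _ x] by (intro norm_of_real_mult_le) auto
      then show ?thesis by (simp add: mult_ac)
    qed
    show "norm (f2 (n + N) x) \<le> \<nu> (n + N) * \<kappa> / (c + s) * M * \<nu> (n + N) * exp (- (\<nu> (n + N) * x))" if x: "x \<ge> 0" for n x
    proof -
      have "norm (f2 (n + N) x) \<le> exp (- (\<nu> (n + N) * x)) * (\<nu> (n + N))\<^sup>2 * \<kappa> / (c + s) * M"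
        unfolding f2_def norm_minus_cancel using N[of "n + N", OF _ x] kap cs
        by (intro norm_of_real_mult_le) (auto simp: abs_mult)
      then show ?thesis by (simp add: mult_ac power2_eq_square)
    qed
    show "(F (n + N) \<longlongrightarrow> 0) at_top" for n
    proof -
      have "(R n \<longlongrightarrow> 0 - of_real c * 0 + of_real (\<nu> n * \<kappa>) * 0 + of_real ((\<nu> n)\<^sup>2 * \<kappa>) * 0) at_top" for n
        unfolding R_def by (intro tendsto_intros l)
      then have R0: "(R (n + N) \<longlongrightarrow> 0) at_top" by simp
      have "((\<lambda>x. (1 / \<mu> (n + N)) * exp (- (\<nu> (n + N) * x))) \<longlongrightarrow> 0) at_top"
        by (rule exp_decay_tendsto_0[OF nu])
      from tendsto_scaleR[OF this R0] show ?thesis unfolding F_def by simp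
    qed
    show "((\<lambda>x. complex_of_real (?G x)) \<longlongrightarrow> 0) at_top"
    proof -
      have "(?G \<longlongrightarrow> (\<kappa> * 0 + s\<^sup>2 * 0 - c\<^sup>2 * 0) / (c + s)) at_top" using cs by (intro tendsto_intros lims) auto
      then have "((\<lambda>x. complex_of_real (?G x)) \<longlongrightarrow> of_real ((\<kappa> * 0 + s\<^sup>2 * 0 - c\<^sup>2 * 0) / (c + s))) at_top"
        by (rule tendsto_of_real)
      then show ?thesis by simp
    qed
    show "(\<lambda>n. f1 (n + N) x) \<longlonglongrightarrow> - (of_real ((a x + c\<^sup>2) / (c + s)) * of_real (y1 x))" if x: "x \<ge> 0" for x
    proof -
      have "(\<lambda>n. f1 n x) \<longlonglongrightarrow> - (of_real (exp (- (0 * x)) * (a x + c\<^sup>2) / (c + s)) * of_real (y1 x))"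
        unfolding f1_def using cs by (intro tendsto_intros nu0 lim x) auto
      then show ?thesis using LIMSEQ_ignore_initial_segment by fastforce
    qed
    show "continuous_on UNIV (f1 (n + N))" "continuous_on UNIV (f2 (n + N))" for n
      unfolding f1_def f2_def using cs c0
      by (auto intro!: continuous_intros reduced_continuous[OF rs] cont)
    show "continuous_on UNIV (\<lambda>x. - (complex_of_real ((a x + c\<^sup>2) / (c + s)) * of_real (y1 x)))"
      using cs by (intro continuous_intros cont conts) auto
  qed
  then have Flim: "(\<lambda>n. F n 0) \<longlonglongrightarrow> of_real (?G 0)" by (rule LIMSEQ_offset)
  \<comment> \<open>Removes the corrections contained in \<open>R\<close>. The \<open>z\<close>
    correction survives division by \<open>\<mu>\<close>, and its limit cancels the
    \<open>y2\<close> term of \<open>?G\<close>, leaving only \<open>y 0\<close>.\<close>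
  have eq: "(Q n 0 - of_real c * P n 0) / of_real (\<mu> n) = F n 0 - of_real (\<kappa> / (c + s)) * z n 0 - of_real (\<nu> n * \<kappa> / (c + s)) * v n 0" for n
  proof -
    have r: "\<nu> n * \<kappa> / (c + s) = (1 / \<mu> n) * ((\<nu> n)\<^sup>2 * \<kappa>)" "\<kappa> / (c + s) = (1 / \<mu> n) * (\<nu> n * \<kappa>)"
      using nu[of n] cs unfolding mnu by (simp_all add: power2_eq_square divide_simps)
    have alg: "X / of_real m = (1 / m) *\<^sub>R (X + of_real A * Z + of_real B * V) - of_real ((1 / m) * A) * Z - of_real ((1 / m) * B) * V"
      for m A B :: real and X Z V :: complex
      by (simp add: scaleR_conv_of_real ring_distribs)
    have "F n 0 = (1 / \<mu> n) *\<^sub>R R n 0" by (simp add: F_def)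
    then show ?thesis unfolding r by (simp only: R_def alg[symmetric])
  qed
  have "(\<lambda>n. F n 0 - of_real (\<kappa> / (c + s)) * z n 0 - of_real (\<nu> n * \<kappa> / (c + s)) * v n 0) \<longlonglongrightarrow>
     of_real (?G 0) - of_real (\<kappa> / (c + s)) * of_real (y2 0) - of_real (0 * \<kappa> / (c + s)) * of_real (y1 0)"
    using cs c0 by (intro tendsto_intros Flim lim nu0) auto
  also have "of_real (?G 0) - of_real (\<kappa> / (c + s)) * of_real (y2 0) - of_real (0 * \<kappa> / (c + s)) * of_real (y1 0)
     = complex_of_real (?G 0 - \<kappa> / (c + s) * y2 0)" by simp
  also have "?G 0 - \<kappa> / (c + s) * y2 0 = (s - c) * y 0"
  proof -
    have e: "\<kappa> * y2 0 + s\<^sup>2 * y 0 - c\<^sup>2 * y 0 = \<kappa> * y2 0 + ((s - c) * y 0) * (c + s)"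
      by (simp add: algebra_simps power2_eq_square)
    show ?thesis unfolding e using cs by (simp add: add_divide_distrib)
  qed
  finally show ?thesis unfolding eq .
qed

end

section \<open>Calculus of smooth functions\<close>


lemma smooth_on_real_deriv:
  assumes "smooth_on UNIV (f :: real \<Rightarrow> real)"
  shows "(f has_real_derivative deriv f x) (at x)" and "smooth_on UNIV (deriv f)"
    and "continuous_on UNIV f"
proof -
  have Ck: "Ck_on k UNIV f" for k using assms by (simp add: smooth_on_def)
  have d: "f differentiable (at x)" for x using Ck[of "Suc 0"] by simp
  have d': "(f has_real_derivative deriv f x) (at x)" for x
    using d[of x] by (metis DERIV_deriv_iff_real_differentiable)
  then show "(f has_real_derivative deriv f x) (at x)" .
  have "frechet_derivative f (at x) 1 = deriv f x" for x
    using frechet_derivative_at[OF d'[of x, unfolded has_field_derivative_def]] by (metis mult.right_neutral)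
  then have "(\<lambda>x. frechet_derivative f (at x) 1) = deriv f" by blast
  then show "smooth_on UNIV (deriv f)" using Ck[of "Suc k" for k] by (auto simp: smooth_on_def)
  show "continuous_on UNIV f" using Ck[of 0] by simp
qed

definition partial1 :: "(real \<times> real \<Rightarrow> real) \<Rightarrow> real \<times> real \<Rightarrow> real" where
  "partial1 f z = frechet_derivative f (at z) (1, 0)"

definition partial2 :: "(real \<times> real \<Rightarrow> real) \<Rightarrow> real \<times> real \<Rightarrow> real" where
  "partial2 f z = frechet_derivative f (at z) (0, 1)"

lemma smooth_on_partials:
  assumes "smooth_on S f"
  shows "smooth_on S (partial1 f)" "smooth_on S (partial2 f)" "continuous_on S f"
    and "(s, x) \<in> S \<Longrightarrow> ((\<lambda>s. f (s, x)) has_real_derivative partial1 f (s, x)) (at s)"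
    and "(s, x) \<in> S \<Longrightarrow> ((\<lambda>x. f (s, x)) has_real_derivative partial2 f (s, x)) (at x)"
proof -
  have Ck: "Ck_on k S f" for k using assms by (simp add: smooth_on_def)
  have B: "(1, 0) \<in> (Basis :: (real \<times> real) set)" "(0, 1) \<in> (Basis :: (real \<times> real) set)"
    by (auto simp: Basis_prod_def)
  have "Ck_on k S (\<lambda>z. frechet_derivative f (at z) b)" if "b \<in> Basis" for k b
    using Ck[of "Suc k"] that by simp
  then show "smooth_on S (partial1 f)" "smooth_on S (partial2 f)"
    using B unfolding smooth_on_def partial1_def[abs_def] partial2_def[abs_def] by blast+
  show "continuous_on S f" using Ck[of 0] by simp
  assume "(s, x) \<in> S"
  then have D: "(f has_derivative frechet_derivative f (at (s, x))) (at (s, x))"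
    using Ck[of "Suc 0"] by (simp add: frechet_derivative_works)
  have lin: "linear (frechet_derivative f (at (s, x)))" using D has_derivative_linear by blast
  have 1: "((\<lambda>s. (s, x)) has_derivative (\<lambda>h. (h, 0))) (at s)"
    by (auto intro!: derivative_eq_intros)
  have "((\<lambda>s. f (s, x)) has_derivative (\<lambda>h. frechet_derivative f (at (s, x)) (h, 0))) (at s)"
    using has_derivative_compose[OF 1, of f] D by simp
  moreover have "frechet_derivative f (at (s, x)) (h, 0) = partial1 f (s, x) * h" for h
    using linear_scale[OF lin, of h "(1, 0)"] by (simp add: partial1_def)
  ultimately show "((\<lambda>s. f (s, x)) has_real_derivative partial1 f (s, x)) (at s)"
    by (simp add: has_field_derivative_def)
  have 2: "((\<lambda>x. (s, x)) has_derivative (\<lambda>h. (0, h))) (at x)"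
    by (auto intro!: derivative_eq_intros)
  have "((\<lambda>x. f (s, x)) has_derivative (\<lambda>h. frechet_derivative f (at (s, x)) (0, h))) (at x)"
    using has_derivative_compose[OF 2, of f] D by simp
  moreover have "frechet_derivative f (at (s, x)) (0, h) = partial2 f (s, x) * h" for h
    using linear_scale[OF lin, of h "(0, 1)"] by (simp add: partial2_def)
  ultimately show "((\<lambda>x. f (s, x)) has_real_derivative partial2 f (s, x)) (at x)"
    by (simp add: has_field_derivative_def)
qed

text \<open>Symmetry of mixed partials by integration: f(s, t) is a boundary value plus the
  x-integral of \<open>partial2 f\<close>. Differentiating under the integral in s and then in the
  upper limit gives the claim.\<close>

lemma mixed_partials:
  assumes f: "smooth_on ({a<..<b} \<times> UNIV) f" and s: "s \<in> {a<..<b}"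
  shows "((\<lambda>x. partial1 f (s, x)) has_real_derivative partial1 (partial2 f) (s, x)) (at x)"
proof -
  define I where "I = {a<..<b}"
  note f = f[folded I_def] and s = s[folded I_def]
  note p = smooth_on_partials[OF f] and p2 = smooth_on_partials[OF smooth_on_partials(2)[OF f]]
  have c12: "continuous_on (I \<times> UNIV) (partial1 (partial2 f))" by (rule smooth_on_partials(3)[OF p2(1)])
  have cs: "continuous_on A (\<lambda>t. partial2 f (r, t))" if "r \<in> I" for r A
    by (rule continuous_on_compose2[OF p2(3)]) (use that in \<open>auto intro!: continuous_intros\<close>)
  have cs12: "continuous_on A (\<lambda>t. partial1 (partial2 f) (s, t))" for A
    by (rule continuous_on_compose2[OF c12]) (use s in \<open>auto intro!: continuous_intros\<close>)
  \<comment> \<open>The base point x - 1 puts x in the interior of the integration range, so the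
    one-sided fundamental theorem yields a two-sided derivative.\<close>
  have FTC: "f (r, t) = f (r, x - 1) + integral (cbox (x - 1) t) (\<lambda>\<xi>. partial2 f (r, \<xi>))"
    if "r \<in> I" "t \<ge> x - 1" for r t
  proof -
    have "((\<lambda>\<xi>. f (r, \<xi>)) has_vector_derivative partial2 f (r, \<xi>)) (at \<xi> within {x - 1..t})" for \<xi>
      using p(5)[of r \<xi>] that(1)
      by (simp add: has_real_derivative_iff_has_vector_derivative has_vector_derivative_at_within)
    then have "((\<lambda>\<xi>. partial2 f (r, \<xi>)) has_integral f (r, t) - f (r, x - 1)) {x - 1..t}"
      by (rule fundamental_theorem_of_calculus[OF that(2), of "\<lambda>\<xi>. f (r, \<xi>)"])
    from integral_unique[OF this] show ?thesis by simp
  qed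
  have D1: "partial1 f (s, t) = partial1 f (s, x - 1) + integral {x - 1..t} (\<lambda>\<xi>. partial1 (partial2 f) (s, \<xi>))"
    if t: "t \<ge> x - 1" for t
  proof -
    have "((\<lambda>r. integral (cbox (x - 1) t) (\<lambda>\<xi>. partial2 f (r, \<xi>))) has_field_derivative
       integral (cbox (x - 1) t) (\<lambda>\<xi>. partial1 (partial2 f) (s, \<xi>))) (at s within I)"
    proof (rule leibniz_rule_field_derivative)
      show "continuous_on (I \<times> cbox (x - 1) t) (\<lambda>(r, t). partial1 (partial2 f) (r, t))"
        by (auto simp: case_prod_eta intro: continuous_on_subset[OF c12])
      show "((\<lambda>r. partial2 f (r, \<xi>)) has_real_derivative partial1 (partial2 f) (r, \<xi>)) (at r within I)" if "r \<in> I" for r \<xi>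
        by (rule has_field_derivative_at_within[OF p2(4)]) (use that in simp)
      show "(\<lambda>\<xi>. partial2 f (r, \<xi>)) integrable_on cbox (x - 1) t" if "r \<in> I" for r
        by (rule integrable_continuous[OF cs[OF that]])
      show "s \<in> I" "convex I" using s by (auto simp: I_def)
    qed
    moreover have "open I" by (simp add: I_def)
    moreover have "at s within I = at s" by (rule at_within_open[OF s \<open>open I\<close>])
    ultimately have 1: "((\<lambda>r. integral (cbox (x - 1) t) (\<lambda>\<xi>. partial2 f (r, \<xi>))) has_real_derivative
       integral (cbox (x - 1) t) (\<lambda>\<xi>. partial1 (partial2 f) (s, \<xi>))) (at s)"
      by (simp only:)
    have "((\<lambda>r. f (r, x - 1) + integral (cbox (x - 1) t) (\<lambda>\<xi>. partial2 f (r, \<xi>))) has_real_derivative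
       partial1 f (s, x - 1) + integral (cbox (x - 1) t) (\<lambda>\<xi>. partial1 (partial2 f) (s, \<xi>))) (at s)"
    proof -
      have "((\<lambda>r. f (r, x - 1)) has_real_derivative partial1 f (s, x - 1)) (at s)" using p(4)[of s "x - 1"] s by simp
      from DERIV_add[OF this 1] show ?thesis .
    qed
    then have 2: "((\<lambda>r. f (r, t)) has_real_derivative
       partial1 f (s, x - 1) + integral (cbox (x - 1) t) (\<lambda>\<xi>. partial1 (partial2 f) (s, \<xi>))) (at s)"
      by (rule has_field_derivative_transform_within_open[OF _ \<open>open I\<close> s]) (rule FTC[OF _ t, symmetric])
    have "((\<lambda>r. f (r, t)) has_real_derivative partial1 f (s, t)) (at s)" using p(4)[of s t] s by simp
    from DERIV_unique[OF this 2] show ?thesis by simp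
  qed
  have "((\<lambda>t. integral {x - 1..t} (\<lambda>\<xi>. partial1 (partial2 f) (s, \<xi>))) has_vector_derivative partial1 (partial2 f) (s, x)) (at x within {x - 1..x + 1})"
    by (rule integral_has_vector_derivative[OF cs12]) auto
  then have "((\<lambda>t. integral {x - 1..t} (\<lambda>\<xi>. partial1 (partial2 f) (s, \<xi>))) has_real_derivative partial1 (partial2 f) (s, x)) (at x)"
    unfolding has_real_derivative_iff_has_vector_derivative
    by (subst (asm) at_within_interior) auto
  then have "((\<lambda>t. partial1 f (s, x - 1) + integral {x - 1..t} (\<lambda>\<xi>. partial1 (partial2 f) (s, \<xi>))) has_real_derivative partial1 (partial2 f) (s, x)) (at x)"
    by (auto intro!: derivative_eq_intros)
  then show ?thesis
    by (rule has_field_derivative_transform_within_open[of _ _ _ "{x - 1<..<x + 1}"]) (auto intro!: D1[symmetric])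
qed

text \<open>Gronwall for the pair (f, f1) with zero initial data; points to the left of
  \<open>x0\<close> are reached by reflection.\<close>

lemma linear_uniqueness:
  fixes f f1 q :: "real \<Rightarrow> real"
  assumes d: "\<And>x. (f has_real_derivative f1 x) (at x)" "\<And>x. (f1 has_real_derivative q x * f x) (at x)"
    and q: "continuous_on UNIV q" and z: "f x0 = 0" "f1 x0 = 0"
  shows "f x = 0"
proof -
  have fwd: "F x = 0" if d: "\<And>x. (F has_real_derivative F1 x) (at x)" "\<And>x. (F1 has_real_derivative r x * F x) (at x)"
    and r: "continuous_on UNIV r" and z: "F a = 0" "F1 a = 0" and ax: "a \<le> x" for F F1 r :: "real \<Rightarrow> real" and a x
  proof -
    have "compact (r ` {a..x})" by (intro compact_continuous_image continuous_on_subset[OF r]) auto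
    then obtain B where B: "\<And>t. t \<in> {a..x} \<Longrightarrow> \<bar>r t\<bar> \<le> B"
      using compact_imp_bounded bounded_iff by (metis image_eqI real_norm_def)
    have "norm (F x, F1 x) \<le> exp ((1 + B) * (x - a)) * norm (F a, F1 a)"
    proof (rule gronwall_norm[OF ax])
      fix t assume t: "a \<le> t" "t \<le> x"
      show "((\<lambda>x. (F x, F1 x)) has_vector_derivative (F1 t, r t * F t)) (at t)"
        using d by (intro has_vector_derivative_Pair) (auto simp: has_real_derivative_iff_has_vector_derivative)
      have "norm (F1 t, r t * F t) \<le> \<bar>F1 t\<bar> + \<bar>r t\<bar> * \<bar>F t\<bar>"
        using norm_Pair_le[of "F1 t" "r t * F t"] by (simp add: abs_mult)
      also have "\<dots> \<le> norm (F t, F1 t) + B * norm (F t, F1 t)"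
        using B[of t] t norm_fst_le[of "F t" "F1 t"] norm_snd_le[of "F1 t" "F t"]
        by (intro add_mono mult_mono) auto
      finally show "norm (F1 t, r t * F t) \<le> (1 + B) * norm (F t, F1 t)" by (simp add: algebra_simps)
    qed
    then show ?thesis using z by (simp add: zero_prod_def)
  qed
  show ?thesis
  proof (cases "x0 \<le> x")
    case True then show ?thesis using fwd[OF d q z] by blast
  next
    case False
    have "(\<lambda>t. f (- t)) (- x) = 0"
    proof (rule fwd[of "\<lambda>t. f (- t)" "\<lambda>t. - f1 (- t)" "\<lambda>t. q (- t)" "- x0"])
      show "((\<lambda>t. f (- t)) has_real_derivative - f1 (- t)) (at t)" for t
        using DERIV_chain'[OF DERIV_minus[OF DERIV_ident] d(1)] by simp
      show "((\<lambda>t. - f1 (- t)) has_real_derivative q (- t) * f (- t)) (at t)" for t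
        using DERIV_minus[OF DERIV_chain'[OF DERIV_minus[OF DERIV_ident] d(2)]] by simp
      show "continuous_on UNIV (\<lambda>t. q (- t))"
        by (rule continuous_on_compose2[OF q]) (auto intro!: continuous_intros)
    qed (use False z in auto)
    then show ?thesis by simp
  qed
qed

section \<open>Decay and moment of a family of homoclinic profiles\<close>


lemma abs_le_deriv_bound:
  fixes f f' :: "real \<Rightarrow> real"
  assumes "\<And>t. (f has_real_derivative f' t) (at t)" "f 0 = 0" "\<And>t. \<bar>t\<bar> \<le> \<bar>z\<bar> \<Longrightarrow> \<bar>f' t\<bar> \<le> B"
  shows "\<bar>f z\<bar> \<le> B * \<bar>z\<bar>"
proof -
  have "norm (f z - f 0) \<le> B * norm (z - 0)"
  proof (rule field_differentiable_bound[of "{-\<bar>z\<bar>..\<bar>z\<bar>}" f f'])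
    show "(f has_real_derivative f' t) (at t within {-\<bar>z\<bar>..\<bar>z\<bar>})" for t
      by (rule has_field_derivative_at_within[OF assms(1)])
    show "norm (f' t) \<le> B" if "t \<in> {-\<bar>z\<bar>..\<bar>z\<bar>}" for t
      using assms(3)[of t] that by auto
  qed auto
  then show ?thesis using assms(2) by simp
qed

text \<open>Mean value theorem on the intervals [n, n + 1]. Convergence of f alone does not make its
  derivative tend to 0, but a sequence suffices to identify a constant of integration.\<close>

lemma small_derivative_sequence:
  fixes f f1 :: "real \<Rightarrow> real"
  assumes d: "\<And>x. (f has_real_derivative f1 x) (at x)" and lim: "(f \<longlongrightarrow> L) at_top"
  shows "\<exists>\<xi>. filterlim \<xi> at_top sequentially \<and> (\<lambda>n. f1 (\<xi> n)) \<longlonglongrightarrow> 0"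
proof -
  have "\<exists>z. real n < z \<and> f (real n + 1) - f (real n) = f1 z" for n
    using MVT2[of "real n" "real n + 1" f f1] d by auto
  then obtain \<xi> where xi: "\<And>n. real n < \<xi> n" "\<And>n. f (real n + 1) - f (real n) = f1 (\<xi> n)" by metis
  have "filterlim \<xi> at_top sequentially"
    by (rule filterlim_at_top_mono[OF filterlim_real_sequentially]) (use xi(1) in \<open>auto intro!: always_eventually less_imp_le\<close>)
  moreover have 1: "(\<lambda>n. f (real n)) \<longlonglongrightarrow> L"
    by (rule filterlim_compose[OF lim filterlim_real_sequentially])
  have "(\<lambda>n. f (real n + 1) - f (real n)) \<longlonglongrightarrow> L - L"
    using tendsto_diff[OF LIMSEQ_Suc[OF 1] 1] by (simp add: add.commute)
  ultimately show ?thesis using xi(2) by auto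
qed

text \<open>Half of the exponent is spent on the linear factor, using 1 + k u / 2 \<le> exp (k u /
  2).\<close>

lemma linear_exp_le:
  fixes k u A B :: real
  assumes "k > 0" "u \<ge> 0" "A \<ge> 0" "B \<ge> 0"
  shows "(A + B * u) * exp (- (k * u)) \<le> (A + 2 * B / k) * exp (- (k / 2 * u))"
proof -
  have e: "1 + k / 2 * u \<le> exp (k / 2 * u)" by (rule exp_ge_add_one_self)
  have e1: "exp (- (k * u)) = exp (- (k / 2 * u)) * exp (- (k / 2 * u))"
    by (simp add: exp_add[symmetric])
  have "B * u = 2 * B / k * (k / 2 * u)" using assms by simp
  also have "\<dots> \<le> 2 * B / k * exp (k / 2 * u)" by (rule mult_left_mono) (use assms e in linarith, use assms in simp)
  moreover have "A * 1 \<le> A * exp (k / 2 * u)" using assms by (intro mult_left_mono) auto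
  ultimately have "A + B * u \<le> (A + 2 * B / k) * exp (k / 2 * u)" by (simp add: distrib_right)
  then have "(A + B * u) * exp (- (k * u)) \<le> (A + 2 * B / k) * exp (k / 2 * u) * exp (- (k * u))"
    by (intro mult_right_mono) auto
  also have "\<dots> = (A + 2 * B / k) * (exp (k / 2 * u) * exp (- (k / 2 * u))) * exp (- (k / 2 * u))"
    unfolding e1 by (simp add: mult_ac)
  also have "\<dots> = (A + 2 * B / k) * exp (- (k / 2 * u))"
    by (simp add: exp_add[symmetric])
  finally show ?thesis .
qed

text \<open>Here \<open>y s = v\<^sup>s - v\<^sub>\<infinity>\<close>, \<open>w = \<partial>\<^sub>s v\<^sup>s\<close>, and \<open>g z = p (v\<^sub>\<infinity> + z) - p v\<^sub>\<infinity>\<close> with antiderivative \<open>G\<close>.\<close>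

locale profile_family =
  fixes \<kappa> s0 \<delta> :: real and g g' G :: "real \<Rightarrow> real" and y y1 w w1 :: "real \<Rightarrow> real \<Rightarrow> real" and I :: "real set"
  assumes kap: "\<kappa> > 0" and del: "\<delta> > 0" and I: "I = {s0 - \<delta><..<s0 + \<delta>}"
    and G: "\<And>z. (G has_real_derivative g z) (at z)" "G 0 = 0"
    and g: "\<And>z. (g has_real_derivative g' z) (at z)" "g 0 = 0" "continuous_on UNIV g'"
    and saddle: "s0\<^sup>2 + g' 0 < 0"
    and dx: "\<And>s x. s \<in> I \<Longrightarrow> (y s has_real_derivative y1 s x) (at x)"
      "\<And>s x. s \<in> I \<Longrightarrow> (y1 s has_real_derivative - (s\<^sup>2 * y s x + g (y s x)) / \<kappa>) (at x)"
      "\<And>s x. s \<in> I \<Longrightarrow> (w s has_real_derivative w1 s x) (at x)"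
    and ds: "\<And>s x. s \<in> I \<Longrightarrow> ((\<lambda>s. y s x) has_real_derivative w s x) (at s)"
      "\<And>s x. s \<in> I \<Longrightarrow> ((\<lambda>s. y1 s x) has_real_derivative w1 s x) (at s)"
    and joint: "continuous_on (I \<times> UNIV) (\<lambda>(s, x). y s x)" "continuous_on (I \<times> UNIV) (\<lambda>(s, x). y1 s x)"
      "continuous_on (I \<times> UNIV) (\<lambda>(s, x). w s x)" "continuous_on (I \<times> UNIV) (\<lambda>(s, x). w1 s x)"
    and lim: "\<And>s. s \<in> I \<Longrightarrow> (y s \<longlongrightarrow> 0) at_top"
    and nonzero: "\<exists>x. y s0 x \<noteq> 0"
begin

text \<open>The energy is a first integral of the profile equation. Its value is read off along a
  sequence on which \<open>y1\<close> tends to 0, since the limit of \<open>y1\<close> itself is not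
  among the assumptions.\<close>

lemma energy_zero:
  assumes s: "s \<in> I"
  shows "\<kappa> * (y1 s x)\<^sup>2 / 2 + s\<^sup>2 * (y s x)\<^sup>2 / 2 + G (y s x) = 0"
proof -
  let ?E = "\<lambda>x. \<kappa> * (y1 s x)\<^sup>2 / 2 + s\<^sup>2 * (y s x)\<^sup>2 / 2 + G (y s x)"
  have dG: "((\<lambda>x. G (y s x)) has_real_derivative g (y s x) * y1 s x) (at x)" for x
    using DERIV_chain2[OF G(1) dx(1)[OF s]] by simp
  have dE: "(?E has_real_derivative 0) (at x)" for x
    using kap by (auto intro!: derivative_eq_intros dx(1,2)[OF s] dG simp: field_simps)
  have const: "?E t = ?E x" for t
    by (rule DERIV_isconst_all) (rule allI, rule dE)
  obtain \<xi> where xi: "filterlim \<xi> at_top sequentially" "(\<lambda>n. y1 s (\<xi> n)) \<longlonglongrightarrow> 0"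
    using small_derivative_sequence[OF dx(1)[OF s] lim[OF s]] by blast
  have ly: "(\<lambda>n. y s (\<xi> n)) \<longlonglongrightarrow> 0" by (rule filterlim_compose[OF lim[OF s] xi(1)])
  have lG: "(\<lambda>n. G (y s (\<xi> n))) \<longlonglongrightarrow> G 0"
    by (rule isCont_tendsto_compose[OF DERIV_isCont[OF G(1)] ly])
  have "(\<lambda>n. ?E (\<xi> n)) \<longlonglongrightarrow> \<kappa> * 0\<^sup>2 / 2 + s\<^sup>2 * 0\<^sup>2 / 2 + G 0"
    by (intro tendsto_intros xi(2) ly lG) auto
  moreover have "(\<lambda>n. ?E (\<xi> n)) = (\<lambda>n. ?E x)" by (rule ext, rule const)
  ultimately have "(\<lambda>n::nat. ?E x) \<longlonglongrightarrow> 0" using G(2) by simp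
  from LIMSEQ_unique[OF tendsto_const this] show ?thesis .
qed

text \<open>The energy vanishes for every speed, so its s-derivative vanishes too. This first-order
  relation serves both the decay of \<open>w\<close>, \<open>w1\<close> and the integration by parts
  in the moment.\<close>

lemma energy_s_derivative:
  assumes s: "s \<in> I"
  shows "\<kappa> * y1 s x * w1 s x = - (s\<^sup>2 * y s x + g (y s x)) * w s x - s * (y s x)\<^sup>2"
proof -
  have dG: "((\<lambda>s. G (y s x)) has_real_derivative g (y s x) * w s x) (at s)"
    using DERIV_chain2[OF G(1) ds(1)[OF s]] by simp
  have "((\<lambda>s. \<kappa> * (y1 s x)\<^sup>2 / 2 + s\<^sup>2 * (y s x)\<^sup>2 / 2 + G (y s x)) has_real_derivative
     \<kappa> * y1 s x * w1 s x + s * (y s x)\<^sup>2 + s\<^sup>2 * y s x * w s x + g (y s x) * w s x) (at s)"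
    by (auto intro!: derivative_eq_intros ds[OF s] dG simp: algebra_simps power2_eq_square)
  then have "((\<lambda>s. 0) has_real_derivative
     \<kappa> * y1 s x * w1 s x + s * (y s x)\<^sup>2 + s\<^sup>2 * y s x * w s x + g (y s x) * w s x) (at s)"
  proof (rule has_field_derivative_transform_within_open[of _ _ _ I])
    show "open I" unfolding I by simp
  qed (rule s, rule energy_zero)
  from DERIV_unique[OF this DERIV_const] show ?thesis by (simp add: algebra_simps)
qed

text \<open>Second-order Taylor control of the potential at the saddle. The quadratic form stays
  negative for all speeds near \<open>s0\<close>, so the resulting rates are uniform in
  \<open>s\<close>.\<close>

lemma near_zero:
  obtains \<epsilon> \<tau> B d where "\<epsilon> > 0" "\<tau> > 0" "B \<ge> 0" "d > 0" "d < \<delta>"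
    "\<And>z. \<bar>z\<bar> \<le> \<epsilon> \<Longrightarrow> \<bar>g z\<bar> \<le> B * \<bar>z\<bar>"
    "\<And>s z. \<bar>s - s0\<bar> \<le> d \<Longrightarrow> \<bar>z\<bar> \<le> \<epsilon> \<Longrightarrow> s\<^sup>2 * z\<^sup>2 / 2 + G z \<le> - \<tau> * z\<^sup>2"
    "\<And>s z. \<bar>z\<bar> \<le> \<epsilon> \<Longrightarrow> - B * z\<^sup>2 \<le> s\<^sup>2 * z\<^sup>2 / 2 + G z"
proof -
  \<comment> \<open>With s0^2 + g'(0) = -8 \<tau>, the quadratic coefficient is -4 \<tau>; the
    errors from s^2 and from G cost \<tau> / 2 and \<tau>, which leaves room below -\<tau>.\<close>
  define \<tau> where "\<tau> = - (s0\<^sup>2 + g' 0) / 8"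
  have t0: "\<tau> > 0" using saddle by (simp add: \<tau>_def)
  have "isCont g' 0" using g(3) by (simp add: continuous_on_eq_continuous_at)
  then have "\<forall>\<^sub>F z in nhds 0. dist (g' z) (g' 0) < \<tau>" using t0
    by (metis isCont_def tendsto_at_iff_tendsto_nhds tendstoD)
  then obtain \<epsilon>' where e': "\<epsilon>' > 0" "\<And>z. \<bar>z\<bar> < \<epsilon>' \<Longrightarrow> \<bar>g' z - g' 0\<bar> < \<tau>"
    unfolding eventually_nhds_metric dist_real_def by auto
  define \<epsilon> where "\<epsilon> = \<epsilon>' / 2"
  have e: "\<epsilon> > 0" "\<And>z. \<bar>z\<bar> \<le> \<epsilon> \<Longrightarrow> \<bar>g' z - g' 0\<bar> \<le> \<tau>" using e' by (auto simp: \<epsilon>_def less_imp_le)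
  have gb: "\<bar>g z - g' 0 * z\<bar> \<le> \<tau> * \<bar>z\<bar>" if "\<bar>z\<bar> \<le> \<epsilon>" for z
  proof (rule abs_le_deriv_bound[of "\<lambda>z. g z - g' 0 * z" "\<lambda>z. g' z - g' 0"])
    show "((\<lambda>z. g z - g' 0 * z) has_real_derivative g' t - g' 0) (at t)" for t
      by (auto intro!: derivative_eq_intros g(1))
    show "\<bar>g' t - g' 0\<bar> \<le> \<tau>" if "\<bar>t\<bar> \<le> \<bar>z\<bar>" for t
      by (rule e(2)) (use that \<open>\<bar>z\<bar> \<le> \<epsilon>\<close> in linarith)
  qed (simp add: g(2))
  have Gb: "\<bar>G z - g' 0 * z\<^sup>2 / 2\<bar> \<le> \<tau> * z\<^sup>2" if z: "\<bar>z\<bar> \<le> \<epsilon>" for z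
  proof -
    have "\<bar>G z - g' 0 * z\<^sup>2 / 2\<bar> \<le> (\<tau> * \<bar>z\<bar>) * \<bar>z\<bar>"
    proof (rule abs_le_deriv_bound[of "\<lambda>z. G z - g' 0 * z\<^sup>2 / 2" "\<lambda>z. g z - g' 0 * z"])
      fix t assume "\<bar>t\<bar> \<le> \<bar>z\<bar>"
      then have "\<bar>g t - g' 0 * t\<bar> \<le> \<tau> * \<bar>t\<bar>" "\<tau> * \<bar>t\<bar> \<le> \<tau> * \<bar>z\<bar>" using gb[of t] z t0 by auto
      then show "\<bar>g t - g' 0 * t\<bar> \<le> \<tau> * \<bar>z\<bar>" by linarith
    next
      show "((\<lambda>z. G z - g' 0 * z\<^sup>2 / 2) has_real_derivative g t - g' 0 * t) (at t)" for t
        by (auto intro!: derivative_eq_intros G(1))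
    qed (simp add: G(2))
    then show ?thesis by (simp add: power2_eq_square abs_mult_self_eq mult.assoc)
  qed
  have "\<forall>\<^sub>F s in nhds s0. dist (s\<^sup>2) (s0\<^sup>2) < \<tau>"
    using t0 by (intro tendstoD tendsto_intros) (auto simp: filterlim_ident)
  then obtain d' where d': "d' > 0" "\<And>s. \<bar>s - s0\<bar> < d' \<Longrightarrow> \<bar>s\<^sup>2 - s0\<^sup>2\<bar> < \<tau>"
    unfolding eventually_nhds_metric dist_real_def by auto
  define d where "d = min d' \<delta> / 2"
  have d: "d > 0" "d < \<delta>" "d < d'" using d' del by (auto simp: d_def min_def)
  define B where "B = \<bar>g' 0\<bar> + \<tau>"
  have B0: "B \<ge> 0" using t0 by (simp add: B_def)
  show ?thesis
  proof (rule that[OF e(1) t0 B0 d(1,2)])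
    show "\<bar>g z\<bar> \<le> B * \<bar>z\<bar>" if z: "\<bar>z\<bar> \<le> \<epsilon>" for z
    proof -
      have "\<bar>g z\<bar> \<le> \<bar>g' 0 * z\<bar> + \<tau> * \<bar>z\<bar>" using gb[OF z] by linarith
      then show ?thesis by (simp add: B_def abs_mult distrib_right)
    qed
    show "s\<^sup>2 * z\<^sup>2 / 2 + G z \<le> - \<tau> * z\<^sup>2" if s: "\<bar>s - s0\<bar> \<le> d" and z: "\<bar>z\<bar> \<le> \<epsilon>" for s z
    proof -
      have "s\<^sup>2 \<le> s0\<^sup>2 + \<tau>" using d'(2)[of s] s d(3) by linarith
      then have "s\<^sup>2 * z\<^sup>2 \<le> (s0\<^sup>2 + \<tau>) * z\<^sup>2" by (intro mult_right_mono) auto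
      moreover have "G z \<le> g' 0 * z\<^sup>2 / 2 + \<tau> * z\<^sup>2" using Gb[OF z] by linarith
      ultimately have "s\<^sup>2 * z\<^sup>2 / 2 + G z \<le> (s0\<^sup>2 + g' 0) * z\<^sup>2 / 2 + \<tau> * z\<^sup>2 / 2 + \<tau> * z\<^sup>2"
        by (simp add: distrib_right add_divide_distrib)
      also have "s0\<^sup>2 + g' 0 = - 8 * \<tau>" by (simp add: \<tau>_def)
      finally have le: "s\<^sup>2 * z\<^sup>2 / 2 + G z \<le> - 8 * \<tau> * z\<^sup>2 / 2 + \<tau> * z\<^sup>2 / 2 + \<tau> * z\<^sup>2" .
      have "0 \<le> \<tau> * z\<^sup>2" using t0 by simp
      then show ?thesis using le by linarith
    qed
    show "- B * z\<^sup>2 \<le> s\<^sup>2 * z\<^sup>2 / 2 + G z" if z: "\<bar>z\<bar> \<le> \<epsilon>" for s z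
    proof -
      have "g' 0 * z\<^sup>2 / 2 - \<tau> * z\<^sup>2 \<le> G z" using Gb[OF z] by linarith
      moreover have "- (\<bar>g' 0\<bar> * z\<^sup>2) \<le> g' 0 * z\<^sup>2 / 2"
      proof -
        have "- \<bar>g' 0\<bar> * z\<^sup>2 \<le> g' 0 / 2 * z\<^sup>2" by (intro mult_right_mono) auto
        then show ?thesis by simp
      qed
      moreover have "0 \<le> s\<^sup>2 * z\<^sup>2 / 2" by simp
      moreover have "- B * z\<^sup>2 = - (\<bar>g' 0\<bar> * z\<^sup>2) - \<tau> * z\<^sup>2" by (simp add: B_def algebra_simps)
      ultimately show ?thesis by linarith
    qed
  qed
qed

text \<open>Near the endstate the energy identity gives \<open>k |y| \<le> |y'|\<close>, so once a profile moves towards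
  the endstate inside this neighbourhood it keeps doing so.\<close>

lemma tail_propagation:
  assumes s: "s \<in> I" and tau: "\<tau> > 0"
    and le: "\<forall>z. \<bar>z\<bar> \<le> \<epsilon> \<longrightarrow> s\<^sup>2 * z\<^sup>2 / 2 + G z \<le> - \<tau> * z\<^sup>2"
    and ge: "\<forall>z. \<bar>z\<bar> \<le> \<epsilon> \<longrightarrow> - B * z\<^sup>2 \<le> s\<^sup>2 * z\<^sup>2 / 2 + G z"
    and X: "\<bar>y s X\<bar> < \<epsilon>" "y s X * y1 s X < 0" and x: "x \<ge> X"
    and k: "k = sqrt (2 * \<tau> / \<kappa>)" and K: "K = sqrt (2 * B / \<kappa>)"
  shows "y s x * y1 s x < 0" "k * \<bar>y s x\<bar> \<le> \<bar>y1 s x\<bar>" "\<bar>y1 s x\<bar> \<le> K * \<bar>y s x\<bar>"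
    "\<bar>y s x\<bar> \<le> \<epsilon> * exp (- (k * (x - X)))" "\<bar>y s x\<bar> \<le> \<epsilon>"
proof -
  have k0: "k > 0" using tau kap k by simp
  \<comment> \<open>Energy identity solved for y1^2, with the two quadratic bounds inserted and
    square roots taken.\<close>
  have cmp: "k * \<bar>y s t\<bar> \<le> \<bar>y1 s t\<bar> \<and> \<bar>y1 s t\<bar> \<le> K * \<bar>y s t\<bar>" if t: "\<bar>y s t\<bar> \<le> \<epsilon>" for t
  proof -
    have E: "\<kappa> * (y1 s t)\<^sup>2 / 2 = - (s\<^sup>2 * (y s t)\<^sup>2 / 2 + G (y s t))" using energy_zero[OF s, of t] by linarith
    have 1: "2 * \<tau> / \<kappa> * (y s t)\<^sup>2 \<le> (y1 s t)\<^sup>2" using le[rule_format, OF t] E kap by (simp add: field_simps)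
    have 2: "(y1 s t)\<^sup>2 \<le> 2 * B / \<kappa> * (y s t)\<^sup>2" using ge[rule_format, OF t] E kap by (simp add: field_simps)
    show ?thesis using real_sqrt_le_mono[OF 1] real_sqrt_le_mono[OF 2] unfolding k K real_sqrt_mult by simp
  qed
  have cy: "continuous_on A (y s)" "continuous_on A (y1 s)" for A
    by (rule DERIV_continuous_on[OF has_field_derivative_at_within[OF dx(1)[OF s]]])
      (rule DERIV_continuous_on[OF has_field_derivative_at_within[OF dx(2)[OF s]]])
  have dz: "((\<lambda>t. (y s t)\<^sup>2) has_real_derivative 2 * (y s t * y1 s t)) (at t)" for t
    by (auto intro!: derivative_eq_intros dx[OF s])
  have dze: "((\<lambda>t. exp (2 * b * (t - X)) * (y s t)\<^sup>2) has_real_derivative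
     2 * exp (2 * b * (t - X)) * (y s t * y1 s t + b * (y s t)\<^sup>2)) (at t)" for b t
    by (auto intro!: derivative_eq_intros dx[OF s] simp: algebra_simps power2_eq_square)
  \<comment> \<open>Suppose the sign of y y1 changes, and let \<open>r\<close> be the first point
    where it is nonnegative. Up to \<open>r\<close> the modulus of y decreases, so the smallness
    region is not left; neither factor vanishes at \<open>r\<close>, hence the product is positive
    there, against continuity from the left.\<close>
  have neg: "y s t * y1 s t < 0" if t: "t \<ge> X" for t
  proof (rule ccontr)
    assume neg: "\<not> y s t * y1 s t < 0"
    define S where "S = {r \<in> {X..t}. 0 \<le> y s r * y1 s r}"
    have ne: "t \<in> S" using neg t by (simp add: S_def)
    have bdd: "bdd_below S" by (auto simp: S_def bdd_below_def)
    have "closed S"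
    proof -
      have c: "continuous_on {X..t} (\<lambda>r. y s r * y1 s r)" by (intro continuous_intros cy)
      have "S = {X..t} \<inter> (\<lambda>r. y s r * y1 s r) -` {0..}" by (auto simp: S_def)
      then show ?thesis using continuous_closed_preimage[OF c closed_atLeastAtMost closed_atLeast] by simp
    qed
    define r where "r = Inf S"
    have rS: "r \<in> S" unfolding r_def using closed_contains_Inf[OF _ bdd \<open>closed S\<close>] ne by blast
    have rX: "X \<le> r" "r \<le> t" "0 \<le> y s r * y1 s r" using rS by (auto simp: S_def)
    have below: "y s q * y1 s q < 0" if "X \<le> q" "q < r" for q
    proof (rule ccontr)
      assume "\<not> y s q * y1 s q < 0"
      then have "q \<in> S" using that rX by (simp add: S_def)
      then have "r \<le> q" unfolding r_def by (rule cInf_lower[OF _ bdd])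
      then show False using that by simp
    qed
    have "X < r" using rX X(2) by (cases "X = r") auto
    have small: "\<bar>y s q\<bar> < \<epsilon>" if q: "X \<le> q" "q \<le> r" for q
    proof (cases "X = q")
      case False
      have "(y s q)\<^sup>2 \<le> (y s X)\<^sup>2"
      proof (rule DERIV_nonpos_imp_decreasing_open[OF q(1), of "\<lambda>t. (y s t)\<^sup>2"])
        fix u assume "X < u" "u < q"
        then have "2 * (y s u * y1 s u) \<le> 0" using below[of u] q by simp
        then show "\<exists>l. ((\<lambda>t. (y s t)\<^sup>2) has_real_derivative l) (at u) \<and> l \<le> 0" using dz by blast
      qed (intro continuous_intros cy)
      then show ?thesis unfolding abs_le_square_iff[symmetric] using X(1) by linarith
    qed (use X in simp)
    \<comment> \<open>The bound |y1| \<le> K |y| makes exp (2 K t) y^2 nondecreasing, so y cannot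
      reach 0 at the finite point \<open>r\<close>.\<close>
    have pos: "(y s r)\<^sup>2 > 0"
    proof -
      have "exp (2 * K * (X - X)) * (y s X)\<^sup>2 \<le> exp (2 * K * (r - X)) * (y s r)\<^sup>2"
      proof (rule DERIV_nonneg_imp_nondecreasing[OF rX(1)])
        fix q assume q: "X \<le> q" "q \<le> r"
        have "\<bar>y s q * y1 s q\<bar> \<le> \<bar>y s q\<bar> * (K * \<bar>y s q\<bar>)"
          unfolding abs_mult using cmp small[OF q] by (intro mult_left_mono) auto
        then have "\<bar>y s q * y1 s q\<bar> \<le> K * (y s q)\<^sup>2" by (simp add: power2_eq_square mult_ac)
        then have "0 \<le> y s q * y1 s q + K * (y s q)\<^sup>2" by linarith
        then have "0 \<le> 2 * exp (2 * K * (q - X)) * (y s q * y1 s q + K * (y s q)\<^sup>2)" by simp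
        then show "\<exists>l. ((\<lambda>q. exp (2 * K * (q - X)) * (y s q)\<^sup>2) has_real_derivative l) (at q) \<and> 0 \<le> l"
          using dze[of K q] by blast
      qed
      moreover have "0 < (y s X)\<^sup>2" using X(2) by auto
      ultimately have "0 < exp (2 * K * (r - X)) * (y s r)\<^sup>2" by (simp only: diff_self mult_zero_right exp_zero mult_1)
      then show ?thesis by (simp add: zero_less_mult_iff)
    qed
    then have yr: "y s r \<noteq> 0" by auto
    have "\<bar>y1 s r\<bar> \<ge> k * \<bar>y s r\<bar>" using cmp[of r] small[of r] rX by auto
    moreover have "k * \<bar>y s r\<bar> > 0" using k0 yr by simp
    ultimately have "y1 s r \<noteq> 0" by auto
    then have gt: "y s r * y1 s r > 0" using yr rX(3) by (simp add: less_le)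
    have "((\<lambda>r. y s r * y1 s r) \<longlongrightarrow> y s r * y1 s r) (at_left r)"
      using DERIV_isCont[OF dx(1)[OF s]] DERIV_isCont[OF dx(2)[OF s]]
      by (intro tendsto_intros) (auto simp: isCont_def filterlim_at_split)
    moreover have "\<forall>\<^sub>F q in at_left r. y s q * y1 s q \<le> 0"
      using below \<open>X < r\<close>
      by (auto simp: eventually_at_left[OF \<open>X < r\<close>] intro!: exI[of _ X] less_imp_le)
    ultimately have "y s r * y1 s r \<le> 0" using tendsto_upperbound trivial_limit_at_left_real by blast
    then show False using gt by simp
  qed
  then show "y s x * y1 s x < 0" using x by simp
  have mono: "(y s t)\<^sup>2 \<le> (y s X)\<^sup>2" if "t \<ge> X" for t
  proof (rule DERIV_nonpos_imp_nonincreasing[OF that, of "\<lambda>t. (y s t)\<^sup>2"])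
    fix u assume "X \<le> u" "u \<le> t"
    then have "2 * (y s u * y1 s u) \<le> 0" using neg[of u] by simp
    then show "\<exists>l. ((\<lambda>t. (y s t)\<^sup>2) has_real_derivative l) (at u) \<and> l \<le> 0" using dz by blast
  qed
  have small: "\<bar>y s t\<bar> \<le> \<epsilon>" if "t \<ge> X" for t
    using mono[OF that, folded abs_le_square_iff] X(1) by linarith
  then show "\<bar>y s x\<bar> \<le> \<epsilon>" using x by simp
  show "k * \<bar>y s x\<bar> \<le> \<bar>y1 s x\<bar>" "\<bar>y1 s x\<bar> \<le> K * \<bar>y s x\<bar>" using cmp small x by auto
  have "exp (2 * k * (x - X)) * (y s x)\<^sup>2 \<le> exp (2 * k * (X - X)) * (y s X)\<^sup>2"
  proof (rule DERIV_nonpos_imp_nonincreasing[OF x])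
    fix q assume q: "X \<le> q" "q \<le> x"
    have "\<bar>y s q\<bar> * (k * \<bar>y s q\<bar>) \<le> \<bar>y s q * y1 s q\<bar>"
      unfolding abs_mult using cmp small[OF q(1)] by (intro mult_left_mono) auto
    then have "k * (y s q)\<^sup>2 \<le> \<bar>y s q * y1 s q\<bar>" by (simp add: power2_eq_square mult_ac)
    then have "y s q * y1 s q + k * (y s q)\<^sup>2 \<le> 0" using neg[OF q(1)] by linarith
    then have "2 * exp (2 * k * (q - X)) * (y s q * y1 s q + k * (y s q)\<^sup>2) \<le> 0" by (simp add: mult_le_0_iff)
    then show "\<exists>l. ((\<lambda>q. exp (2 * k * (q - X)) * (y s q)\<^sup>2) has_real_derivative l) (at q) \<and> l \<le> 0"
      using dze[of k q] by blast
  qed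
  then have "(exp (k * (x - X)) * \<bar>y s x\<bar>)\<^sup>2 \<le> \<bar>y s X\<bar>\<^sup>2"
    by (simp add: power_mult_distrib exp_double[symmetric] mult.assoc)
  then have "exp (k * (x - X)) * \<bar>y s x\<bar> \<le> \<epsilon>" using X(1) power2_le_imp_le[of "exp (k * (x - X)) * \<bar>y s x\<bar>" "\<bar>y s X\<bar>"] by simp
  then show "\<bar>y s x\<bar> \<le> \<epsilon> * exp (- (k * (x - X)))"
  proof -
    assume "exp (k * (x - X)) * \<bar>y s x\<bar> \<le> \<epsilon>"
    then have "exp (- (k * (x - X))) * (exp (k * (x - X)) * \<bar>y s x\<bar>) \<le> exp (- (k * (x - X))) * \<epsilon>"
      by (intro mult_left_mono) auto
    moreover have "exp (- (k * (x - X))) * (exp (k * (x - X)) * \<bar>y s x\<bar>) = \<bar>y s x\<bar>" by (simp add: exp_minus)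
    ultimately show ?thesis by (simp only: mult.commute[of \<epsilon>])
  qed
qed

end


section \<open>Exponential decay of the profiles, uniform in the speed\<close>

context profile_family begin

lemma s0_in: "s0 \<in> I" using del I by simp

lemma open_I: "open I" by (simp add: I)

lemma y_continuous: "s \<in> I \<Longrightarrow> continuous_on A (y s)"
  by (rule DERIV_continuous_on[OF has_field_derivative_at_within[OF dx(1)]])

text \<open>\<open>y1\<close> solves the linearized second-order equation and has zero data at
  \<open>x0\<close>, so it vanishes identically; the then constant profile equals its limit
  0.\<close>

lemma stationary_point_trivial:
  assumes s: "s \<in> I" and z: "y1 s x0 = 0" "s\<^sup>2 * y s x0 + g (y s x0) = 0"
  shows "y s x = 0"
proof -
  have y10: "y1 s t = 0" for t
  proof (rule linear_uniqueness[of "y1 s" "\<lambda>t. - (s\<^sup>2 * y s t + g (y s t)) / \<kappa>" "\<lambda>t. - (s\<^sup>2 + g' (y s t)) / \<kappa>" x0])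
    show "((\<lambda>t. - (s\<^sup>2 * y s t + g (y s t)) / \<kappa>) has_real_derivative - (s\<^sup>2 + g' (y s t)) / \<kappa> * y1 s t) (at t)" for t
    proof -
      have "((\<lambda>t. g (y s t)) has_real_derivative g' (y s t) * y1 s t) (at t)"
        using DERIV_chain2[OF g(1) dx(1)[OF s]] by simp
      then show ?thesis
        using kap by (auto intro!: derivative_eq_intros dx(1)[OF s] simp: field_simps)
    qed
    show "continuous_on UNIV (\<lambda>t. - (s\<^sup>2 + g' (y s t)) / \<kappa>)"
      using kap by (intro continuous_intros continuous_on_compose2[OF g(3) y_continuous[OF s]]) auto
  qed (use dx(2)[OF s] z in auto)
  have "y s t = y s x" for t
    by (rule DERIV_isconst_all) (use dx(1)[OF s] y10 in metis)
  then have "y s = (\<lambda>t. y s x)" by auto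
  then have "((\<lambda>t::real. y s x) \<longlongrightarrow> 0) at_top" using lim[OF s] by simp
  from tendsto_unique[OF _ tendsto_const this] show ?thesis by simp
qed

text \<open>If y y1 were nonnegative on a whole tail, y^2 would be nondecreasing with limit 0, hence
  zero at the start of the tail; the energy identity then makes that point stationary and the
  profile trivial.\<close>

lemma approach_start:
  assumes e: "\<epsilon> > 0"
  obtains X where "X \<ge> 0" "\<bar>y s0 X\<bar> < \<epsilon>" "y s0 X * y1 s0 X < 0"
proof -
  note s = s0_in
  have "\<forall>\<^sub>F x in at_top. dist (y s0 x) 0 < \<epsilon>" by (rule tendstoD[OF lim[OF s] e])
  then obtain X1 where X1: "\<And>x. x \<ge> X1 \<Longrightarrow> \<bar>y s0 x\<bar> < \<epsilon>"
    by (auto simp: eventually_at_top_linorder)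
  define X0 where "X0 = max X1 0"
  have "\<exists>X\<ge>X0. y s0 X * y1 s0 X < 0"
  proof (rule ccontr)
    assume "\<not> ?thesis"
    then have nn: "0 \<le> y s0 X * y1 s0 X" if "X \<ge> X0" for X using that by force
    have dz: "((\<lambda>t. (y s0 t)\<^sup>2) has_real_derivative 2 * (y s0 t * y1 s0 t)) (at t)" for t
      by (auto intro!: derivative_eq_intros dx(1)[OF s])
    have mono: "(y s0 X0)\<^sup>2 \<le> (y s0 t)\<^sup>2" if "t \<ge> X0" for t
    proof (rule DERIV_nonneg_imp_nondecreasing[OF that, of "\<lambda>t. (y s0 t)\<^sup>2"])
      fix u assume "X0 \<le> u" "u \<le> t"
      then have "0 \<le> 2 * (y s0 u * y1 s0 u)" using nn[of u] by simp
      then show "\<exists>l. ((\<lambda>t. (y s0 t)\<^sup>2) has_real_derivative l) (at u) \<and> 0 \<le> l" using dz by blast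
    qed
    have "((\<lambda>t. (y s0 t)\<^sup>2) \<longlongrightarrow> 0\<^sup>2) at_top" by (intro tendsto_intros lim s)
    moreover have "\<forall>\<^sub>F t in at_top. (y s0 X0)\<^sup>2 \<le> (y s0 t)\<^sup>2"
      using eventually_ge_at_top[of X0] by eventually_elim (rule mono)
    ultimately have "(y s0 X0)\<^sup>2 \<le> 0\<^sup>2" by (rule tendsto_lowerbound) simp
    then have y0: "y s0 X0 = 0" by simp
    then have "y1 s0 X0 = 0" using energy_zero[OF s, of X0] G(2) kap by simp
    then have "y s0 x = 0" for x
      using stationary_point_trivial[OF s, of X0] y0 g(2) by simp
    then show False using nonzero by simp
  qed
  then obtain X where "X \<ge> X0" "y s0 X * y1 s0 X < 0" by blast
  then show ?thesis using that[of X] X1[of X] by (auto simp: X0_def)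
qed

text \<open>Differentiating the energy identity in \<open>s\<close> shows \<open>(w / y')' = - s y\<^sup>2 / (\<kappa> y'\<^sup>2)\<close>, which is bounded in the
  tail; hence \<open>w\<close> decays like \<open>y'\<close> up to a linear factor.\<close>

lemma right_decay:
  "\<exists>d C k. 0 < d \<and> d < \<delta> \<and> 0 < k \<and> (\<forall>s x. \<bar>s - s0\<bar> \<le> d \<longrightarrow> 0 \<le> x \<longrightarrow>
     \<bar>y s x\<bar> \<le> C * exp (- (k * x)) \<and> \<bar>y1 s x\<bar> \<le> C * exp (- (k * x)) \<and>
     \<bar>w s x\<bar> \<le> C * exp (- (k * x)) \<and> \<bar>w1 s x\<bar> \<le> C * exp (- (k * x)))"
proof -
  obtain \<epsilon> \<tau> B d1 where e: "\<epsilon> > 0" and tau: "\<tau> > 0" and B: "B \<ge> 0" and d1: "d1 > 0" "d1 < \<delta>"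
    and gB: "\<And>z. \<bar>z\<bar> \<le> \<epsilon> \<Longrightarrow> \<bar>g z\<bar> \<le> B * \<bar>z\<bar>"
    and le: "\<And>s z. \<bar>s - s0\<bar> \<le> d1 \<Longrightarrow> \<bar>z\<bar> \<le> \<epsilon> \<Longrightarrow> s\<^sup>2 * z\<^sup>2 / 2 + G z \<le> - \<tau> * z\<^sup>2"
    and ge: "\<And>s z. \<bar>z\<bar> \<le> \<epsilon> \<Longrightarrow> - B * z\<^sup>2 \<le> s\<^sup>2 * z\<^sup>2 / 2 + G z"
    by (rule near_zero) (rule that; assumption)
  obtain X where X0: "X \<ge> 0" and X: "\<bar>y s0 X\<bar> < \<epsilon>" "y s0 X * y1 s0 X < 0"
    by (rule approach_start[OF e]) (rule that; assumption)
  define k where "k = sqrt (2 * \<tau> / \<kappa>)"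
  define K where "K = sqrt (2 * B / \<kappa>)"
  have k0: "k > 0" and K0: "K \<ge> 0" using tau kap B by (auto simp: k_def K_def)
  \<comment> \<open>The extra 1 leaves room for the bound on the quotient at the fixed point
    \<open>X\<close> to persist, by continuity, for nearby speeds.\<close>
  define C1 where "C1 = \<bar>w s0 X / y1 s0 X\<bar> + 1"
  have cy: "((\<lambda>s. y s X) \<longlongrightarrow> y s0 X) (nhds s0)"
    using DERIV_isCont[OF ds(1)[OF s0_in, of X]] tendsto_at_iff_tendsto_nhds[of "\<lambda>s. y s X" s0]
    by (simp add: isCont_def)
  have cy1: "((\<lambda>s. y1 s X) \<longlongrightarrow> y1 s0 X) (nhds s0)"
    using DERIV_isCont[OF ds(2)[OF s0_in, of X]] tendsto_at_iff_tendsto_nhds[of "\<lambda>s. y1 s X" s0]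
    by (simp add: isCont_def)
  have "continuous_on I (\<lambda>s. (\<lambda>(s, x). w s x) (s, X))"
    by (rule continuous_on_compose2[OF joint(3)]) (auto intro!: continuous_intros)
  then have cw: "((\<lambda>s. w s X) \<longlongrightarrow> w s0 X) (nhds s0)"
    using continuous_on_eq_continuous_at[OF open_I] s0_in tendsto_at_iff_tendsto_nhds[of "\<lambda>s. w s X" s0]
    by (auto simp: isCont_def)
  have y1X: "y1 s0 X \<noteq> 0" using X(2) by auto
  have "\<forall>\<^sub>F s in nhds s0. \<bar>y s X\<bar> < \<epsilon> \<and> y s X * y1 s X < 0 \<and> \<bar>w s X / y1 s X\<bar> < C1"
  proof (intro eventually_conj)
    show "\<forall>\<^sub>F s in nhds s0. \<bar>y s X\<bar> < \<epsilon>" by (rule order_tendstoD(2)[OF tendsto_rabs[OF cy] X(1)])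
    show "\<forall>\<^sub>F s in nhds s0. y s X * y1 s X < 0" by (rule order_tendstoD(2)[OF tendsto_mult[OF cy cy1] X(2)])
    show "\<forall>\<^sub>F s in nhds s0. \<bar>w s X / y1 s X\<bar> < C1"
      by (rule order_tendstoD(2)[OF tendsto_rabs[OF tendsto_divide[OF cw cy1 y1X]]]) (simp add: C1_def)
  qed
  then obtain d2 where d2: "d2 > 0" "\<And>s. \<bar>s - s0\<bar> < d2 \<Longrightarrow> \<bar>y s X\<bar> < \<epsilon> \<and> y s X * y1 s X < 0 \<and> \<bar>w s X / y1 s X\<bar> < C1"
    unfolding eventually_nhds_metric dist_real_def by auto
  define d where "d = min d1 (d2 / 2)"
  have d: "d > 0" "d < \<delta>" "d \<le> d1" "d < d2" using d1 d2 by (auto simp: d_def min_def)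
  have sI: "s \<in> I" if "\<bar>s - s0\<bar> \<le> d" for s using that d I by (auto simp: abs_le_iff)
  define S where "S = \<bar>s0\<bar> + \<delta>"
  \<comment> \<open>Bounds |s| y^2 / (\<kappa> y1^2), the modulus of the derivative of w / y1, by
    means of k |y| \<le> |y1|.\<close>
  define Bq where "Bq = S / (\<kappa> * k\<^sup>2)"
  have S0: "S \<ge> 0" and Bq0: "Bq \<ge> 0" and C10: "C1 \<ge> 0" using del kap by (auto simp: S_def Bq_def C1_def)
  \<comment> \<open>\<open>A0\<close> and \<open>B0\<close> add up the constant and the linear
    coefficients, in u = x - X, of the four estimates, so that one bound of the form (A0 + B0 u) exp
    (-k u) serves all of them.\<close>
  define A0 where "A0 = \<epsilon> + K * \<epsilon> + C1 * (K * \<epsilon>) + ((S\<^sup>2 + B) * C1 + S / k) * \<epsilon> / \<kappa>"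
  define B0 where "B0 = Bq * (K * \<epsilon>) + (S\<^sup>2 + B) * Bq * \<epsilon> / \<kappa>"
  have A00: "A0 \<ge> 0" and B00: "B0 \<ge> 0" using e K0 S0 Bq0 C10 B kap k0 by (auto simp: A0_def B0_def)
  have parts: "\<epsilon> \<le> A0" "K * \<epsilon> \<le> A0" "C1 * (K * \<epsilon>) \<le> A0" "((S\<^sup>2 + B) * C1 + S / k) * \<epsilon> / \<kappa> \<le> A0"
    "Bq * (K * \<epsilon>) \<le> B0" "(S\<^sup>2 + B) * Bq * \<epsilon> / \<kappa> \<le> B0"
  proof -
    have "0 \<le> \<epsilon>" "0 \<le> K * \<epsilon>" "0 \<le> C1 * (K * \<epsilon>)" "0 \<le> ((S\<^sup>2 + B) * C1 + S / k) * \<epsilon> / \<kappa>"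
      "0 \<le> Bq * (K * \<epsilon>)" "0 \<le> (S\<^sup>2 + B) * Bq * \<epsilon> / \<kappa>"
      using e K0 S0 Bq0 C10 B kap k0 by auto
    then show "\<epsilon> \<le> A0" "K * \<epsilon> \<le> A0" "C1 * (K * \<epsilon>) \<le> A0" "((S\<^sup>2 + B) * C1 + S / k) * \<epsilon> / \<kappa> \<le> A0"
      "Bq * (K * \<epsilon>) \<le> B0" "(S\<^sup>2 + B) * Bq * \<epsilon> / \<kappa> \<le> B0"
      unfolding A0_def B0_def by linarith+
  qed
  define C2 where "C2 = (A0 + 2 * B0 / k) * exp (k / 2 * X)"
  have far: "\<bar>y s x\<bar> \<le> C2 * exp (- (k / 2 * x)) \<and> \<bar>y1 s x\<bar> \<le> C2 * exp (- (k / 2 * x)) \<and>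
     \<bar>w s x\<bar> \<le> C2 * exp (- (k / 2 * x)) \<and> \<bar>w1 s x\<bar> \<le> C2 * exp (- (k / 2 * x))"
    if s: "\<bar>s - s0\<bar> \<le> d" and x: "x \<ge> X" for s x
  proof -
    note sI = sI[OF s]
    have sd1: "\<bar>s - s0\<bar> \<le> d1" using s d by linarith
    have Xs: "\<bar>y s X\<bar> < \<epsilon>" "y s X * y1 s X < 0" "\<bar>w s X / y1 s X\<bar> < C1" using d2(2)[of s] s d by auto
    have les: "\<forall>z. \<bar>z\<bar> \<le> \<epsilon> \<longrightarrow> s\<^sup>2 * z\<^sup>2 / 2 + G z \<le> - \<tau> * z\<^sup>2"
      and ges: "\<forall>z. \<bar>z\<bar> \<le> \<epsilon> \<longrightarrow> - B * z\<^sup>2 \<le> s\<^sup>2 * z\<^sup>2 / 2 + G z"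
      using le[OF sd1] ge by blast+
    note tp = tail_propagation[OF sI tau les ges Xs(1,2) _ k_def K_def]
    have sS: "\<bar>s\<bar> \<le> S" using s d by (auto simp: S_def)
    have s2S: "s\<^sup>2 \<le> S\<^sup>2" using sS by (simp add: abs_le_square_iff[symmetric])
    define u where "u = x - X"
    have u0: "u \<ge> 0" using x by (simp add: u_def)
    define E where "E = exp (- (k * u))"
    have E0: "E \<ge> 0" by (simp add: E_def)
    have y1ne: "y1 s t \<noteq> 0" if "t \<ge> X" for t using tp(1)[OF that] by auto
    have q: "\<bar>w s x / y1 s x\<bar> \<le> C1 + Bq * u"
    proof -
      have dq: "((\<lambda>t. w s t / y1 s t) has_real_derivative - s * (y s t)\<^sup>2 / (\<kappa> * (y1 s t)\<^sup>2)) (at t)" if t: "t \<ge> X" for t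
      proof -
        have "((\<lambda>t. w s t / y1 s t) has_real_derivative
          (w1 s t * y1 s t - w s t * (- (s\<^sup>2 * y s t + g (y s t)) / \<kappa>)) / (y1 s t * y1 s t)) (at t)"
          by (rule DERIV_divide[OF dx(3)[OF sI] dx(2)[OF sI] y1ne[OF t]])
        moreover have "w1 s t * y1 s t - w s t * (- (s\<^sup>2 * y s t + g (y s t)) / \<kappa>) = - s * (y s t)\<^sup>2 / \<kappa>"
        proof -
          have "w1 s t * y1 s t - w s t * (- (s\<^sup>2 * y s t + g (y s t)) / \<kappa>)
            = (\<kappa> * y1 s t * w1 s t + (s\<^sup>2 * y s t + g (y s t)) * w s t) / \<kappa>"
            using kap by (simp add: field_simps)
          also have "\<kappa> * y1 s t * w1 s t + (s\<^sup>2 * y s t + g (y s t)) * w s t = - s * (y s t)\<^sup>2"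
            unfolding energy_s_derivative[OF sI] by (simp add: algebra_simps)
          finally show ?thesis .
        qed
        ultimately show ?thesis by (simp add: power2_eq_square)
      qed
      have "norm (w s x / y1 s x - w s X / y1 s X) \<le> Bq * norm (x - X)"
      proof (rule field_differentiable_bound[of "{X..x}" "\<lambda>t. w s t / y1 s t" "\<lambda>t. - s * (y s t)\<^sup>2 / (\<kappa> * (y1 s t)\<^sup>2)"])
        fix t assume "t \<in> {X..x}"
        then have t: "t \<ge> X" by simp
        show "((\<lambda>t. w s t / y1 s t) has_real_derivative - s * (y s t)\<^sup>2 / (\<kappa> * (y1 s t)\<^sup>2)) (at t within {X..x})"
          by (rule has_field_derivative_at_within[OF dq[OF t]])
        have "(k * \<bar>y s t\<bar>)\<^sup>2 \<le> \<bar>y1 s t\<bar>\<^sup>2" using tp(2)[OF t] k0 by (intro power_mono) auto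
        then have c: "k\<^sup>2 * (y s t)\<^sup>2 \<le> (y1 s t)\<^sup>2" by (simp add: power_mult_distrib)
        have p: "(y1 s t)\<^sup>2 > 0" using y1ne[OF t] by simp
        have "\<bar>s\<bar> * (y s t)\<^sup>2 / (\<kappa> * (y1 s t)\<^sup>2) \<le> S * (y s t)\<^sup>2 / (\<kappa> * (y1 s t)\<^sup>2)"
          using sS kap by (intro divide_right_mono mult_right_mono) auto
        also have "\<dots> = Bq * (k\<^sup>2 * (y s t)\<^sup>2 / (y1 s t)\<^sup>2)" using k0 by (simp add: Bq_def)
        also have "\<dots> \<le> Bq * 1" using c p Bq0 by (intro mult_left_mono) auto
        finally show "norm (- s * (y s t)\<^sup>2 / (\<kappa> * (y1 s t)\<^sup>2)) \<le> Bq"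
          using kap by (simp add: abs_mult)
      qed (use x in auto)
      then have "\<bar>w s x / y1 s x - w s X / y1 s X\<bar> \<le> Bq * u" using x by (simp add: u_def)
      then show ?thesis using Xs(3) by linarith
    qed
    have q0: "C1 + Bq * u \<ge> 0" using C10 Bq0 u0 by simp
    have yle: "\<bar>y s x\<bar> \<le> \<epsilon> * E" using tp(4)[OF x] by (simp add: E_def u_def)
    have y1le: "\<bar>y1 s x\<bar> \<le> K * \<epsilon> * E"
    proof -
      have "\<bar>y1 s x\<bar> \<le> K * (\<epsilon> * E)" using order_trans[OF tp(3)[OF x] mult_left_mono[OF yle K0]] .
      then show ?thesis by simp
    qed
    have bw: "\<bar>w s x\<bar> \<le> (C1 + Bq * u) * (K * \<epsilon> * E)"
    proof -
      have "\<bar>w s x\<bar> = \<bar>w s x / y1 s x\<bar> * \<bar>y1 s x\<bar>" using y1ne[OF x] by simp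
      also have "\<dots> \<le> (C1 + Bq * u) * (K * \<epsilon> * E)" using q y1le q0 by (intro mult_mono) auto
      finally show ?thesis .
    qed
    have bw1: "\<bar>w1 s x\<bar> \<le> ((S\<^sup>2 + B) * (C1 + Bq * u) + S / k) * \<epsilon> / \<kappa> * E"
    proof -
      \<comment> \<open>The s-derivative of the energy identity, divided by \<kappa> y1, expresses
        \<open>w1\<close> through the bounded ratio y / y1 and the at most linearly growing w /
        y1.\<close>
      have eq: "w1 s x = (- (s\<^sup>2 * y s x + g (y s x)) * (w s x / y1 s x) - s * y s x * (y s x / y1 s x)) / \<kappa>"
      proof -
        have "w1 s x = \<kappa> * y1 s x * w1 s x / (\<kappa> * y1 s x)" using kap y1ne[OF x] by simp
        also have "\<dots> = (- (s\<^sup>2 * y s x + g (y s x)) * w s x - s * (y s x)\<^sup>2) / (\<kappa> * y1 s x)"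
          unfolding energy_s_derivative[OF sI] ..
        finally show ?thesis by (simp add: power2_eq_square diff_divide_distrib mult_ac)
      qed
      have "\<bar>s\<^sup>2 * y s x + g (y s x)\<bar> \<le> S\<^sup>2 * \<bar>y s x\<bar> + B * \<bar>y s x\<bar>"
      proof -
        have "\<bar>s\<^sup>2 * y s x\<bar> \<le> S\<^sup>2 * \<bar>y s x\<bar>" using s2S by (simp add: abs_mult mult_right_mono)
        then show ?thesis using gB[OF tp(5)[OF x]] by linarith
      qed
      also have "\<dots> = (S\<^sup>2 + B) * \<bar>y s x\<bar>" by (simp add: distrib_right)
      also have "\<dots> \<le> (S\<^sup>2 + B) * (\<epsilon> * E)" using yle B by (intro mult_left_mono) auto
      finally have 1: "\<bar>- (s\<^sup>2 * y s x + g (y s x)) * (w s x / y1 s x)\<bar> \<le> (S\<^sup>2 + B) * (\<epsilon> * E) * (C1 + Bq * u)"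
        unfolding abs_mult abs_minus_cancel using q by (intro mult_mono) (auto simp: B e E0 less_imp_le)
      have "\<bar>y s x / y1 s x\<bar> \<le> 1 / k"
        using tp(2)[OF x] k0 y1ne[OF x] by (simp add: field_simps)
      then have 2: "\<bar>s * y s x * (y s x / y1 s x)\<bar> \<le> S * (\<epsilon> * E) * (1 / k)"
        unfolding abs_mult[of _ "y s x / y1 s x"] abs_mult[of s] using sS yle S0 e E0
        by (intro mult_mono) auto
      have "\<bar>w1 s x\<bar> \<le> ((S\<^sup>2 + B) * (\<epsilon> * E) * (C1 + Bq * u) + S * (\<epsilon> * E) * (1 / k)) / \<kappa>"
        unfolding eq abs_divide abs_of_pos[OF kap]
        by (rule divide_right_mono[OF order_trans[OF abs_triangle_ineq4 add_mono[OF 1 2]] less_imp_le[OF kap]])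
      then show ?thesis by (simp add: field_simps)
    qed
    have all: "\<bar>y s x\<bar> \<le> (A0 + B0 * u) * E \<and> \<bar>y1 s x\<bar> \<le> (A0 + B0 * u) * E \<and>
       \<bar>w s x\<bar> \<le> (A0 + B0 * u) * E \<and> \<bar>w1 s x\<bar> \<le> (A0 + B0 * u) * E"
    proof -
      have Bu: "0 \<le> B0 * u" "Bq * (K * \<epsilon>) * u \<le> B0 * u" "(S\<^sup>2 + B) * Bq * \<epsilon> / \<kappa> * u \<le> B0 * u"
        using mult_nonneg_nonneg[OF B00 u0] mult_right_mono[OF parts(5) u0] mult_right_mono[OF parts(6) u0] .
      have "\<epsilon> * E \<le> (A0 + B0 * u) * E" "K * \<epsilon> * E \<le> (A0 + B0 * u) * E"
        by (rule mult_right_mono[OF _ E0], use parts Bu in linarith)+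
      moreover have "(C1 + Bq * u) * (K * \<epsilon> * E) = (C1 * (K * \<epsilon>) + Bq * (K * \<epsilon>) * u) * E" by (simp add: algebra_simps)
      moreover have "\<dots> \<le> (A0 + B0 * u) * E" by (rule mult_right_mono[OF _ E0]) (use parts Bu in linarith)
      moreover have "((S\<^sup>2 + B) * (C1 + Bq * u) + S / k) * \<epsilon> / \<kappa> * E
          = (((S\<^sup>2 + B) * C1 + S / k) * \<epsilon> / \<kappa> + (S\<^sup>2 + B) * Bq * \<epsilon> / \<kappa> * u) * E"
        by (simp add: algebra_simps add_divide_distrib)
      moreover have "\<dots> \<le> (A0 + B0 * u) * E" by (rule mult_right_mono[OF _ E0]) (use parts Bu in linarith)
      ultimately show ?thesis using yle y1le bw bw1 by linarith
    qed
    have "(A0 + B0 * u) * E \<le> (A0 + 2 * B0 / k) * exp (- (k / 2 * u))"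
      unfolding E_def by (rule linear_exp_le[OF k0 u0 A00 B00])
    also have "exp (- (k / 2 * u)) = exp (k / 2 * X) * exp (- (k / 2 * x))"
      by (simp add: exp_add[symmetric] u_def right_diff_distrib)
    finally have "(A0 + B0 * u) * E \<le> C2 * exp (- (k / 2 * x))" by (simp add: C2_def)
    then show ?thesis using all by linarith
  qed
  \<comment> \<open>Only the compact strip between 0 and \<open>X\<close> remains; joint continuity
    in (s, x) bounds the four functions there uniformly in the speed.\<close>
  define J where "J = {s0 - d..s0 + d} \<times> {0..X}"
  have JI: "J \<subseteq> I \<times> UNIV" using d I by (auto simp: J_def)
  have bdd: "\<exists>M. \<forall>z\<in>J. \<bar>F z\<bar> \<le> M" if "continuous_on (I \<times> UNIV) F" for F :: "real \<times> real \<Rightarrow> real"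
  proof -
    have "compact (F ` J)"
      by (intro compact_continuous_image continuous_on_subset[OF that JI]) (auto simp: J_def intro!: compact_Times)
    then have "bounded (F ` J)" by (rule compact_imp_bounded)
    then show ?thesis unfolding bounded_iff by (auto simp: real_norm_def)
  qed
  obtain M1 M2 M3 M4 where M: "\<forall>z\<in>J. \<bar>case z of (s, x) \<Rightarrow> y s x\<bar> \<le> M1" "\<forall>z\<in>J. \<bar>case z of (s, x) \<Rightarrow> y1 s x\<bar> \<le> M2"
    "\<forall>z\<in>J. \<bar>case z of (s, x) \<Rightarrow> w s x\<bar> \<le> M3" "\<forall>z\<in>J. \<bar>case z of (s, x) \<Rightarrow> w1 s x\<bar> \<le> M4"
    using bdd[OF joint(1)] bdd[OF joint(2)] bdd[OF joint(3)] bdd[OF joint(4)] by metis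
  define M where "M = \<bar>M1\<bar> + \<bar>M2\<bar> + \<bar>M3\<bar> + \<bar>M4\<bar>"
  define C3 where "C3 = C2 + M * exp (k / 2 * X)"
  have C20: "C2 \<ge> 0" using A00 B00 k0 by (simp add: C2_def)
  have M0: "M \<ge> 0" by (simp add: M_def)
  have fin: "\<bar>y s x\<bar> \<le> C3 * exp (- (k / 2 * x)) \<and> \<bar>y1 s x\<bar> \<le> C3 * exp (- (k / 2 * x)) \<and>
     \<bar>w s x\<bar> \<le> C3 * exp (- (k / 2 * x)) \<and> \<bar>w1 s x\<bar> \<le> C3 * exp (- (k / 2 * x))"
    if s: "\<bar>s - s0\<bar> \<le> d" and x: "0 \<le> x" for s x
  proof (cases "x \<le> X")
    case True
    have z: "(s, x) \<in> J" using s x True by (auto simp: J_def abs_le_iff)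
    have "M * exp (k / 2 * x) \<le> M * exp (k / 2 * X)" using True k0 M0 by (intro mult_left_mono) auto
    also have "\<dots> \<le> C3" using C20 by (simp add: C3_def)
    finally have "M * exp (k / 2 * x) * exp (- (k / 2 * x)) \<le> C3 * exp (- (k / 2 * x))"
      by (rule mult_right_mono) simp
    moreover have "M * exp (k / 2 * x) * exp (- (k / 2 * x)) = M" by (simp add: exp_minus)
    ultimately have MC: "M \<le> C3 * exp (- (k / 2 * x))" by linarith
    have "\<bar>y s x\<bar> \<le> M" "\<bar>y1 s x\<bar> \<le> M" "\<bar>w s x\<bar> \<le> M" "\<bar>w1 s x\<bar> \<le> M"
      using bspec[OF M(1) z] bspec[OF M(2) z] bspec[OF M(3) z] bspec[OF M(4) z] unfolding M_def prod.case by linarith+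
    then show ?thesis using MC by linarith
  next
    case False
    have "C2 * exp (- (k / 2 * x)) \<le> C3 * exp (- (k / 2 * x))" using M0 by (intro mult_right_mono) (auto simp: C3_def)
    then show ?thesis using far[OF s, of x] False by linarith
  qed
  show ?thesis
    by (rule exI[of _ d], rule exI[of _ C3], rule exI[of _ "k / 2"]) (use d k0 fin in auto)
qed

end


section \<open>Integrals over the whole line and two derivatives of the moment\<close>

lemma exp_abs_decay_tendsto_0:
  fixes F :: "real \<Rightarrow> real"
  assumes k: "k > 0" and le: "\<And>x. \<bar>F x\<bar> \<le> C * exp (- (k * \<bar>x\<bar>))"
  shows "(F \<longlongrightarrow> 0) at_top" "(F \<longlongrightarrow> 0) at_bot"
proof -
  show "(F \<longlongrightarrow> 0) at_top"
  proof (rule tendsto_0_exp_decay[OF k])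
    show "norm (F x) \<le> C * exp (- (k * x))" if "x \<ge> 0" for x using le[of x] that by simp
  qed
  have "((\<lambda>x. F (- x)) \<longlongrightarrow> 0) at_top"
  proof (rule tendsto_0_exp_decay[OF k])
    show "norm (F (- x)) \<le> C * exp (- (k * x))" if "x \<ge> 0" for x using le[of "- x"] that by simp
  qed
  then show "(F \<longlongrightarrow> 0) at_bot" by (simp add: filterlim_at_bot_mirror)
qed

lemma integrable_exp_abs_decay:
  fixes k C :: real
  assumes k: "k > 0" shows "integrable lborel (\<lambda>x. C * exp (- (k * \<bar>x\<bar>)))"
proof -
  let ?f = "\<lambda>x. indicator {0<..} x *\<^sub>R (C * exp (- (k * x)))"
  have 1: "integrable lborel ?f" using set_integrable_exp_decay(1)[OF k] unfolding set_integrable_def .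
  have 2: "integrable lborel (\<lambda>x. ?f (0 + (- 1) * x))"
    by (rule lborel_integrable_real_affine[OF 1]) simp
  have "integrable lborel (\<lambda>x. ?f x + ?f (0 + (- 1) * x))" by (rule Bochner_Integration.integrable_add[OF 1 2])
  then show ?thesis
  proof (rule integrable_cong_AE[THEN iffD1, rotated -1])
    show "AE x in lborel. ?f x + ?f (0 + (- 1) * x) = C * exp (- (k * \<bar>x\<bar>))"
      using AE_lborel_singleton[of "0::real"]
    proof eventually_elim
      case (elim x)
      then show ?case by (cases "x > 0") (auto simp: indicator_def)
    qed
  qed auto
qed

lemma integrable_continuous_exp_abs_decay:
  fixes f :: "real \<Rightarrow> real"
  assumes k: "k > 0" and cont: "continuous_on UNIV f" and le: "\<And>x. \<bar>f x\<bar> \<le> C * exp (- (k * \<bar>x\<bar>))"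
  shows "integrable lborel f"
proof (rule Bochner_Integration.integrable_bound[OF integrable_exp_abs_decay[OF k, of C]])
  show "f \<in> borel_measurable lborel" using borel_measurable_continuous_onI[OF cont] by simp
  show "AE x in lborel. norm (f x) \<le> norm (C * exp (- (k * \<bar>x\<bar>)))"
    using le by (intro AE_I2) (auto intro: order_trans[OF le])
qed

lemma whole_line_FTC:
  fixes f F :: "real \<Rightarrow> real"
  assumes d: "\<And>x. (F has_real_derivative f x) (at x)" and cont: "continuous_on UNIV f"
    and int: "integrable lborel f" and lim: "(F \<longlongrightarrow> A) at_bot" "(F \<longlongrightarrow> B) at_top"
  shows "(\<integral>x. f x \<partial>lborel) = B - A"
proof -
  have e: "einterval (- \<infinity>) \<infinity> = (UNIV :: real set)" by (auto simp: einterval_def)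
  have L: "((F \<circ> real_of_ereal) \<longlongrightarrow> A) (at_right (- \<infinity>))" "((F \<circ> real_of_ereal) \<longlongrightarrow> B) (at_left \<infinity>)"
    using lim by (simp_all add: ereal_tendsto_simps)
  have "(LBINT x=-\<infinity>..\<infinity>. f x) = B - A"
    by (rule interval_integral_FTC_integrable[OF _ _ _ _ L])
      (use d cont int in \<open>auto simp: e continuous_on_eq_continuous_at set_integrable_def
        has_real_derivative_iff_has_vector_derivative[symmetric]\<close>)
  then show ?thesis by (simp add: interval_lebesgue_integral_def e set_lebesgue_integral_def)
qed

text \<open>By the mean value theorem the difference quotients in s obey the same exponential bound
  as \<open>F'\<close>, so dominated convergence applies along every sequence of increments.\<close>

lemma has_derivative_integral_exp_decay:
  fixes F F' :: "real \<Rightarrow> real \<Rightarrow> real"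
  assumes k: "k > 0" and e: "e > 0"
    and d: "\<And>s x. \<bar>s - s0\<bar> < e \<Longrightarrow> ((\<lambda>s. F s x) has_real_derivative F' s x) (at s)"
    and cont: "\<And>s. \<bar>s - s0\<bar> < e \<Longrightarrow> continuous_on UNIV (F s)" "continuous_on UNIV (F' s0)"
    and le: "\<And>s x. \<bar>s - s0\<bar> < e \<Longrightarrow> \<bar>F s x\<bar> \<le> C * exp (- (k * \<bar>x\<bar>))"
      "\<And>s x. \<bar>s - s0\<bar> < e \<Longrightarrow> \<bar>F' s x\<bar> \<le> C * exp (- (k * \<bar>x\<bar>))"
  shows "((\<lambda>s. \<integral>x. F s x \<partial>lborel) has_real_derivative (\<integral>x. F' s0 x \<partial>lborel)) (at s0)"
proof -
  have int: "integrable lborel (F s)" if "\<bar>s - s0\<bar> < e" for s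
    by (rule integrable_continuous_exp_abs_decay[OF k cont(1)[OF that] le(1)[OF that]])
  let ?q = "\<lambda>h. ((\<integral>x. F (s0 + h) x \<partial>lborel) - (\<integral>x. F s0 x \<partial>lborel)) / h"
  have "(?q \<longlongrightarrow> (\<integral>x. F' s0 x \<partial>lborel)) (at 0)"
    unfolding tendsto_at_iff_sequentially
  proof (intro allI impI)
    fix h :: "nat \<Rightarrow> real"
    assume ne: "\<forall>i. h i \<in> UNIV - {0}" and h0: "h \<longlonglongrightarrow> 0"
    have "\<forall>\<^sub>F i in sequentially. dist (h i) 0 < e" by (rule tendstoD[OF h0 e])
    then obtain N where N: "\<And>i. i \<ge> N \<Longrightarrow> \<bar>h i\<bar> < e" by (auto simp: eventually_sequentially)
    define r where "r = (\<lambda>i. h (i + N))"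
    have r: "r i \<noteq> 0" "\<bar>r i\<bar> < e" for i using ne N[of "i + N"] by (auto simp: r_def)
    have r0: "r \<longlonglongrightarrow> 0" unfolding r_def using h0 by (rule LIMSEQ_ignore_initial_segment)
    have "(\<lambda>i. \<integral>x. (F (s0 + r i) x - F s0 x) / r i \<partial>lborel) \<longlonglongrightarrow> (\<integral>x. F' s0 x \<partial>lborel)"
    proof (rule integral_dominated_convergence[OF _ _ integrable_exp_abs_decay[OF k, of C]])
      show "F' s0 \<in> borel_measurable lborel" using borel_measurable_continuous_onI[OF cont(2)] by simp
      show "(\<lambda>x. (F (s0 + r i) x - F s0 x) / r i) \<in> borel_measurable lborel" for i
        using borel_measurable_continuous_onI[OF cont(1)[of "s0 + r i"]] borel_measurable_continuous_onI[OF cont(1)[of s0]] r(2)[of i] e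
        by simp
      show "AE x in lborel. (\<lambda>i. (F (s0 + r i) x - F s0 x) / r i) \<longlonglongrightarrow> F' s0 x"
      proof (rule AE_I2)
        fix x
        have "((\<lambda>h. (F (s0 + h) x - F s0 x) / h) \<longlongrightarrow> F' s0 x) (at 0)"
          using d[of s0 x] e unfolding DERIV_def by simp
        then show "(\<lambda>i. (F (s0 + r i) x - F s0 x) / r i) \<longlonglongrightarrow> F' s0 x"
          using r(1) r0 unfolding tendsto_at_iff_sequentially comp_def by auto
      qed
      show "AE x in lborel. norm ((F (s0 + r i) x - F s0 x) / r i) \<le> C * exp (- (k * \<bar>x\<bar>))" for i
      proof (rule AE_I2)
        fix x
        have "norm (F (s0 + r i) x - F s0 x) \<le> (C * exp (- (k * \<bar>x\<bar>))) * norm (s0 + r i - s0)"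
        proof (rule field_differentiable_bound[of "{s0 - e<..<s0 + e}" "\<lambda>s. F s x" "\<lambda>s. F' s x"])
          fix t assume t: "t \<in> {s0 - e<..<s0 + e}"
          then have "\<bar>t - s0\<bar> < e" by auto
          then show "((\<lambda>s. F s x) has_real_derivative F' t x) (at t within {s0 - e<..<s0 + e})"
            "norm (F' t x) \<le> C * exp (- (k * \<bar>x\<bar>))"
            using d le(2) by (auto intro: has_field_derivative_at_within)
        qed (use r(2)[of i] e in auto)
        then show "norm ((F (s0 + r i) x - F s0 x) / r i) \<le> C * exp (- (k * \<bar>x\<bar>))"
          using r(1)[of i] by (simp add: divide_le_eq)
      qed
    qed
    moreover have "(\<integral>x. (F (s0 + r i) x - F s0 x) / r i \<partial>lborel) = ?q (r i)" for i
    proof -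
      have "integrable lborel (F (s0 + r i))" "integrable lborel (F s0)"
        using int[of "s0 + r i"] int[of s0] r(2)[of i] e by simp_all
      then show ?thesis by (simp add: Bochner_Integration.integral_diff)
    qed
    ultimately have "(\<lambda>i. ?q (r i)) \<longlonglongrightarrow> (\<integral>x. F' s0 x \<partial>lborel)" by (simp only:)
    then have "(\<lambda>i. ?q (h i)) \<longlonglongrightarrow> (\<integral>x. F' s0 x \<partial>lborel)" unfolding r_def by (rule LIMSEQ_offset)
    then show "(?q \<circ> h) \<longlonglongrightarrow> (\<integral>x. F' s0 x \<partial>lborel)" by (simp add: comp_def)
  qed
  then show ?thesis unfolding DERIV_def .
qed

lemma has_derivative_mirror:
  "(\<And>x. (F has_real_derivative F' x) (at x)) \<Longrightarrow> ((\<lambda>x. F (- x)) has_real_derivative - F' (- x)) (at x)" for F F' :: "real \<Rightarrow> real"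
  using DERIV_chain'[OF DERIV_minus[OF DERIV_ident]] by fastforce

locale homoclinic_family = profile_family +
  assumes lim_bot: "\<And>s. s \<in> I \<Longrightarrow> (y s \<longlongrightarrow> 0) at_bot"
begin

text \<open>Reflection in x. The speed keeps its sign here, because the second-order profile
  equation contains only its square.\<close>

lemma mirrored: "profile_family \<kappa> s0 \<delta> g g' G (\<lambda>s x. y s (- x)) (\<lambda>s x. - y1 s (- x)) (\<lambda>s x. w s (- x)) (\<lambda>s x. - w1 s (- x)) I"
proof
  fix s x assume s: "s \<in> I"
  show "((\<lambda>x. y s (- x)) has_real_derivative - y1 s (- x)) (at x)"
    by (rule has_derivative_mirror) (rule dx(1)[OF s])
  show "((\<lambda>x. w s (- x)) has_real_derivative - w1 s (- x)) (at x)"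
    by (rule has_derivative_mirror) (rule dx(3)[OF s])
  have "((\<lambda>x. - y1 s (- x)) has_real_derivative - (- (- (s\<^sup>2 * y s (- x) + g (y s (- x))) / \<kappa>))) (at x)"
    by (rule DERIV_minus, rule has_derivative_mirror) (rule dx(2)[OF s])
  then show "((\<lambda>x. - y1 s (- x)) has_real_derivative - (s\<^sup>2 * y s (- x) + g (y s (- x))) / \<kappa>) (at x)" by simp
  show "((\<lambda>s. y s (- x)) has_real_derivative w s (- x)) (at s)" by (rule ds(1)[OF s])
  show "((\<lambda>s. - y1 s (- x)) has_real_derivative - w1 s (- x)) (at s)" by (rule DERIV_minus[OF ds(2)[OF s]])
  show "((\<lambda>x. y s (- x)) \<longlongrightarrow> 0) at_top" using lim_bot[OF s] by (simp add: filterlim_at_bot_mirror)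
next
  have j: "continuous_on (I \<times> UNIV) (\<lambda>(s, x). F s (- x))" if "continuous_on (I \<times> UNIV) (\<lambda>(s, x). F s x)" for F :: "real \<Rightarrow> real \<Rightarrow> real"
  proof -
    have "continuous_on (I \<times> UNIV) (\<lambda>z. (\<lambda>(s, x). F s x) (fst z, - snd z))"
      by (rule continuous_on_compose2[OF that]) (auto intro!: continuous_intros)
    then show ?thesis by (simp add: case_prod_beta)
  qed
  have jm: "continuous_on (I \<times> UNIV) (\<lambda>(s, x). - F s (- x))" if "continuous_on (I \<times> UNIV) (\<lambda>(s, x). F s x)" for F :: "real \<Rightarrow> real \<Rightarrow> real"
    using continuous_on_minus[OF j[OF that]] by (simp add: case_prod_beta)
  show "continuous_on (I \<times> UNIV) (\<lambda>(s, x). y s (- x))" "continuous_on (I \<times> UNIV) (\<lambda>(s, x). - y1 s (- x))"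
    "continuous_on (I \<times> UNIV) (\<lambda>(s, x). w s (- x))" "continuous_on (I \<times> UNIV) (\<lambda>(s, x). - w1 s (- x))"
    by (rule j jm, rule joint)+
  show "\<exists>x. y s0 (- x) \<noteq> 0" using nonzero by (metis minus_minus)
qed (rule kap del I G g saddle)+

lemma decay:
  obtains d C k where "0 < d" "d < \<delta>" "0 < k" "C \<ge> 0"
    "\<And>s x. \<bar>s - s0\<bar> \<le> d \<Longrightarrow> \<bar>y s x\<bar> \<le> C * exp (- (k * \<bar>x\<bar>))"
    "\<And>s x. \<bar>s - s0\<bar> \<le> d \<Longrightarrow> \<bar>y1 s x\<bar> \<le> C * exp (- (k * \<bar>x\<bar>))"
    "\<And>s x. \<bar>s - s0\<bar> \<le> d \<Longrightarrow> \<bar>w s x\<bar> \<le> C * exp (- (k * \<bar>x\<bar>))"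
    "\<And>s x. \<bar>s - s0\<bar> \<le> d \<Longrightarrow> \<bar>w1 s x\<bar> \<le> C * exp (- (k * \<bar>x\<bar>))"
proof -
  interpret m: profile_family \<kappa> s0 \<delta> g g' G "\<lambda>s x. y s (- x)" "\<lambda>s x. - y1 s (- x)" "\<lambda>s x. w s (- x)" "\<lambda>s x. - w1 s (- x)" I
    by (rule mirrored)
  obtain d1 C1 k1 where 1: "0 < d1" "d1 < \<delta>" "0 < k1" and r: "\<And>s x. \<bar>s - s0\<bar> \<le> d1 \<Longrightarrow> 0 \<le> x \<Longrightarrow>
     \<bar>y s x\<bar> \<le> C1 * exp (- (k1 * x)) \<and> \<bar>y1 s x\<bar> \<le> C1 * exp (- (k1 * x)) \<and>
     \<bar>w s x\<bar> \<le> C1 * exp (- (k1 * x)) \<and> \<bar>w1 s x\<bar> \<le> C1 * exp (- (k1 * x))"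
    using right_decay by metis
  obtain d2 C2 k2 where 2: "0 < d2" "d2 < \<delta>" "0 < k2" and l: "\<And>s x. \<bar>s - s0\<bar> \<le> d2 \<Longrightarrow> 0 \<le> x \<Longrightarrow>
     \<bar>y s (- x)\<bar> \<le> C2 * exp (- (k2 * x)) \<and> \<bar>- y1 s (- x)\<bar> \<le> C2 * exp (- (k2 * x)) \<and>
     \<bar>w s (- x)\<bar> \<le> C2 * exp (- (k2 * x)) \<and> \<bar>- w1 s (- x)\<bar> \<le> C2 * exp (- (k2 * x))"
    using m.right_decay by metis
  define d where "d = min d1 d2"
  define k where "k = min k1 k2"
  define C where "C = max \<bar>C1\<bar> \<bar>C2\<bar>"
  have le: "C' * exp (- (k' * x)) \<le> C * exp (- (k * x))" if "0 \<le> x" "C' \<le> C" "k \<le> k'" for C' k' x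
  proof -
    have "C' * exp (- (k' * x)) \<le> C * exp (- (k' * x))" using that by (intro mult_right_mono) auto
    also have "\<dots> \<le> C * exp (- (k * x))" using that by (intro mult_left_mono) (auto simp: C_def mult_right_mono)
    finally show ?thesis .
  qed
  have c: "C1 \<le> C" "C2 \<le> C" "k \<le> k1" "k \<le> k2" by (auto simp: C_def k_def)
  have all: "\<bar>y s x\<bar> \<le> C * exp (- (k * \<bar>x\<bar>)) \<and> \<bar>y1 s x\<bar> \<le> C * exp (- (k * \<bar>x\<bar>)) \<and>
     \<bar>w s x\<bar> \<le> C * exp (- (k * \<bar>x\<bar>)) \<and> \<bar>w1 s x\<bar> \<le> C * exp (- (k * \<bar>x\<bar>))" if s: "\<bar>s - s0\<bar> \<le> d" for s x
  proof (cases "x \<ge> 0")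
    case True
    then show ?thesis using r[of s x] s le[of x C1 k1] c by (auto simp: d_def intro: order_trans)
  next
    case False
    then have x: "0 \<le> - x" by simp
    show ?thesis using l[OF _ x, of s] s le[of "- x" C2 k2] c x False
      by (auto simp: d_def intro: order_trans)
  qed
  show ?thesis
    by (rule that[of d k C]) (use 1 2 all in \<open>auto simp: d_def k_def C_def\<close>)
qed

text \<open>Uniform decay allows both differentiations under the integral. The first gives 2
  \<kappa> times the integral of y1 w1, which must be converted into -s times that of y^2: only y
  and w then remain to be differentiated.\<close>

lemma second_derivative_of_kinetic_integral:
  obtains d where "d > 0" "d < \<delta>"
    "\<And>s. \<bar>s - s0\<bar> \<le> d \<Longrightarrow> integrable lborel (\<lambda>x. (y s x)\<^sup>2) \<and> integrable lborel (\<lambda>x. (y1 s x)\<^sup>2)"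
    "\<And>s. \<bar>s - s0\<bar> < d \<Longrightarrow> ((\<lambda>s. \<kappa> * (\<integral>x. (y1 s x)\<^sup>2 \<partial>lborel)) has_real_derivative - s * (\<integral>x. (y s x)\<^sup>2 \<partial>lborel)) (at s)"
    "((\<lambda>s. - s * (\<integral>x. (y s x)\<^sup>2 \<partial>lborel)) has_real_derivative - (\<integral>x. 2 * s0 * y s0 x * w s0 x + (y s0 x)\<^sup>2 \<partial>lborel)) (at s0)"
    "integrable lborel (\<lambda>x. 2 * s0 * y s0 x * w s0 x + (y s0 x)\<^sup>2)"
proof -
  obtain d C k where d: "0 < d" "d < \<delta>" and k: "0 < k" and C0: "C \<ge> 0"
    and le: "\<And>s x. \<bar>s - s0\<bar> \<le> d \<Longrightarrow> \<bar>y s x\<bar> \<le> C * exp (- (k * \<bar>x\<bar>))"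
    "\<And>s x. \<bar>s - s0\<bar> \<le> d \<Longrightarrow> \<bar>y1 s x\<bar> \<le> C * exp (- (k * \<bar>x\<bar>))"
    "\<And>s x. \<bar>s - s0\<bar> \<le> d \<Longrightarrow> \<bar>w s x\<bar> \<le> C * exp (- (k * \<bar>x\<bar>))"
    "\<And>s x. \<bar>s - s0\<bar> \<le> d \<Longrightarrow> \<bar>w1 s x\<bar> \<le> C * exp (- (k * \<bar>x\<bar>))"
    by (rule decay) (rule that; assumption)
  have sI: "s \<in> I" if "\<bar>s - s0\<bar> \<le> d" for s using that d I by (auto simp: abs_le_iff)
  have prod_le: "\<bar>p * q\<bar> \<le> C * C * exp (- (k * \<bar>x\<bar>))"
    if "\<bar>p\<bar> \<le> C * exp (- (k * \<bar>x\<bar>))" "\<bar>q\<bar> \<le> C * exp (- (k * \<bar>x\<bar>))" for p q x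
  proof -
    have "C * exp (- (k * \<bar>x\<bar>)) \<le> C * 1" using C0 k by (intro mult_left_mono) auto
    then have "\<bar>q\<bar> \<le> C" using that by linarith
    then have "\<bar>p\<bar> * \<bar>q\<bar> \<le> (C * exp (- (k * \<bar>x\<bar>))) * C" using that C0 by (intro mult_mono) auto
    then show ?thesis by (simp add: abs_mult mult_ac)
  qed
  have cont: "continuous_on A (y s)" "continuous_on A (y1 s)" "continuous_on A (w s)" if "\<bar>s - s0\<bar> \<le> d" for s A
    by (rule DERIV_continuous_on[OF has_field_derivative_at_within[OF dx(1)[OF sI[OF that]]]])
      (rule DERIV_continuous_on[OF has_field_derivative_at_within[OF dx(2)[OF sI[OF that]]]]
        DERIV_continuous_on[OF has_field_derivative_at_within[OF dx(3)[OF sI[OF that]]]])+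
  have contw1: "continuous_on UNIV (w1 s)" if "\<bar>s - s0\<bar> \<le> d" for s
  proof -
    have "continuous_on UNIV (\<lambda>x. (\<lambda>(s, x). w1 s x) (s, x))"
      by (rule continuous_on_compose2[OF joint(4)]) (use sI[OF that] in \<open>auto intro!: continuous_intros\<close>)
    then show ?thesis by simp
  qed
  note int = integrable_continuous_exp_abs_decay[OF k]
  have iy: "integrable lborel (\<lambda>x. (y s x)\<^sup>2)" and iy1: "integrable lborel (\<lambda>x. (y1 s x)\<^sup>2)"
    and iyw: "integrable lborel (\<lambda>x. y s x * w s x)" and iyw1: "integrable lborel (\<lambda>x. y1 s x * w1 s x)"
    if s: "\<bar>s - s0\<bar> \<le> d" for s
    unfolding power2_eq_square
    by (rule int[where C = "C * C"], intro continuous_intros cont[OF s] contw1[OF s], rule prod_le, rule le[OF s], rule le[OF s])+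
  \<comment> \<open>The boundary term is \<kappa> y1 w: its derivative is \<kappa> y1 w1 plus
    \<kappa> y1' w, and the differentiated energy identity turns the sum into 2 \<kappa> y1 w1 + s
    y^2.\<close>
  have ibp: "2 * \<kappa> * (\<integral>x. y1 s x * w1 s x \<partial>lborel) = - s * (\<integral>x. (y s x)\<^sup>2 \<partial>lborel)" if s: "\<bar>s - s0\<bar> \<le> d" for s
  proof -
    have dF: "((\<lambda>x. \<kappa> * (y1 s x * w s x)) has_real_derivative 2 * \<kappa> * (y1 s x * w1 s x) + s * (y s x)\<^sup>2) (at x)" for x
    proof -
      have "((\<lambda>x. \<kappa> * (y1 s x * w s x)) has_real_derivative
         \<kappa> * (- (s\<^sup>2 * y s x + g (y s x)) / \<kappa> * w s x + w1 s x * y1 s x)) (at x)"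
        by (intro DERIV_cmult DERIV_mult dx[OF sI[OF s]])
      moreover have "\<kappa> * (- (s\<^sup>2 * y s x + g (y s x)) / \<kappa> * w s x + w1 s x * y1 s x)
         = 2 * \<kappa> * (y1 s x * w1 s x) + s * (y s x)\<^sup>2"
      proof -
        have "\<kappa> * (- (s\<^sup>2 * y s x + g (y s x)) / \<kappa> * w s x + w1 s x * y1 s x)
          = - (s\<^sup>2 * y s x + g (y s x)) * w s x + \<kappa> * y1 s x * w1 s x"
          using kap by (simp add: field_simps)
        then show ?thesis using energy_s_derivative[OF sI[OF s], of x] by (simp add: algebra_simps)
      qed
      ultimately show ?thesis by simp
    qed
    have ii: "integrable lborel (\<lambda>x. 2 * \<kappa> * (y1 s x * w1 s x) + s * (y s x)\<^sup>2)"
      using iy[OF s] iyw1[OF s] by simp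
    have b: "\<bar>\<kappa> * (y1 s x * w s x)\<bar> \<le> (\<kappa> * (C * C)) * exp (- (k * \<bar>x\<bar>))" for x
      using mult_left_mono[OF prod_le[OF le(2,3)[OF s]], of \<kappa> x] kap by (simp add: abs_mult mult.assoc)
    have "(\<integral>x. 2 * \<kappa> * (y1 s x * w1 s x) + s * (y s x)\<^sup>2 \<partial>lborel) = 0 - 0"
      by (rule whole_line_FTC[OF dF _ ii exp_abs_decay_tendsto_0(2)[OF k b] exp_abs_decay_tendsto_0(1)[OF k b]])
        (intro continuous_intros cont[OF s] contw1[OF s])
    then show ?thesis using iy[OF s] iyw1[OF s] by simp
  qed
  have D1: "((\<lambda>s. \<kappa> * (\<integral>x. (y1 s x)\<^sup>2 \<partial>lborel)) has_real_derivative - s * (\<integral>x. (y s x)\<^sup>2 \<partial>lborel)) (at s)"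
    if s: "\<bar>s - s0\<bar> < d" for s
  proof -
    define e where "e = d - \<bar>s - s0\<bar>"
    have e: "e > 0" using s by (simp add: e_def)
    have near: "\<bar>t - s0\<bar> \<le> d" if "\<bar>t - s\<bar> < e" for t using that by (simp add: e_def)
    have "((\<lambda>s. \<integral>x. (y1 s x)\<^sup>2 \<partial>lborel) has_real_derivative (\<integral>x. 2 * (y1 s x * w1 s x) \<partial>lborel)) (at s)"
    proof (rule has_derivative_integral_exp_decay[OF k e, where C = "2 * (C * C)"])
      fix t x assume "\<bar>t - s\<bar> < e"
      note t = near[OF this]
      show "((\<lambda>s. (y1 s x)\<^sup>2) has_real_derivative 2 * (y1 t x * w1 t x)) (at t)"
        by (auto intro!: derivative_eq_intros ds(2)[OF sI[OF t]])
      have "0 \<le> C * C * exp (- (k * \<bar>x\<bar>))" using C0 by simp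
      then show "\<bar>(y1 t x)\<^sup>2\<bar> \<le> 2 * (C * C) * exp (- (k * \<bar>x\<bar>))" "\<bar>2 * (y1 t x * w1 t x)\<bar> \<le> 2 * (C * C) * exp (- (k * \<bar>x\<bar>))"
        using prod_le[OF le(2)[OF t] le(2)[OF t], of x] prod_le[OF le(2)[OF t] le(4)[OF t], of x]
        unfolding power2_eq_square by linarith+
    next
      fix t assume "\<bar>t - s\<bar> < e"
      note t = near[OF this]
      show "continuous_on UNIV (\<lambda>x. (y1 t x)\<^sup>2)" by (intro continuous_intros cont[OF t])
    next
      have s': "\<bar>s - s0\<bar> \<le> d" using s by simp
      show "continuous_on UNIV (\<lambda>x. 2 * (y1 s x * w1 s x))" by (intro continuous_intros cont[OF s'] contw1[OF s'])
    qed
    from DERIV_cmult[OF this, of \<kappa>] show ?thesis using ibp[of s] s by (simp add: mult_ac)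
  qed
  have z: "\<bar>s0 - s0\<bar> \<le> d" using d by simp
  have "((\<lambda>s. \<integral>x. (y s x)\<^sup>2 \<partial>lborel) has_real_derivative (\<integral>x. 2 * (y s0 x * w s0 x) \<partial>lborel)) (at s0)"
  proof (rule has_derivative_integral_exp_decay[OF k d(1), where C = "2 * (C * C)"])
    fix t x assume "\<bar>t - s0\<bar> < d"
    then have t: "\<bar>t - s0\<bar> \<le> d" by simp
    show "((\<lambda>s. (y s x)\<^sup>2) has_real_derivative 2 * (y t x * w t x)) (at t)"
      by (auto intro!: derivative_eq_intros ds(1)[OF sI[OF t]])
    have "0 \<le> C * C * exp (- (k * \<bar>x\<bar>))" using C0 by simp
    then show "\<bar>(y t x)\<^sup>2\<bar> \<le> 2 * (C * C) * exp (- (k * \<bar>x\<bar>))" "\<bar>2 * (y t x * w t x)\<bar> \<le> 2 * (C * C) * exp (- (k * \<bar>x\<bar>))"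
      using prod_le[OF le(1)[OF t] le(1)[OF t], of x] prod_le[OF le(1)[OF t] le(3)[OF t], of x]
      unfolding power2_eq_square by linarith+
  next
    fix t assume "\<bar>t - s0\<bar> < d"
    then have t: "\<bar>t - s0\<bar> \<le> d" by simp
    show "continuous_on UNIV (\<lambda>x. (y t x)\<^sup>2)" by (intro continuous_intros cont[OF t])
  next
    show "continuous_on UNIV (\<lambda>x. 2 * (y s0 x * w s0 x))" by (intro continuous_intros cont[OF z])
  qed
  then have "((\<lambda>s. - s * (\<integral>x. (y s x)\<^sup>2 \<partial>lborel)) has_real_derivative
      - 1 * (\<integral>x. (y s0 x)\<^sup>2 \<partial>lborel) + (\<integral>x. 2 * (y s0 x * w s0 x) \<partial>lborel) * - s0) (at s0)"
    by (intro DERIV_mult DERIV_minus DERIV_ident)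
  moreover have "(\<integral>x. 2 * s0 * y s0 x * w s0 x + (y s0 x)\<^sup>2 \<partial>lborel)
      = 2 * s0 * (\<integral>x. y s0 x * w s0 x \<partial>lborel) + (\<integral>x. (y s0 x)\<^sup>2 \<partial>lborel)"
    using iy[OF z] iyw[OF z] by (simp add: mult.assoc)
  ultimately have D2: "((\<lambda>s. - s * (\<integral>x. (y s x)\<^sup>2 \<partial>lborel)) has_real_derivative - (\<integral>x. 2 * s0 * y s0 x * w s0 x + (y s0 x)\<^sup>2 \<partial>lborel)) (at s0)"
    by (simp add: algebra_simps)
  have "integrable lborel (\<lambda>x. 2 * s0 * y s0 x * w s0 x + (y s0 x)\<^sup>2)"
    using iy[OF z] iyw[OF z] by (simp add: mult.assoc)
  from that[OF d _ D1 D2 this] iy iy1 show ?thesis by blast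
qed

end

section \<open>The second derivative of the Evans function\<close>


lemma det_4:
  "det (A::'a::comm_ring_1^4^4) =
    A$1$1 * (A$2$2 * (A$3$3 * A$4$4 - A$3$4 * A$4$3) - A$2$3 * (A$3$2 * A$4$4 - A$3$4 * A$4$2) + A$2$4 * (A$3$2 * A$4$3 - A$3$3 * A$4$2))
  - A$1$2 * (A$2$1 * (A$3$3 * A$4$4 - A$3$4 * A$4$3) - A$2$3 * (A$3$1 * A$4$4 - A$3$4 * A$4$1) + A$2$4 * (A$3$1 * A$4$3 - A$3$3 * A$4$1))
  + A$1$3 * (A$2$1 * (A$3$2 * A$4$4 - A$3$4 * A$4$2) - A$2$2 * (A$3$1 * A$4$4 - A$3$4 * A$4$1) + A$2$4 * (A$3$1 * A$4$2 - A$3$2 * A$4$1))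
  - A$1$4 * (A$2$1 * (A$3$2 * A$4$3 - A$3$3 * A$4$2) - A$2$2 * (A$3$1 * A$4$3 - A$3$3 * A$4$1) + A$2$3 * (A$3$1 * A$4$2 - A$3$2 * A$4$1))"
proof -
  have f1234: "finite {2::4, 3, 4}" "1 \<notin> {2::4, 3, 4}" by auto
  have f234: "finite {3::4, 4}" "2 \<notin> {3::4, 4}" by auto
  have f34: "finite {4::4}" "3 \<notin> {4::4}" by auto
  show ?thesis
    unfolding det_def UNIV_4
    unfolding sum_over_permutations_insert[OF f1234]
    unfolding sum_over_permutations_insert[OF f234]
    unfolding sum_over_permutations_insert[OF f34]
    unfolding permutes_sing
    by (simp add: sign_swap_id permutation_swap_id permutation_compose sign_compose sign_id swap_id_eq algebra_simps)
qed

definition matrix4 :: "'a \<Rightarrow> 'a \<Rightarrow> 'a \<Rightarrow> 'a \<Rightarrow> 'a \<Rightarrow> 'a \<Rightarrow> 'a \<Rightarrow> 'a \<Rightarrow> 'a \<Rightarrow> 'a \<Rightarrow> 'a \<Rightarrow> 'a \<Rightarrow> 'a \<Rightarrow> 'a \<Rightarrow> 'a \<Rightarrow> 'a \<Rightarrow> 'a::comm_ring_1 ^ 4 ^ 4" where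
  "matrix4 a b c d e f g h i j k l m n p q = vector [vector [a, b, c, d], vector [e, f, g, h], vector [i, j, k, l], vector [m, n, p, q]]"

lemmas det_matrix4 = det_4[of "matrix4 a b c d e f g h i j k l m n p q" for a b c d e f g h i j k l m n p q, unfolded matrix4_def vector_4_nth, folded matrix4_def]

text \<open>The model for factoring t^2 out of D: the first and last columns coincide to leading
  order, so their difference yields one factor t, and the third row, made of pairings, yields the
  other.\<close>

lemma det_matrix4_rescale:
  fixes t :: "'a::comm_ring_1"
  shows "det (matrix4 (d + t * a) b c d (h + t * e) f g h (t * l + t\<^sup>2 * i) (t * j) (t * k) (t * l) (q + t * m) n p q)
    = t\<^sup>2 * det (matrix4 a b c d e f g h i j k l m n p q)"
  unfolding det_matrix4 by (simp add: algebra_simps power2_eq_square)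


text \<open>Boundedness of the quotient along the sequence forces f(0) = 0 and then f'(0) = 0; the
  Taylor formula with cubic remainder identifies the limit as half the second derivative.\<close>

lemma second_derivative_from_sequence:
  fixes f :: "complex \<Rightarrow> complex"
  assumes f: "f analytic_on {0}" and l: "l \<longlonglongrightarrow> 0" "\<And>n. l n \<noteq> 0"
    and L: "(\<lambda>n. f (l n) / (l n)\<^sup>2) \<longlonglongrightarrow> L"
  shows "(deriv ^^ 2) f 0 = 2 * L"
proof -
  obtain e where e: "e > 0" and hol: "f holomorphic_on ball 0 e" using f by (auto simp: analytic_on_def)
  define F where "F = (\<lambda>i. (deriv ^^ i) f)"
  have hF: "F i holomorphic_on ball 0 e" for i
    unfolding F_def by (rule holomorphic_higher_deriv[OF hol open_ball])
  have dF: "(F i has_field_derivative F (Suc i) x) (at x)" if "x \<in> ball 0 e" for i x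
    using holomorphic_derivI[OF hF[of i] open_ball that] by (simp add: F_def)
  define S where "S = cball (0::complex) (e / 2)"
  have S: "S \<subseteq> ball 0 e" using e by (auto simp: S_def)
  have "compact (F 3 ` S)"
    by (intro compact_continuous_image continuous_on_subset[OF holomorphic_on_imp_continuous_on[OF hF] S])
      (auto simp: S_def)
  then obtain B where B: "\<And>x. x \<in> S \<Longrightarrow> cmod (F 3 x) \<le> B"
    using compact_imp_bounded bounded_iff by (metis image_eqI)
  have T: "cmod (f z - (F 0 0 + F 1 0 * z + F 2 0 * z\<^sup>2 / 2)) \<le> B * cmod z ^ 3 / 2" if z: "z \<in> S" for z
  proof -
    have "cmod (F 0 z - (\<Sum>i\<le>2. F i 0 * (z - 0) ^ i / fact i)) \<le> B * cmod (z - 0) ^ Suc 2 / fact 2"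
    proof (rule complex_Taylor[of S 2 F B 0 z])
      show "(F i has_field_derivative F (Suc i) x) (at x within S)" if "x \<in> S" for i x
        by (rule has_field_derivative_at_within[OF dF]) (use S that in blast)
      show "cmod (F (Suc 2) x) \<le> B" if "x \<in> S" for x using B[OF that] by (simp add: numeral_3_eq_3 numeral_2_eq_2)
    qed (use z e in \<open>auto simp: S_def\<close>)
    then show ?thesis by (simp add: numeral_2_eq_2 numeral_3_eq_3 F_def power2_eq_square)
  qed
  have "0 \<in> ball (0::complex) e" using e by simp
  then have c0: "isCont f 0" and d0: "(f has_field_derivative F 1 0) (at 0)"
    using dF[of 0 0] DERIV_isCont by (auto simp: F_def)
  have l2: "(\<lambda>n. (l n)\<^sup>2 * (f (l n) / (l n)\<^sup>2)) \<longlonglongrightarrow> 0\<^sup>2 * L" by (intro tendsto_intros l L)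
  have "(\<lambda>n. f (l n)) \<longlonglongrightarrow> f 0" by (rule isCont_tendsto_compose[OF c0 l(1)])
  moreover have "(\<lambda>n. f (l n)) \<longlonglongrightarrow> 0" using l2 l(2) by simp
  ultimately have f0: "f 0 = 0" by (rule LIMSEQ_unique)
  have "(\<lambda>n. l n * (f (l n) / (l n)\<^sup>2)) \<longlonglongrightarrow> 0 * L" by (intro tendsto_intros l L)
  then have "(\<lambda>n. f (l n) / l n) \<longlonglongrightarrow> 0" using l(2) by (simp add: power2_eq_square)
  moreover have "(\<lambda>n. f (l n) / l n) \<longlonglongrightarrow> F 1 0"
  proof -
    have "((\<lambda>h. f h / h) \<longlongrightarrow> F 1 0) (at 0)" using d0 f0 by (simp add: DERIV_def)
    then show ?thesis using l unfolding tendsto_at_iff_sequentially comp_def by auto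
  qed
  ultimately have f1: "F 1 0 = 0" using LIMSEQ_unique by blast
  have "\<forall>\<^sub>F n in sequentially. dist (l n) 0 < e / 2" using e by (intro tendstoD[OF l(1)]) simp
  then have "\<forall>\<^sub>F n in sequentially. cmod (f (l n) / (l n)\<^sup>2 - F 2 0 / 2) \<le> B / 2 * cmod (l n)"
  proof eventually_elim
    case (elim n)
    then have "cmod (f (l n) - F 2 0 * (l n)\<^sup>2 / 2) \<le> B * cmod (l n) ^ 3 / 2"
      using T[of "l n"] f0 f1 by (simp add: S_def F_def)
    then have "cmod (f (l n) - F 2 0 * (l n)\<^sup>2 / 2) / cmod ((l n)\<^sup>2) \<le> (B * cmod (l n) ^ 3 / 2) / cmod ((l n)\<^sup>2)"
      by (rule divide_right_mono) simp
    also have "(B * cmod (l n) ^ 3 / 2) / cmod ((l n)\<^sup>2) = B / 2 * cmod (l n)"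
      using l(2)[of n] by (simp add: norm_mult power2_eq_square power3_eq_cube)
    also have "cmod (f (l n) - F 2 0 * (l n)\<^sup>2 / 2) / cmod ((l n)\<^sup>2) = cmod (f (l n) / (l n)\<^sup>2 - F 2 0 / 2)"
      using l(2)[of n] by (simp add: norm_divide[symmetric] diff_divide_distrib)
    finally show ?case .
  qed
  moreover have "(\<lambda>n. B / 2 * cmod (l n)) \<longlonglongrightarrow> 0"
    using tendsto_mult_right_zero[OF tendsto_norm_zero[OF l(1)]] .
  ultimately have "(\<lambda>n. f (l n) / (l n)\<^sup>2 - F 2 0 / 2) \<longlonglongrightarrow> 0" by (rule Lim_null_comparison)
  then have F2: "(\<lambda>n. f (l n) / (l n)\<^sup>2) \<longlonglongrightarrow> F 2 0 / 2" by (rule LIM_zero_cancel)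
  have "2 * L = 2 * (F 2 0 / 2)" using LIMSEQ_unique[OF L F2] by (simp only:)
  then show ?thesis by (simp add: F_def)
qed


section \<open>The eigenvalue system in flux variables and its reflection\<close>

lemma has_vector_derivative_component:
  "(W has_vector_derivative X) F \<Longrightarrow> ((\<lambda>x. W x $ i) has_vector_derivative X $ i) F"
  by (rule bounded_linear.has_vector_derivative[OF bounded_linear_vec_nth])

definition flux_P :: "real \<Rightarrow> (real \<Rightarrow> complex ^ 4) \<Rightarrow> real \<Rightarrow> complex" where
  "flux_P s W x = W x $ 1 + of_real s * W x $ 2"

definition flux_Q :: "real \<Rightarrow> real \<Rightarrow> (real \<Rightarrow> real) \<Rightarrow> (real \<Rightarrow> complex ^ 4) \<Rightarrow> real \<Rightarrow> complex" where
  "flux_Q \<kappa> s a W x = - of_real s * W x $ 1 + of_real (a x) * W x $ 2 + of_real \<kappa> * W x $ 4"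

text \<open>Both equations are in conservation form, P' = t v and Q' = -t u. The derivative of the
  coefficient is absorbed because \<open>flux_Q\<close> contains \<alpha> v
  undifferentiated.\<close>

lemma eigen_solution_reduced:
  assumes kap: "\<kappa> > 0" and da: "\<And>x. (alpha p v has_real_derivative deriv (alpha p v) x) (at x)"
    and sol: "eigen_solution p \<kappa> s v (of_real t) W"
  shows "reduced_solution \<kappa> s (alpha p v) t (flux_P s W) (flux_Q \<kappa> s (alpha p v) W) (\<lambda>x. W x $ 2) (\<lambda>x. W x $ 3)"
  unfolding reduced_solution_def
proof (intro allI conjI)
  fix x
  let ?a = "alpha p v" and ?a' = "deriv (alpha p v)"
  have k0: "complex_of_real \<kappa> \<noteq> 0" using kap by simp
  have W: "(W has_vector_derivative (eigen_matrix p \<kappa> s v x (of_real t) *v W x)) (at x)"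
    using sol by (simp add: eigen_solution_def)
  note c = has_vector_derivative_component[OF W]
  have M: "(eigen_matrix p \<kappa> s v x (of_real t) *v W x) $ 1 = of_real t * W x $ 2 - of_real s * W x $ 3"
    "(eigen_matrix p \<kappa> s v x (of_real t) *v W x) $ 2 = W x $ 3"
    "(eigen_matrix p \<kappa> s v x (of_real t) *v W x) $ 3 = W x $ 4"
    "(eigen_matrix p \<kappa> s v x (of_real t) *v W x) $ 4 =
      - (of_real t * W x $ 1 + (of_real (?a' x) - of_real s * of_real t) * W x $ 2 + (of_real (?a x) + (of_real s)\<^sup>2) * W x $ 3) / of_real \<kappa>"
    using k0 by (simp_all add: eigen_matrix_def Let_def matrix_vector_mult_def sum_4 add_divide_distrib diff_divide_distrib algebra_simps)
  have d: "((\<lambda>x. W x $ 1) has_vector_derivative of_real t * W x $ 2 - of_real s * W x $ 3) (at x)"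
    "((\<lambda>x. W x $ 2) has_vector_derivative W x $ 3) (at x)"
    "((\<lambda>x. W x $ 3) has_vector_derivative W x $ 4) (at x)"
    "((\<lambda>x. W x $ 4) has_vector_derivative
      - (of_real t * W x $ 1 + (of_real (?a' x) - of_real s * of_real t) * W x $ 2 + (of_real (?a x) + (of_real s)\<^sup>2) * W x $ 3) / of_real \<kappa>) (at x)"
    using c[of 1] c[of 2] c[of 3] c[of 4] unfolding M .
  have da': "((\<lambda>x. complex_of_real (?a x)) has_vector_derivative of_real (?a' x)) (at x)"
    using has_vector_derivative_of_real da has_real_derivative_iff_has_vector_derivative by blast
  show "(flux_P s W has_vector_derivative of_real t * W x $ 2) (at x)"
    unfolding flux_P_def[abs_def]
    apply (rule has_vector_derivative_eq_rhs)
     apply (rule d derivative_intros has_vector_derivative_mult_right)+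
    by simp
  show "((\<lambda>x. W x $ 2) has_vector_derivative W x $ 3) (at x)" by (rule d)
  have e: "of_real \<kappa> * (X / of_real \<kappa>) = X" for X :: complex using k0 by simp
  show "(flux_Q \<kappa> s ?a W has_vector_derivative - of_real t * (flux_P s W x - of_real s * W x $ 2)) (at x)"
    unfolding flux_Q_def[abs_def] flux_P_def
    apply (rule has_vector_derivative_eq_rhs)
     apply (rule d da' derivative_intros has_vector_derivative_mult_right has_vector_derivative_mult)+
    unfolding e
    by (simp add: algebra_simps power2_eq_square)
  have "W x $ 4 = (flux_Q \<kappa> s ?a W x + of_real s * flux_P s W x - of_real (s\<^sup>2 + ?a x) * W x $ 2) / of_real \<kappa>"
    using k0 by (simp add: flux_Q_def flux_P_def field_simps power2_eq_square)
  then show "((\<lambda>x. W x $ 3) has_vector_derivative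
      (flux_Q \<kappa> s ?a W x + of_real s * flux_P s W x - of_real (s\<^sup>2 + ?a x) * W x $ 2) / of_real \<kappa>) (at x)"
    using d(3) by simp
qed

text \<open>Under x to -x and s to -s the system is preserved if u is kept and v changes sign; P and
  z are then even and Q is odd. Thus statements at +infinity transfer to -infinity.\<close>

lemma reduced_solution_mirror:
  assumes "reduced_solution \<kappa> s a t P Q v z"
  shows "reduced_solution \<kappa> (- s) (\<lambda>x. a (- x)) t (\<lambda>x. P (- x)) (\<lambda>x. - Q (- x)) (\<lambda>x. - v (- x)) (\<lambda>x. z (- x))"
  unfolding reduced_solution_def
proof (intro allI conjI)
  fix x
  have m: "((\<lambda>x. F (- x)) has_vector_derivative - F') (at x)" if "(F has_vector_derivative F') (at (- x))" for F :: "real \<Rightarrow> complex" and F'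
  proof -
    have "((\<lambda>x. - x) has_vector_derivative - 1) (at x)" by (auto intro!: derivative_eq_intros)
    from vector_diff_chain_at[OF this that] show ?thesis by (simp add: comp_def)
  qed
  have d: "(P has_vector_derivative of_real t * v (- x)) (at (- x))"
    "(Q has_vector_derivative - of_real t * (P (- x) - of_real s * v (- x))) (at (- x))"
    "(v has_vector_derivative z (- x)) (at (- x))"
    "(z has_vector_derivative
        (Q (- x) + of_real s * P (- x) - of_real (s\<^sup>2 + a (- x)) * v (- x)) / of_real \<kappa>) (at (- x))"
    using assms unfolding reduced_solution_def by auto
  show "((\<lambda>x. P (- x)) has_vector_derivative of_real t * - v (- x)) (at x)"
    using m[OF d(1)] by simp
  show "((\<lambda>x. - Q (- x)) has_vector_derivative - of_real t * (P (- x) - of_real (- s) * - v (- x))) (at x)"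
    using has_vector_derivative_minus[OF m[OF d(2)]] by simp
  show "((\<lambda>x. - v (- x)) has_vector_derivative z (- x)) (at x)"
    using has_vector_derivative_minus[OF m[OF d(3)]] by simp
  show "((\<lambda>x. z (- x)) has_vector_derivative (- Q (- x) + of_real (- s) * P (- x) - of_real ((- s)\<^sup>2 + a (- x)) * - v (- x)) / of_real \<kappa>) (at x)"
    by (rule has_vector_derivative_eq_rhs[OF m[OF d(4)]]) (simp add: minus_divide_left algebra_simps)
qed

text \<open>The two-sided version of \<open>half_line\<close>. The primitives \<open>f\<close>,
  \<open>g\<close>, \<open>h\<close> are left out because they depend on the end at which they are
  normalized.\<close>

locale linearized =
  fixes \<kappa> s c k K :: real and a y y1 y2 w w1 :: "real \<Rightarrow> real"
  assumes kap: "\<kappa> > 0" and sc: "\<bar>s\<bar> < c" and k: "k > 0" and cont: "continuous_on UNIV a"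
    and dy: "\<And>x. (y has_real_derivative y1 x) (at x)"
      "\<And>x. (y1 has_real_derivative y2 x) (at x)"
      "\<And>x. (y2 has_real_derivative - ((s\<^sup>2 + a x) * y1 x) / \<kappa>) (at x)"
    and dw: "\<And>x. (w has_real_derivative w1 x) (at x)"
      "\<And>x. (w1 has_real_derivative - ((s\<^sup>2 + a x) * w x + 2 * s * y x) / \<kappa>) (at x)"
    and decay: "\<And>x. \<bar>a x + c\<^sup>2\<bar> \<le> K * exp (- (k * \<bar>x\<bar>))"
      "\<And>x. \<bar>y x\<bar> \<le> K * exp (- (k * \<bar>x\<bar>))"
      "\<And>x. \<bar>y1 x\<bar> \<le> K * exp (- (k * \<bar>x\<bar>))"
      "\<And>x. \<bar>y2 x\<bar> \<le> K * exp (- (k * \<bar>x\<bar>))"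
      "\<And>x. \<bar>w x\<bar> \<le> K * exp (- (k * \<bar>x\<bar>))"
      "\<And>x. \<bar>w1 x\<bar> \<le> K * exp (- (k * \<bar>x\<bar>))"
begin

lemma K_nonneg: "K \<ge> 0" using decay(2)[of 0] by simp

lemma continuous: "continuous_on A y" "continuous_on A w"
  by (rule DERIV_continuous_on[OF has_field_derivative_at_within[OF dy(1)]])
    (rule DERIV_continuous_on[OF has_field_derivative_at_within[OF dw(1)]])

lemma decay_h: "\<bar>2 * s * y x * w x + (y x)\<^sup>2\<bar> \<le> (2 * \<bar>s\<bar> + 1) * K * K * exp (- (k * \<bar>x\<bar>))"
proof -
  let ?e = "K * exp (- (k * \<bar>x\<bar>))"
  have "K * exp (- (k * \<bar>x\<bar>)) \<le> K * 1" using K_nonneg k by (intro mult_left_mono) auto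
  then have b: "\<bar>w x\<bar> \<le> K" "\<bar>y x\<bar> \<le> K" using decay[of x] by linarith+
  have "\<bar>y x\<bar> * \<bar>w x\<bar> \<le> ?e * K" "\<bar>y x\<bar> * \<bar>y x\<bar> \<le> ?e * K"
    using b decay(2)[of x] K_nonneg by (intro mult_mono; simp)+
  then have "2 * \<bar>s\<bar> * (\<bar>y x\<bar> * \<bar>w x\<bar>) + \<bar>y x\<bar> * \<bar>y x\<bar> \<le> 2 * \<bar>s\<bar> * (?e * K) + ?e * K"
    by (intro add_mono mult_left_mono) auto
  moreover have "\<bar>2 * s * y x * w x + (y x)\<^sup>2\<bar> \<le> 2 * \<bar>s\<bar> * (\<bar>y x\<bar> * \<bar>w x\<bar>) + \<bar>y x\<bar> * \<bar>y x\<bar>"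
    by (rule order_trans[OF abs_triangle_ineq]) (simp add: abs_mult power2_eq_square)
  ultimately show ?thesis by (simp add: algebra_simps)
qed

text \<open>The speed changes sign with the reflection, so \<open>w\<close>, a derivative with
  respect to the speed, changes sign as well.\<close>

lemma mirror: "linearized \<kappa> (- s) c k K (\<lambda>x. a (- x)) (\<lambda>x. y (- x)) (\<lambda>x. - y1 (- x)) (\<lambda>x. y2 (- x)) (\<lambda>x. - w (- x)) (\<lambda>x. w1 (- x))"
proof
  have m: "((\<lambda>x. F (- x)) has_real_derivative - F') (at x)" if "(F has_real_derivative F') (at (- x))" for F :: "real \<Rightarrow> real" and F' x
    using DERIV_chain'[OF DERIV_minus[OF DERIV_ident] that] by simp
  fix x
  show "((\<lambda>x. y (- x)) has_real_derivative - y1 (- x)) (at x)" by (rule m[OF dy(1)])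
  show "((\<lambda>x. - y1 (- x)) has_real_derivative y2 (- x)) (at x)" using DERIV_minus[OF m[OF dy(2)]] by simp
  show "((\<lambda>x. y2 (- x)) has_real_derivative - (((- s)\<^sup>2 + a (- x)) * - y1 (- x)) / \<kappa>) (at x)" using m[OF dy(3)] by simp
  show "((\<lambda>x. - w (- x)) has_real_derivative w1 (- x)) (at x)" using DERIV_minus[OF m[OF dw(1)]] by simp
  show "((\<lambda>x. w1 (- x)) has_real_derivative - (((- s)\<^sup>2 + a (- x)) * - w (- x) + 2 * - s * y (- x)) / \<kappa>) (at x)"
    by (rule DERIV_cong[OF m[OF dw(2)]]) (simp add: minus_divide_left algebra_simps)
  show "\<bar>a (- x) + c\<^sup>2\<bar> \<le> K * exp (- (k * \<bar>x\<bar>))" "\<bar>y (- x)\<bar> \<le> K * exp (- (k * \<bar>x\<bar>))"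
    "\<bar>- y1 (- x)\<bar> \<le> K * exp (- (k * \<bar>x\<bar>))" "\<bar>y2 (- x)\<bar> \<le> K * exp (- (k * \<bar>x\<bar>))"
    "\<bar>- w (- x)\<bar> \<le> K * exp (- (k * \<bar>x\<bar>))" "\<bar>w1 (- x)\<bar> \<le> K * exp (- (k * \<bar>x\<bar>))"
    using decay[of "- x"] by auto
next
  show "continuous_on UNIV (\<lambda>x. a (- x))"
    by (rule continuous_on_compose2[OF cont]) (auto intro!: continuous_intros)
qed (use kap sc k in auto)

lemma half_line_exists:
  obtains K' f g h where "half_line \<kappa> s c k K' a y y1 y2 w w1 f g h"
proof -
  have e: "K * exp (- (k * \<bar>x\<bar>)) = K * exp (- (k * x))" if "x \<ge> 0" for x using that by simp
  obtain g where g: "\<And>x. (g has_real_derivative w x) (at x)" "\<And>x. x \<ge> 0 \<Longrightarrow> \<bar>g x\<bar> \<le> K / k * exp (- (k * x))"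
    using exp_decay_antiderivative[OF k continuous(2), of K] decay(5) e by metis
  have b: "\<bar>- s * w x - y x\<bar> \<le> ((\<bar>s\<bar> + 1) * K) * exp (- (k * x))" if "x \<ge> 0" for x
  proof -
    have "\<bar>- s * w x - y x\<bar> \<le> \<bar>s\<bar> * \<bar>w x\<bar> + \<bar>y x\<bar>"
      by (rule order_trans[OF abs_triangle_ineq4]) (simp add: abs_mult)
    also have "\<dots> \<le> \<bar>s\<bar> * (K * exp (- (k * x))) + K * exp (- (k * x))"
      using decay(2)[of x] decay(5)[of x] e[OF that] by (intro add_mono mult_left_mono) auto
    finally show ?thesis by (simp add: algebra_simps)
  qed
  obtain f where f: "\<And>x. (f has_real_derivative - s * w x - y x) (at x)"
    "\<And>x. x \<ge> 0 \<Longrightarrow> \<bar>f x\<bar> \<le> ((\<bar>s\<bar> + 1) * K) / k * exp (- (k * x))"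
    using exp_decay_antiderivative[OF k, of "\<lambda>x. - s * w x - y x" "(\<bar>s\<bar> + 1) * K"] b
      continuous_on_diff[OF continuous_on_mult_left[OF continuous(2)] continuous(1)] by metis
  have bh: "\<bar>2 * s * y x * w x + (y x)\<^sup>2\<bar> \<le> ((2 * \<bar>s\<bar> + 1) * K * K) * exp (- (k * x))" if "x \<ge> 0" for x
    using decay_h[of x] that by simp
  have ch: "continuous_on UNIV (\<lambda>x. 2 * s * y x * w x + (y x)\<^sup>2)" by (intro continuous_intros continuous)
  obtain h where h: "\<And>x. (h has_real_derivative 2 * s * y x * w x + (y x)\<^sup>2) (at x)"
    "\<And>x. x \<ge> 0 \<Longrightarrow> \<bar>h x\<bar> \<le> ((2 * \<bar>s\<bar> + 1) * K * K) / k * exp (- (k * x))"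
    using exp_decay_antiderivative[OF k ch bh] by metis
  define K' where "K' = K + K / k + ((\<bar>s\<bar> + 1) * K) / k"
  have nn: "0 \<le> K / k" "0 \<le> ((\<bar>s\<bar> + 1) * K) / k" using K_nonneg k by auto
  have le: "r \<le> K' * exp (- (k * x))" if "r \<le> R * exp (- (k * x))" "R \<le> K'" for r R x
    by (rule order_trans[OF that(1) mult_right_mono[OF that(2)]]) simp
  have KK: "K \<le> K'" "K / k \<le> K'" "((\<bar>s\<bar> + 1) * K) / k \<le> K'" using K_nonneg nn by (auto simp: K'_def)
  have "half_line \<kappa> s c k K' a y y1 y2 w w1 f g h"
  proof
    fix x :: real assume x: "x \<ge> 0"
    show "\<bar>a x + c\<^sup>2\<bar> \<le> K' * exp (- (k * x))" "\<bar>y x\<bar> \<le> K' * exp (- (k * x))"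
      "\<bar>y1 x\<bar> \<le> K' * exp (- (k * x))" "\<bar>y2 x\<bar> \<le> K' * exp (- (k * x))"
      "\<bar>w x\<bar> \<le> K' * exp (- (k * x))" "\<bar>w1 x\<bar> \<le> K' * exp (- (k * x))"
      using decay[of x] x by (auto intro: le[OF _ KK(1)])
    show "\<bar>f x\<bar> \<le> K' * exp (- (k * x))" by (rule le[OF f(2)[OF x] KK(3)])
    show "\<bar>g x\<bar> \<le> K' * exp (- (k * x))" by (rule le[OF g(2)[OF x] KK(2)])
  next
    show "(h \<longlongrightarrow> 0) at_top"
      by (rule tendsto_0_exp_decay[OF k, of _ "((2 * \<bar>s\<bar> + 1) * K * K) / k"]) (use h(2) in simp)
  qed (rule kap sc k cont dy dw f(1) g(1) h(1))+
  then show ?thesis by (rule that)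
qed

end


section \<open>The limit of the rescaled Evans determinant\<close>

lemma constant_if_zero_derivative:
  fixes f :: "real \<Rightarrow> 'a::real_normed_vector"
  assumes "\<And>x. (f has_vector_derivative 0) (at x)"
  shows "f x = f y"
proof -
  have "(f has_derivative (\<lambda>h. 0)) (at x within UNIV)" for x
    using assms[of x] by (simp add: has_vector_derivative_def)
  then show ?thesis using has_derivative_zero_constant[of UNIV f] by (metis UNIV_I convex_UNIV)
qed

lemma flux_tendsto_0:
  assumes W: "(W \<longlongrightarrow> 0) F" and a: "(a \<longlongrightarrow> A) F"
  shows "(flux_P s W \<longlongrightarrow> 0) F" "(flux_Q \<kappa> s a W \<longlongrightarrow> 0) F"
    "((\<lambda>x. W x $ i) \<longlongrightarrow> 0) F"
proof -
  have c: "((\<lambda>x. W x $ i) \<longlongrightarrow> 0) F" for i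
    using tendsto_vec_nth[OF W, of i] by simp
  show "((\<lambda>x. W x $ i) \<longlongrightarrow> 0) F" by (rule c)
  have "((\<lambda>x. W x $ 1 + of_real s * W x $ 2) \<longlongrightarrow> 0 + of_real s * 0) F"
    by (intro tendsto_intros c)
  then show "(flux_P s W \<longlongrightarrow> 0) F" by (simp add: flux_P_def[abs_def])
  have "((\<lambda>x. - of_real s * W x $ 1 + of_real (a x) * W x $ 2 + of_real \<kappa> * W x $ 4) \<longlongrightarrow>
    - of_real s * 0 + of_real A * 0 + of_real \<kappa> * 0) F"
    by (intro tendsto_intros c a)
  then show "(flux_Q \<kappa> s a W \<longlongrightarrow> 0) F" by (simp add: flux_Q_def[abs_def])
qed

text \<open>At spectral parameter 0 both fluxes are conserved, so the prescribed limit at one end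
  determines them everywhere.\<close>

lemma flux_at_0_constant:
  assumes "\<kappa> > 0" "\<And>x. (alpha p v has_real_derivative deriv (alpha p v) x) (at x)"
    "eigen_solution p \<kappa> s v 0 W"
    and F: "F \<noteq> bot" and a: "(alpha p v \<longlongrightarrow> A) F" and W: "(W \<longlongrightarrow> vector [b, 1, 0, 0]) F"
  shows "flux_P s W x = b + of_real s" "flux_Q \<kappa> s (alpha p v) W x = - of_real s * b + of_real A"
proof -
  have r: "reduced_solution \<kappa> s (alpha p v) 0 (flux_P s W) (flux_Q \<kappa> s (alpha p v) W) (\<lambda>x. W x $ 2) (\<lambda>x. W x $ 3)"
    by (rule eigen_solution_reduced) (use assms in auto)
  have c: "((\<lambda>x. W x $ i) \<longlongrightarrow> vector [b, 1, 0, 0] $ i) F" for i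
    using tendsto_vec_nth[OF W, of i] by simp
  have c': "((\<lambda>x. W x $ 1) \<longlongrightarrow> b) F" "((\<lambda>x. W x $ 2) \<longlongrightarrow> 1) F" "((\<lambda>x. W x $ 4) \<longlongrightarrow> 0) F"
    using c[of 1] c[of 2] c[of 4] by simp_all
  have P: "flux_P s W = (\<lambda>_. flux_P s W x)"
    by (rule ext, rule constant_if_zero_derivative) (use r in \<open>simp add: reduced_solution_def\<close>)
  have Q: "flux_Q \<kappa> s (alpha p v) W = (\<lambda>_. flux_Q \<kappa> s (alpha p v) W x)"
    by (rule ext, rule constant_if_zero_derivative) (use r in \<open>simp add: reduced_solution_def\<close>)
  have "(flux_P s W \<longlongrightarrow> b + of_real s * 1) F"
    unfolding flux_P_def[abs_def] by (intro tendsto_intros c')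
  then have "((\<lambda>_. flux_P s W x) \<longlongrightarrow> b + of_real s * 1) F" by (subst (asm) P)
  from tendsto_unique[OF F tendsto_const this] show "flux_P s W x = b + of_real s" by simp
  have "(flux_Q \<kappa> s (alpha p v) W \<longlongrightarrow> - of_real s * b + of_real A * 1 + of_real \<kappa> * 0) F"
    unfolding flux_Q_def[abs_def] by (intro tendsto_intros c' a)
  then have "((\<lambda>_. flux_Q \<kappa> s (alpha p v) W x) \<longlongrightarrow> - of_real s * b + of_real A * 1 + of_real \<kappa> * 0) F" by (subst (asm) Q)
  from tendsto_unique[OF F tendsto_const this] show "flux_Q \<kappa> s (alpha p v) W x = - of_real s * b + of_real A" by simp
qed

text \<open>The four rows of the left factor are the two fluxes, the pairing with the generalized kernel of
  the adjoint operator, and a functional that does not vanish on the profile derivative.\<close>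

lemma det_change_of_rows:
  fixes A B C E \<kappa> s a b0 b1 :: complex and U1 U2 U3 U4 :: "complex ^ 4"
  defines "P \<equiv> \<lambda>U :: complex ^ 4. U $ 1 + s * U $ 2"
    and "Q \<equiv> \<lambda>U :: complex ^ 4. - s * U $ 1 + a * U $ 2 + \<kappa> * U $ 4"
  defines "l \<equiv> \<lambda>U. P U * A + Q U * B - \<kappa> * U $ 3 * C + \<kappa> * U $ 2 * E"
    and "\<rho> \<equiv> \<lambda>U :: complex ^ 4. b0 * U $ 2 + b1 * U $ 3"
  shows "\<kappa>\<^sup>2 * (E * b1 + C * b0) * det (transpose (vector [U1, U2, U3, U4])) =
    det (matrix4 (P U1) (P U2) (P U3) (P U4) (Q U1) (Q U2) (Q U3) (Q U4) (l U1) (l U2) (l U3) (l U4) (\<rho> U1) (\<rho> U2) (\<rho> U3) (\<rho> U4))"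
proof -
  let ?N = "matrix4 1 s 0 0 (- s) a 0 \<kappa> (A - s * B) (s * A + a * B + \<kappa> * E) (- (\<kappa> * C)) (\<kappa> * B) 0 b0 b1 0"
  have N: "det ?N = \<kappa>\<^sup>2 * (E * b1 + C * b0)"
    unfolding det_matrix4 by (simp add: algebra_simps power2_eq_square)
  have "?N ** transpose (vector [U1, U2, U3, U4]) =
    matrix4 (P U1) (P U2) (P U3) (P U4) (Q U1) (Q U2) (Q U3) (Q U4) (l U1) (l U2) (l U3) (l U4) (\<rho> U1) (\<rho> U2) (\<rho> U3) (\<rho> U4)"
    unfolding vec_eq_iff forall_4
    by (simp add: matrix_matrix_mult_def sum_4 transpose_def matrix4_def P_def Q_def l_def \<rho>_def algebra_simps)
  then show ?thesis using det_mul[of ?N "transpose (vector [U1, U2, U3, U4])"] N by simp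
qed

context linearized
begin

lemma a_lim: "(a \<longlongrightarrow> - c\<^sup>2) at_top" "(a \<longlongrightarrow> - c\<^sup>2) at_bot"
  using tendsto_add[OF exp_abs_decay_tendsto_0(1)[OF k decay(1)] tendsto_const[of "- c\<^sup>2"]]
    tendsto_add[OF exp_abs_decay_tendsto_0(2)[OF k decay(1)] tendsto_const[of "- c\<^sup>2"]] by simp_all

text \<open>\<open>R\<close> treats W1 and W2 at +infinity, its reflection \<open>L\<close> treats
  W3 and W4 at -infinity. After a change of rows every entry of the rescaled determinant has a
  limit, and only the total integral carried by \<open>h\<close> and \<open>h'\<close>
  survives.\<close>

lemma evans_second_derivative:
  assumes basis: "evans_basis p \<kappa> vinf s v u r W1 W2 W3 W4"
    and a: "a = alpha p v" and da: "\<And>x. (alpha p v has_real_derivative deriv (alpha p v) x) (at x)"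
    and c: "c = sqrt (- deriv p vinf)"
    and dU: "\<And>x. deriv u x = - s * y1 x" "\<And>x. deriv v x = y1 x" "\<And>x. (deriv ^^ 2) v x = y2 x"
      "\<And>x. (deriv ^^ 3) v x = - ((s\<^sup>2 + a x) * y1 x) / \<kappa>"
    and nondeg: "y1 0 \<noteq> 0 \<or> y2 0 \<noteq> 0"
  shows "(deriv ^^ 2) (evans_function W1 W2 W3 W4) 0 =
    of_real (4 * c * (s\<^sup>2 - c\<^sup>2) / \<kappa>\<^sup>2 * - (\<integral>x. 2 * s * y x * w x + (y x)\<^sup>2 \<partial>lborel))"
proof -
  interpret m: linearized \<kappa> "- s" c k K "\<lambda>x. a (- x)" "\<lambda>x. y (- x)" "\<lambda>x. - y1 (- x)" "\<lambda>x. y2 (- x)" "\<lambda>x. - w (- x)" "\<lambda>x. w1 (- x)"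
    by (rule mirror)
  obtain K1 f g h where R: "half_line \<kappa> s c k K1 a y y1 y2 w w1 f g h" using half_line_exists by blast
  obtain K2 f' g' h' where L: "half_line \<kappa> (- s) c k K2 (\<lambda>x. a (- x)) (\<lambda>x. y (- x)) (\<lambda>x. - y1 (- x)) (\<lambda>x. y2 (- x)) (\<lambda>x. - w (- x)) (\<lambda>x. w1 (- x)) f' g' h'"
    using m.half_line_exists by blast
  interpret R: half_line \<kappa> s c k K1 a y y1 y2 w w1 f g h by (rule R)
  interpret L: half_line \<kappa> "- s" c k K2 "\<lambda>x. a (- x)" "\<lambda>x. y (- x)" "\<lambda>x. - y1 (- x)" "\<lambda>x. y2 (- x)" "\<lambda>x. - w (- x)" "\<lambda>x. w1 (- x)" f' g' h'
    by (rule L)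
  \<comment> \<open>\<open>h\<close> is normalized at +infinity and the reflected \<open>h'\<close>
    at -infinity; as primitives of the same density they combine to a constant, which is minus the
    whole-line integral.\<close>
  have T: "(\<integral>x. 2 * s * y x * w x + (y x)\<^sup>2 \<partial>lborel) = - (h 0 + h' 0)"
  proof -
    have dh': "((\<lambda>x. - h' (- x)) has_real_derivative 2 * s * y x * w x + (y x)\<^sup>2) (at x)" for x
      using DERIV_minus[OF DERIV_chain'[OF DERIV_minus[OF DERIV_ident] L.dh[of "- x"]]] by (simp add: add.commute)
    have "((\<lambda>x. h x + h' (- x)) has_real_derivative 0) (at x)" for x
      using DERIV_diff[OF R.dh[of x] dh'[of x]] by simp
    then have e: "h x + h' (- x) = h 0 + h' (- 0)" for x using DERIV_isconst_all by blast
    have "((\<lambda>x. (h 0 + h' 0) - h' (- x)) \<longlongrightarrow> (h 0 + h' 0) - 0) at_bot"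
      by (intro tendsto_intros) (use L.h0 in \<open>simp add: filterlim_at_bot_mirror\<close>)
    moreover have "(\<lambda>x. (h 0 + h' 0) - h' (- x)) = h" using e by (auto simp: fun_eq_iff algebra_simps)
    ultimately have hb: "(h \<longlongrightarrow> h 0 + h' 0) at_bot" by simp
    have ch: "continuous_on UNIV (\<lambda>x. 2 * s * y x * w x + (y x)\<^sup>2)" by (intro continuous_intros continuous)
    have "(\<integral>x. 2 * s * y x * w x + (y x)\<^sup>2 \<partial>lborel) = 0 - (h 0 + h' 0)"
      by (rule whole_line_FTC[OF R.dh ch integrable_continuous_exp_abs_decay[OF k ch decay_h] hb R.h0])
    then show ?thesis by simp
  qed
  define \<Omega> where "\<Omega> = {\<mu>. Re \<mu> > 0} \<union> ball 0 r"
  have r0: "r > 0" and eig: "\<And>W \<mu>. W \<in> {W1, W2, W3, W4} \<Longrightarrow> \<mu> \<in> \<Omega> \<Longrightarrow> eigen_solution p \<kappa> s v \<mu> (W \<mu>)"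
    and anal: "\<And>W x i. W \<in> {W1, W2, W3, W4} \<Longrightarrow> (\<lambda>\<mu>. W \<mu> x $ i) analytic_on \<Omega>"
    and span: "\<And>\<mu>. Re \<mu> > 0 \<Longrightarrow> fun_span2 (W1 \<mu>) (W2 \<mu>) = {W. eigen_solution p \<kappa> s v \<mu> W \<and> (W \<longlongrightarrow> 0) at_top}"
      "\<And>\<mu>. Re \<mu> > 0 \<Longrightarrow> fun_span2 (W3 \<mu>) (W4 \<mu>) = {W. eigen_solution p \<kappa> s v \<mu> W \<and> (W \<longlongrightarrow> 0) at_bot}"
    and W0: "W1 0 = (\<lambda>x. vector [of_real (deriv u x), of_real (deriv v x), of_real ((deriv ^^ 2) v x), of_real ((deriv ^^ 3) v x)])"
      "W4 0 = (\<lambda>x. vector [of_real (deriv u x), of_real (deriv v x), of_real ((deriv ^^ 2) v x), of_real ((deriv ^^ 3) v x)])"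
      "(W2 0 \<longlongrightarrow> vector [- of_real c, 1, 0, 0]) at_top" "(W3 0 \<longlongrightarrow> vector [of_real c, 1, 0, 0]) at_bot"
    using basis unfolding evans_basis_def Let_def \<Omega>_def c by blast+
  have Om0: "0 \<in> \<Omega>" using r0 by (simp add: \<Omega>_def)
  define t where "t = (\<lambda>n. inverse (real (Suc n)))"
  have t: "t n > 0" "t \<longlonglongrightarrow> 0" for n
    unfolding t_def using LIMSEQ_inverse_real_of_nat by auto
  define \<tau> where "\<tau> = (\<lambda>n. complex_of_real (t n))"
  have tau: "Re (\<tau> n) > 0" "\<tau> n \<in> \<Omega>" "\<tau> n \<noteq> 0" "\<tau> \<longlonglongrightarrow> 0" for n
    using t tendsto_of_real[OF t(2), where 'a = complex] by (auto simp: \<tau>_def \<Omega>_def less_imp_neq[THEN not_sym])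
  have in_span: "U \<in> fun_span2 U V" "V \<in> fun_span2 U V" for U V
  proof -
    have "U = (\<lambda>x. 1 *s U x + 0 *s V x)" "V = (\<lambda>x. 0 *s U x + 1 *s V x)" by simp_all
    then show "U \<in> fun_span2 U V" "V \<in> fun_span2 U V" unfolding fun_span2_def by blast+
  qed
  have lim0: "(W1 (\<tau> n) \<longlongrightarrow> 0) at_top" "(W2 (\<tau> n) \<longlongrightarrow> 0) at_top" "(W3 (\<tau> n) \<longlongrightarrow> 0) at_bot" "(W4 (\<tau> n) \<longlongrightarrow> 0) at_bot" for n
    using in_span(1)[of "W1 (\<tau> n)" "W2 (\<tau> n)"] in_span(1)[of "W3 (\<tau> n)" "W4 (\<tau> n)"]
      in_span(2)[of "W2 (\<tau> n)" "W1 (\<tau> n)"] in_span(2)[of "W4 (\<tau> n)" "W3 (\<tau> n)"] span[OF tau(1)[of n]] by auto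
  have conv: "(\<lambda>n. W (\<tau> n) x $ i) \<longlonglongrightarrow> W 0 x $ i" if "W \<in> {W1, W2, W3, W4}" for W x i
    by (rule isCont_tendsto_compose[OF analytic_at_imp_isCont[OF analytic_on_subset[OF anal[OF that]]] tau(4)])
      (use Om0 in auto)
  have dconv: "convergent (\<lambda>n. (W (\<tau> n) x $ i - W 0 x $ i) / \<tau> n)" if "W \<in> {W1, W2, W3, W4}" for W x i
  proof -
    have "(\<lambda>\<mu>. W \<mu> x $ i) field_differentiable at 0"
      using analytic_on_imp_differentiable_at[OF anal[OF that] Om0] .
    then obtain D where "((\<lambda>\<mu>. W \<mu> x $ i) has_field_derivative D) (at 0)"
      unfolding field_differentiable_def by blast
    then have "((\<lambda>h. (W h x $ i - W 0 x $ i) / h) \<longlongrightarrow> D) (at 0)" by (simp add: DERIV_def)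
    then have "(\<lambda>n. (W (\<tau> n) x $ i - W 0 x $ i) / \<tau> n) \<longlonglongrightarrow> D"
      using tau(3,4) unfolding tendsto_at_iff_sequentially comp_def by auto
    then show ?thesis by (rule convergentI)
  qed
  define P where "P = flux_P s"
  define Q where "Q = flux_Q \<kappa> s a"
  have Pconv: "(\<lambda>n. P (W (\<tau> n)) x) \<longlonglongrightarrow> P (W 0) x" and Qconv: "(\<lambda>n. Q (W (\<tau> n)) x) \<longlonglongrightarrow> Q (W 0) x"
    if "W \<in> {W1, W2, W3, W4}" for W x
    unfolding P_def Q_def flux_P_def flux_Q_def by (intro tendsto_intros conv that)+
  have dPconv: "convergent (\<lambda>n. (P (W (\<tau> n)) x - P (W 0) x) / \<tau> n)" if W: "W \<in> {W1, W2, W3, W4}" for W x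
  proof -
    have "(P (W (\<tau> n)) x - P (W 0) x) / \<tau> n = (W (\<tau> n) x $ 1 - W 0 x $ 1) / \<tau> n + of_real s * ((W (\<tau> n) x $ 2 - W 0 x $ 2) / \<tau> n)" for n
      by (simp add: P_def flux_P_def add_divide_distrib diff_divide_distrib algebra_simps)
    then show ?thesis by (simp only:) (intro convergent_add convergent_mult convergent_const dconv W)
  qed
  have red: "reduced_solution \<kappa> s a (t n) (P (W (\<tau> n))) (Q (W (\<tau> n))) (\<lambda>x. W (\<tau> n) x $ 2) (\<lambda>x. W (\<tau> n) x $ 3)"
    if W: "W \<in> {W1, W2, W3, W4}" for W n
    unfolding P_def Q_def a
    by (rule eigen_solution_reduced[OF kap da]) (use eig[OF W tau(2)] in \<open>simp add: \<tau>_def\<close>)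
  have ds: "R.decaying_solutions t (\<lambda>n. P (W (\<tau> n))) (\<lambda>n. Q (W (\<tau> n))) (\<lambda>n x. W (\<tau> n) x $ 2) (\<lambda>n x. W (\<tau> n) x $ 3)"
    if W: "W \<in> {W1, W2}" for W
  proof -
    have W': "W \<in> {W1, W2, W3, W4}" and l: "(W (\<tau> n) \<longlongrightarrow> 0) at_top" for n using W lim0 by auto
    show ?thesis
      unfolding R.decaying_solutions_def
      using red[OF W'] flux_tendsto_0[OF l a_lim(1)] t convergentI[OF Pconv[OF W']] convergentI[OF Qconv[OF W']] convergentI[OF conv[OF W']]
      by (simp add: P_def Q_def)
  qed
  have ds': "L.decaying_solutions t (\<lambda>n x. P (W (\<tau> n)) (- x)) (\<lambda>n x. - Q (W (\<tau> n)) (- x)) (\<lambda>n x. - (W (\<tau> n) (- x) $ 2)) (\<lambda>n x. W (\<tau> n) (- x) $ 3)"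
    if W: "W \<in> {W3, W4}" for W
  proof -
    have W': "W \<in> {W1, W2, W3, W4}" and l: "(W (\<tau> n) \<longlongrightarrow> 0) at_bot" for n using W lim0 by auto
    have mir: "((\<lambda>x. F (- x)) \<longlongrightarrow> 0) at_top" if "(F \<longlongrightarrow> 0) at_bot" for F :: "real \<Rightarrow> complex"
      using that by (simp add: filterlim_at_bot_mirror)
    note f = flux_tendsto_0[OF l a_lim(2), THEN mir]
    show ?thesis
      unfolding L.decaying_solutions_def
      using reduced_solution_mirror[OF red[OF W']] f tendsto_minus[OF f(2)] tendsto_minus[OF f(3)] t
        convergentI[OF Pconv[OF W']] convergentI[OF tendsto_minus[OF Qconv[OF W']]]
        convergentI[OF conv[OF W']] convergentI[OF tendsto_minus[OF conv[OF W']]]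
      by (simp add: P_def Q_def)
  qed
  define b0 b1 where "b0 = complex_of_real (y1 0)" and "b1 = complex_of_real (y2 0)"
  \<comment> \<open>The integrals over the whole line of the s-derivatives of u and v, pieced
    together at 0 from the two half-line primitives.\<close>
  define mf mg where "mf = complex_of_real (- (f 0 + f' 0))" and "mg = complex_of_real (g' 0 - g 0)"
  define ell where "ell = (\<lambda>W n. R.pairing (t n) (P (W (\<tau> n))) (Q (W (\<tau> n))) (\<lambda>x. W (\<tau> n) x $ 2) (\<lambda>x. W (\<tau> n) x $ 3) 0)"
  define elm where "elm = (\<lambda>W n. L.pairing (t n) (\<lambda>x. P (W (\<tau> n)) (- x)) (\<lambda>x. - Q (W (\<tau> n)) (- x)) (\<lambda>x. - (W (\<tau> n) (- x) $ 2)) (\<lambda>x. W (\<tau> n) (- x) $ 3) 0)"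
  define \<rho> where "\<rho> = (\<lambda>(W :: complex \<Rightarrow> real \<Rightarrow> complex ^ 4) n. b0 * W (\<tau> n) 0 $ 2 + b1 * W (\<tau> n) 0 $ 3)"
  \<comment> \<open>The reflected pairing has the opposite overall sign, and its primitives differ
    by the constants \<open>mf\<close> and \<open>mg\<close>; constants pair with a solution through
    its fluxes alone.\<close>
  have rel: "ell W n = - elm W n + \<tau> n * (mf * P (W (\<tau> n)) 0 - mg * Q (W (\<tau> n)) 0)" for W n
    unfolding ell_def elm_def R.pairing_def L.pairing_def mf_def mg_def \<tau>_def
    by (simp add: algebra_simps)
  have comp0: "W 0 x $ 1 = - of_real s * of_real (y1 x)" "W 0 x $ 2 = of_real (y1 x)" "W 0 x $ 3 = of_real (y2 x)"
    "W 0 x $ 4 = of_real (- ((s\<^sup>2 + a x) * y1 x) / \<kappa>)" if "W = W1 \<or> W = W4" for W x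
    using that W0(1,2) dU by auto
  have k0: "complex_of_real \<kappa> \<noteq> 0" using kap by simp
  have PQ0: "P (W 0) x = 0" "Q (W 0) x = 0" if "W = W1 \<or> W = W4" for W x
  proof -
    have e: "complex_of_real \<kappa> * of_real (- ((s\<^sup>2 + a x) * y1 x) / \<kappa>) = of_real (- ((s\<^sup>2 + a x) * y1 x))"
      using kap by (subst of_real_mult[symmetric]) simp
    show "P (W 0) x = 0" "Q (W 0) x = 0"
      unfolding P_def Q_def flux_P_def flux_Q_def comp0[OF that] e
      by (simp_all add: algebra_simps power2_eq_square)
  qed
  have alim': "(alpha p v \<longlongrightarrow> - c\<^sup>2) at_top" "(alpha p v \<longlongrightarrow> - c\<^sup>2) at_bot" using a_lim unfolding a .
  \<comment> \<open>Thus Q = c P for W2, and Q = -c P for W3 below: each lies in the kernel of the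
    slow mode that is forbidden at its own end.\<close>
  have PQ2: "P (W2 0) 0 = of_real (s - c)" "Q (W2 0) 0 = of_real (c * (s - c))"
    using flux_at_0_constant[OF kap da eig[of W2 0, OF _ Om0] _ alim'(1) W0(3), of 0]
    unfolding P_def Q_def a by (simp_all add: algebra_simps power2_eq_square)
  have PQ3: "P (W3 0) 0 = of_real (s + c)" "Q (W3 0) 0 = of_real (- c * (s + c))"
    using flux_at_0_constant[OF kap da eig[of W3 0, OF _ Om0] _ alim'(2) W0(4), of 0]
    unfolding P_def Q_def a by (simp_all add: algebra_simps power2_eq_square)
  have mem: "W1 \<in> {W1, W2, W3, W4}" "W2 \<in> {W1, W2, W3, W4}" "W3 \<in> {W1, W2, W3, W4}" "W4 \<in> {W1, W2, W3, W4}" by auto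
  have vlim: "(\<lambda>n. W (of_real (t n)) x $ 2) \<longlonglongrightarrow> of_real (y1 x)" "(\<lambda>n. W (of_real (t n)) x $ 3) \<longlonglongrightarrow> of_real (y2 x)"
    "(\<lambda>n. P (W (of_real (t n))) x) \<longlonglongrightarrow> 0" "(\<lambda>n. - (W (of_real (t n)) x $ 2)) \<longlonglongrightarrow> - of_real (y1 x)"
    if W: "W = W1 \<or> W = W4" for W x
  proof -
    have W': "W \<in> {W1, W2, W3, W4}" using W by auto
    show "(\<lambda>n. W (of_real (t n)) x $ 2) \<longlonglongrightarrow> of_real (y1 x)"
      using conv[OF W', of x 2] unfolding comp0[OF W] \<tau>_def .
    then show "(\<lambda>n. - (W (of_real (t n)) x $ 2)) \<longlonglongrightarrow> - of_real (y1 x)" by (rule tendsto_minus)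
    show "(\<lambda>n. W (of_real (t n)) x $ 3) \<longlonglongrightarrow> of_real (y2 x)"
      using conv[OF W', of x 3] unfolding comp0[OF W] \<tau>_def .
    show "(\<lambda>n. P (W (of_real (t n))) x) \<longlonglongrightarrow> 0"
      using Pconv[OF W', of x] unfolding PQ0[OF W] \<tau>_def .
  qed
  \<comment> \<open>First-order terms of the flux P, which exist by analyticity but are not fixed by
    the normalization. The growing-mode lemma expresses those of Q through them.\<close>
  obtain p1 where p1: "(\<lambda>n. P (W1 (\<tau> n)) 0 / \<tau> n) \<longlonglongrightarrow> p1"
    using dPconv[OF mem(1), of 0] PQ0[of W1 0] by (auto simp: convergent_def)
  obtain p4 where p4: "(\<lambda>n. P (W4 (\<tau> n)) 0 / \<tau> n) \<longlonglongrightarrow> p4"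
    using dPconv[OF mem(4), of 0] PQ0[of W4 0] by (auto simp: convergent_def)
  have q1: "(\<lambda>n. Q (W1 (\<tau> n)) 0 / \<tau> n) \<longlonglongrightarrow> of_real ((s - c) * y 0) + of_real c * p1"
  proof -
    have "(\<lambda>n. (Q (W1 (\<tau> n)) 0 - of_real c * P (W1 (\<tau> n)) 0) / \<tau> n) \<longlonglongrightarrow> of_real ((s - c) * y 0)"
      unfolding \<tau>_def
      by (rule R.growing_mode_limit[OF ds[of W1], unfolded \<tau>_def])
        (auto intro: vlim)
    from tendsto_add[OF this tendsto_mult[OF tendsto_const p1, of "of_real c"]]
    show ?thesis by (simp add: diff_divide_distrib)
  qed
  have q4: "(\<lambda>n. Q (W4 (\<tau> n)) 0 / \<tau> n) \<longlonglongrightarrow> of_real ((s + c) * y 0) - of_real c * p4"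
  proof -
    have "(\<lambda>n. (- Q (W4 (\<tau> n)) (- 0) - of_real c * P (W4 (\<tau> n)) (- 0)) / \<tau> n) \<longlonglongrightarrow> of_real ((- s - c) * y (- 0))"
      unfolding \<tau>_def
      by (rule L.growing_mode_limit[OF ds'[of W4], unfolded \<tau>_def])
        (auto intro: vlim)
    from tendsto_minus[OF tendsto_add[OF this tendsto_mult[OF tendsto_const p4, of "of_real c"]]]
    have "(\<lambda>n. Q (W4 (\<tau> n)) 0 / \<tau> n) \<longlonglongrightarrow> - (of_real ((- s - c) * y 0) + of_real c * p4)"
      by (simp add: diff_divide_distrib)
    moreover have "- (of_real ((- s - c) * y 0) + of_real c * p4) = of_real ((s + c) * y 0) - of_real c * p4"
      by (simp add: algebra_simps)
    ultimately show ?thesis by (simp only:)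
  qed
  have l1: "(\<lambda>n. ell W1 n / (\<tau> n)\<^sup>2) \<longlonglongrightarrow> of_real (- (y 0 * (f 0 - s * g 0)) - h 0)"
    unfolding ell_def \<tau>_def of_real_power[symmetric]
    by (rule R.pairing_over_mu_squared[OF ds[of W1], unfolded \<tau>_def])
      (auto intro: vlim)
  have l4: "(\<lambda>n. elm W4 n / (\<tau> n)\<^sup>2) \<longlonglongrightarrow> of_real (- (y (- 0) * (f' 0 - - s * g' 0)) - h' 0)"
    unfolding elm_def \<tau>_def of_real_power[symmetric]
    by (rule L.pairing_over_mu_squared[OF ds'[of W4], unfolded \<tau>_def])
      (auto intro: vlim)
  have l2: "(\<lambda>n. ell W2 n / \<tau> n) \<longlonglongrightarrow> 0"
    unfolding ell_def \<tau>_def by (rule R.pairing_over_mu[OF ds[of W2], unfolded \<tau>_def]) simp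
  have l34: "(\<lambda>n. elm W n / \<tau> n) \<longlonglongrightarrow> 0" if "W \<in> {W3, W4}" for W
    unfolding elm_def \<tau>_def by (rule L.pairing_over_mu[OF ds'[OF that], unfolded \<tau>_def])
  have ellm: "(\<lambda>n. ell W n / \<tau> n) \<longlonglongrightarrow> mf * P (W 0) 0 - mg * Q (W 0) 0" if W: "W \<in> {W3, W4}" for W
  proof -
    have W': "W \<in> {W1, W2, W3, W4}" using W by auto
    have "ell W n / \<tau> n = - (elm W n / \<tau> n) + (mf * P (W (\<tau> n)) 0 - mg * Q (W (\<tau> n)) 0)" for n
      unfolding rel using tau(3)[of n] by (simp add: diff_divide_distrib add_divide_distrib)
    moreover have "(\<lambda>n. - (elm W n / \<tau> n) + (mf * P (W (\<tau> n)) 0 - mg * Q (W (\<tau> n)) 0)) \<longlonglongrightarrow> - 0 + (mf * P (W 0) 0 - mg * Q (W 0) 0)"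
      by (intro tendsto_intros l34 Pconv Qconv W W')
    ultimately show ?thesis by simp
  qed
  \<comment> \<open>The limit of the pairing entry in the difference column: two half-line
    contributions, minus the flux correction needed to express \<open>ell W4\<close> by
    \<open>elm W4\<close>.\<close>
  define LL where "LL = of_real (- (y 0 * (f 0 - s * g 0)) - h 0) + of_real (- (y 0 * (f' 0 + s * g' 0)) - h' 0)
    - (mf * p4 - mg * (of_real ((s + c) * y 0) - of_real c * p4))"
  have l14: "(\<lambda>n. (ell W1 n - ell W4 n) / (\<tau> n)\<^sup>2) \<longlonglongrightarrow> LL"
  proof -
    have "(ell W1 n - ell W4 n) / (\<tau> n)\<^sup>2 = ell W1 n / (\<tau> n)\<^sup>2 + elm W4 n / (\<tau> n)\<^sup>2
       - (mf * (P (W4 (\<tau> n)) 0 / \<tau> n) - mg * (Q (W4 (\<tau> n)) 0 / \<tau> n))" for n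
    proof -
      have alg: "(l - (- e + t * (A - B))) / t\<^sup>2 = l / t\<^sup>2 + e / t\<^sup>2 - (A / t - B / t)" if "t \<noteq> 0" for l e A B t :: complex
        using that by (simp add: field_simps power2_eq_square)
      show ?thesis unfolding rel[of W4] alg[OF tau(3)] by simp
    qed
    moreover have "(\<lambda>n. ell W1 n / (\<tau> n)\<^sup>2 + elm W4 n / (\<tau> n)\<^sup>2
       - (mf * (P (W4 (\<tau> n)) 0 / \<tau> n) - mg * (Q (W4 (\<tau> n)) 0 / \<tau> n))) \<longlonglongrightarrow>
       of_real (- (y 0 * (f 0 - s * g 0)) - h 0) + of_real (- (y (- 0) * (f' 0 - - s * g' 0)) - h' 0)
       - (mf * p4 - mg * (of_real ((s + c) * y 0) - of_real c * p4))"
      by (intro tendsto_intros l1 l4 p4 q4)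
    ultimately show ?thesis by (simp add: LL_def)
  qed
  obtain m where m: "(\<lambda>n. (\<rho> W1 n - \<rho> W4 n) / \<tau> n) \<longlonglongrightarrow> m"
  proof -
    have "(\<rho> W1 n - \<rho> W4 n) / \<tau> n =
      b0 * ((W1 (\<tau> n) 0 $ 2 - W1 0 0 $ 2) / \<tau> n) - b0 * ((W4 (\<tau> n) 0 $ 2 - W4 0 0 $ 2) / \<tau> n)
      + (b1 * ((W1 (\<tau> n) 0 $ 3 - W1 0 0 $ 3) / \<tau> n) - b1 * ((W4 (\<tau> n) 0 $ 3 - W4 0 0 $ 3) / \<tau> n))" for n
      unfolding \<rho>_def comp0[of W1, simplified] comp0[of W4, simplified]
      by (simp add: add_divide_distrib diff_divide_distrib algebra_simps)
    then have "convergent (\<lambda>n. (\<rho> W1 n - \<rho> W4 n) / \<tau> n)"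
      by (simp only:) (intro convergent_add convergent_diff convergent_mult convergent_const dconv mem)
    then show ?thesis using that by (auto simp: convergent_def)
  qed
  have \<rho>lim: "(\<lambda>n. \<rho> W n) \<longlonglongrightarrow> b0 * W 0 0 $ 2 + b1 * W 0 0 $ 3" if "W \<in> {W1, W2, W3, W4}" for W
    unfolding \<rho>_def by (intro tendsto_intros conv that)
  \<comment> \<open>The determinant after replacing column 1 by its difference with column 4 divided
    by \<open>\<tau> n\<close>, and dividing the pairing row by \<open>\<tau> n\<close>.\<close>
  define M where "M = (\<lambda>n. det (matrix4
     ((P (W1 (\<tau> n)) 0 - P (W4 (\<tau> n)) 0) / \<tau> n) (P (W2 (\<tau> n)) 0) (P (W3 (\<tau> n)) 0) (P (W4 (\<tau> n)) 0)
     ((Q (W1 (\<tau> n)) 0 - Q (W4 (\<tau> n)) 0) / \<tau> n) (Q (W2 (\<tau> n)) 0) (Q (W3 (\<tau> n)) 0) (Q (W4 (\<tau> n)) 0)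
     ((ell W1 n - ell W4 n) / (\<tau> n)\<^sup>2) (ell W2 n / \<tau> n) (ell W3 n / \<tau> n) (ell W4 n / \<tau> n)
     ((\<rho> W1 n - \<rho> W4 n) / \<tau> n) (\<rho> W2 n) (\<rho> W3 n) (\<rho> W4 n)))"
  \<comment> \<open>Up to \<kappa>^2 this is the determinant of the row transformation, which has to
    be divided out at the end.\<close>
  define CE where "CE = (\<lambda>n. of_real (y2 0 + t n * w1 0) * b1 + of_real (y1 0 + t n * w 0) * b0)"
  have key: "(of_real \<kappa>)\<^sup>2 * CE n * evans_function W1 W2 W3 W4 (\<tau> n) = (\<tau> n)\<^sup>2 * M n" for n
  proof -
    have 1: "P (W (\<tau> n)) 0 = W (\<tau> n) 0 $ 1 + of_real s * W (\<tau> n) 0 $ 2"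
      "Q (W (\<tau> n)) 0 = - of_real s * W (\<tau> n) 0 $ 1 + of_real (a 0) * W (\<tau> n) 0 $ 2 + of_real \<kappa> * W (\<tau> n) 0 $ 4" for W
      by (simp_all add: P_def Q_def flux_P_def flux_Q_def)
    have "(of_real \<kappa>)\<^sup>2 * CE n * evans_function W1 W2 W3 W4 (\<tau> n) = det (matrix4
      (P (W1 (\<tau> n)) 0) (P (W2 (\<tau> n)) 0) (P (W3 (\<tau> n)) 0) (P (W4 (\<tau> n)) 0)
      (Q (W1 (\<tau> n)) 0) (Q (W2 (\<tau> n)) 0) (Q (W3 (\<tau> n)) 0) (Q (W4 (\<tau> n)) 0)
      (ell W1 n) (ell W2 n) (ell W3 n) (ell W4 n) (\<rho> W1 n) (\<rho> W2 n) (\<rho> W3 n) (\<rho> W4 n))"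
      unfolding evans_function_def CE_def ell_def R.pairing_def \<rho>_def 1
      by (rule det_change_of_rows)
    also have "\<dots> = (\<tau> n)\<^sup>2 * M n"
    proof -
      show ?thesis unfolding M_def det_matrix4_rescale[symmetric]
        using tau(3)[of n] by simp
    qed
    finally show ?thesis .
  qed
  define r2 r3 where "r2 = b0 * W2 0 0 $ 2 + b1 * W2 0 0 $ 3" and "r3 = b0 * W3 0 0 $ 2 + b1 * W3 0 0 $ 3"
  have p4': "P (W4 0) 0 = 0" "Q (W4 0) 0 = 0" using PQ0[of W4 0] by auto
  have Mlim: "M \<longlonglongrightarrow> det (matrix4
     (p1 - p4) (of_real (s - c)) (of_real (s + c)) 0
     (of_real ((s - c) * y 0) + of_real c * p1 - (of_real ((s + c) * y 0) - of_real c * p4)) (of_real (c * (s - c))) (of_real (- c * (s + c))) 0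
     LL 0 (mf * of_real (s + c) - mg * of_real (- c * (s + c))) 0
     m r2 r3 (b0 * b0 + b1 * b1))"
  proof -
    have "(\<lambda>n. (P (W1 (\<tau> n)) 0 - P (W4 (\<tau> n)) 0) / \<tau> n) \<longlonglongrightarrow> p1 - p4"
      using tendsto_diff[OF p1 p4] by (simp add: diff_divide_distrib)
    moreover have "(\<lambda>n. (Q (W1 (\<tau> n)) 0 - Q (W4 (\<tau> n)) 0) / \<tau> n) \<longlonglongrightarrow>
      of_real ((s - c) * y 0) + of_real c * p1 - (of_real ((s + c) * y 0) - of_real c * p4)"
      using tendsto_diff[OF q1 q4] by (simp add: diff_divide_distrib)
    moreover note Pconv[OF mem(2), of 0, unfolded PQ2] Pconv[OF mem(3), of 0, unfolded PQ3] Pconv[OF mem(4), of 0, unfolded p4']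
      Qconv[OF mem(2), of 0, unfolded PQ2] Qconv[OF mem(3), of 0, unfolded PQ3] Qconv[OF mem(4), of 0, unfolded p4']
      l14 l2 ellm[of W3, unfolded PQ3] m \<rho>lim[OF mem(2), folded r2_def] \<rho>lim[OF mem(3), folded r3_def]
    moreover have "(\<lambda>n. ell W4 n / \<tau> n) \<longlonglongrightarrow> 0" using ellm[of W4] p4' by simp
    moreover have "\<rho> W4 \<longlonglongrightarrow> b0 * b0 + b1 * b1" using \<rho>lim[OF mem(4)] comp0[of W4 0] by (simp add: b0_def b1_def)
    ultimately show ?thesis
      unfolding M_def det_matrix4 by (intro tendsto_intros) simp_all
  qed
  \<comment> \<open>Common limit of \<open>CE\<close> and of the functional \<rho> on the profile
    derivative. It is positive by \<open>nondeg\<close> and drops out of the final quotient.\<close>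
  define N where "N = (y1 0)\<^sup>2 + (y2 0)\<^sup>2"
  have N0: "N \<noteq> 0" using nondeg by (auto simp: N_def sum_power2_eq_zero_iff)
  have CElim: "CE \<longlonglongrightarrow> of_real N"
  proof -
    have "CE \<longlonglongrightarrow> of_real (y2 0 + 0 * w1 0) * b1 + of_real (y1 0 + 0 * w 0) * b0"
      unfolding CE_def by (intro tendsto_intros t(2))
    then show ?thesis by (simp add: N_def b0_def b1_def power2_eq_square add.commute)
  qed
  \<comment> \<open>The last column is (0, 0, 0, N), leaving a 3 by 3 minor. There \<open>p1\<close>
    cancels between the two flux rows; the remaining terms in \<open>p4\<close>, \<open>y 0\<close>,
    \<open>mf\<close> and \<open>mg\<close> cancel against those of \<open>LL\<close>, so only -(h 0
    + h' 0) is left.\<close>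
  have det_value: "det (matrix4
     (p1 - p4) (of_real (s - c)) (of_real (s + c)) 0
     (of_real ((s - c) * y 0) + of_real c * p1 - (of_real ((s + c) * y 0) - of_real c * p4)) (of_real (c * (s - c))) (of_real (- c * (s + c))) 0
     LL 0 (mf * of_real (s + c) - mg * of_real (- c * (s + c))) 0
     m r2 r3 (b0 * b0 + b1 * b1)) = of_real (2 * c * (s\<^sup>2 - c\<^sup>2) * (h 0 + h' 0)) * of_real N"
    unfolding det_matrix4 LL_def mf_def mg_def N_def b0_def b1_def
    by (simp add: algebra_simps power2_eq_square)
  have "(\<lambda>n. M n / ((of_real \<kappa>)\<^sup>2 * CE n)) \<longlonglongrightarrow> of_real (2 * c * (s\<^sup>2 - c\<^sup>2) * (h 0 + h' 0)) * of_real N / ((of_real \<kappa>)\<^sup>2 * of_real N)"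
    by (intro tendsto_intros CElim Mlim[unfolded det_value]) (use N0 k0 in auto)
  also have "of_real (2 * c * (s\<^sup>2 - c\<^sup>2) * (h 0 + h' 0)) * of_real N / ((of_real \<kappa>)\<^sup>2 * of_real N)
     = complex_of_real (2 * c * (s\<^sup>2 - c\<^sup>2) / \<kappa>\<^sup>2 * (h 0 + h' 0))" using N0 by simp
  finally have Dlim': "(\<lambda>n. M n / ((of_real \<kappa>)\<^sup>2 * CE n)) \<longlonglongrightarrow> complex_of_real (2 * c * (s\<^sup>2 - c\<^sup>2) / \<kappa>\<^sup>2 * (h 0 + h' 0))" .
  have "\<forall>\<^sub>F n in sequentially. CE n \<noteq> 0"
    by (rule tendsto_imp_eventually_ne[OF CElim]) (use N0 in simp)
  then have "\<forall>\<^sub>F n in sequentially. M n / ((of_real \<kappa>)\<^sup>2 * CE n) = evans_function W1 W2 W3 W4 (\<tau> n) / (\<tau> n)\<^sup>2"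
  proof eventually_elim
    case (elim n)
    then show ?case using key[of n] tau(3)[of n] k0 by (simp add: divide_eq_eq eq_divide_eq mult_ac)
  qed
  then have Dlim: "(\<lambda>n. evans_function W1 W2 W3 W4 (\<tau> n) / (\<tau> n)\<^sup>2) \<longlonglongrightarrow> complex_of_real (2 * c * (s\<^sup>2 - c\<^sup>2) / \<kappa>\<^sup>2 * (h 0 + h' 0))"
    using Dlim' tendsto_cong by fastforce
  have an0: "(\<lambda>\<mu>. W \<mu> 0 $ i) analytic_on {0}" if "W \<in> {W1, W2, W3, W4}" for W i
    by (rule analytic_on_subset[OF anal[OF that]]) (use Om0 in simp)
  have "evans_function W1 W2 W3 W4 analytic_on {0}"
    unfolding evans_function_def[abs_def] det_4 transpose_def vec_lambda_beta vector_4_nth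
    by (intro analytic_intros an0 mem)
  from second_derivative_from_sequence[OF this tau(4,3) Dlim] show ?thesis unfolding T by simp
qed

end

section \<open>Soliton profiles\<close>


text \<open>Small first differences give points where the increment of f1 over a unit interval is
  small; by the mean value theorem that increment is a value of f2 further out.\<close>

lemma second_derivative_limit_zero:
  fixes f f1 f2 :: "real \<Rightarrow> real"
  assumes d: "\<And>x. (f has_real_derivative f1 x) (at x)" "\<And>x. (f1 has_real_derivative f2 x) (at x)"
    and lim: "(f \<longlongrightarrow> A) at_top" "(f2 \<longlongrightarrow> L) at_top"
  shows "L = 0"
proof -
  have dg: "((\<lambda>x. f (x + 1) - f x) has_real_derivative f1 (x + 1) - f1 x) (at x)" for x
    using d(1)[of "x + 1"] d(1)[of x] by (auto intro!: derivative_eq_intros simp: DERIV_shift)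
  have "((\<lambda>x. f (x + 1) - f x) \<longlongrightarrow> A - A) at_top"
    by (intro tendsto_intros lim filterlim_compose[OF lim(1)] filterlim_tendsto_add_at_top[OF tendsto_const filterlim_ident, of 1, simplified add.commute])
  then obtain \<xi> where xi: "filterlim \<xi> at_top sequentially" "(\<lambda>n. f1 (\<xi> n + 1) - f1 (\<xi> n)) \<longlonglongrightarrow> 0"
    using small_derivative_sequence[OF dg] by blast
  have "\<exists>z. \<xi> n < z \<and> f1 (\<xi> n + 1) - f1 (\<xi> n) = f2 z" for n
    using MVT2[of "\<xi> n" "\<xi> n + 1" f1 f2] d(2) by auto
  then obtain z where z: "\<And>n. \<xi> n < z n" "\<And>n. f1 (\<xi> n + 1) - f1 (\<xi> n) = f2 (z n)" by metis
  have "filterlim z at_top sequentially"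
    by (rule filterlim_at_top_mono[OF xi(1)]) (use z(1) in \<open>auto intro!: always_eventually less_imp_le\<close>)
  from filterlim_compose[OF lim(2) this] have "(\<lambda>n. f2 (z n)) \<longlonglongrightarrow> L" .
  moreover have "(\<lambda>n. f2 (z n)) \<longlonglongrightarrow> 0" using xi(2) z(2) by simp
  ultimately show ?thesis by (rule LIMSEQ_unique)
qed

lemma constant_limit:
  fixes f :: "real \<Rightarrow> real"
  assumes "\<And>x. (f has_real_derivative 0) (at x)" "(f \<longlongrightarrow> L) at_top"
  shows "f x = L"
proof -
  have "f t = f x" for t by (rule DERIV_isconst_all) (use assms(1) in blast)
  then have "f = (\<lambda>_. f x)" by auto
  then have "((\<lambda>_. f x) \<longlongrightarrow> L) (at_top :: real filter)" using assms(2) by simp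
  from tendsto_unique[OF _ tendsto_const this] show ?thesis by simp
qed

text \<open>Each equation is integrated once. The first constant comes directly from the endstates;
  for the second, the second derivative of v is seen to converge, and its limit must be 0.\<close>

lemma soliton_profile_ode:
  assumes p: "smooth_on UNIV p" and kap: "\<kappa> > 0" and prof: "soliton_profile p \<kappa> vinf uinf s v u"
  shows "u x = uinf - s * (v x - vinf)" "deriv u x = - s * deriv v x"
    "deriv (deriv v) x = - (s\<^sup>2 * (v x - vinf) + (p (v x) - p vinf)) / \<kappa>"
    "\<exists>x. v x \<noteq> vinf"
proof -
  have sv: "smooth_on UNIV v" and su: "smooth_on UNIV u" and nc: "\<not> (\<lambda>x. (v x, u x)) constant_on UNIV"
    and sol: "korteweg_solution p \<kappa> (\<lambda>x t. v (x - s * t)) (\<lambda>x t. u (x - s * t))"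
    and lim: "(v \<longlongrightarrow> vinf) at_top" "(u \<longlongrightarrow> uinf) at_top"
    using prof unfolding soliton_profile_def by auto
  note dv = smooth_on_real_deriv(1)[OF sv] and dv2 = smooth_on_real_deriv(1)[OF smooth_on_real_deriv(2)[OF sv]]
    and dv3 = smooth_on_real_deriv(1)[OF smooth_on_real_deriv(2)[OF smooth_on_real_deriv(2)[OF sv]]]
    and du = smooth_on_real_deriv(1)[OF su] and dp = smooth_on_real_deriv(1)[OF p]
  have t_deriv: "deriv (\<lambda>t. F (x - s * t)) 0 = - s * deriv F x" if "\<And>x. (F has_real_derivative deriv F x) (at x)" for F x
  proof -
    have "((\<lambda>t. x - s * t) has_real_derivative - s) (at 0)" by (auto intro!: derivative_eq_intros)
    from DERIV_chain2[OF _ this, of F "deriv F x"] that[of x]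
    have "((\<lambda>t. F (x - s * t)) has_real_derivative deriv F x * - s) (at 0)" by simp
    from DERIV_imp_deriv[OF this] show ?thesis by simp
  qed
  have dpv: "((\<lambda>x. p (v x)) has_real_derivative deriv p (v x) * deriv v x) (at x)" for x
    by (rule DERIV_chain2[OF dp dv])
  \<comment> \<open>Time 0 suffices: there the moving coordinate equals x, and time derivatives
    become -s times x derivatives.\<close>
  have "deriv (\<lambda>\<tau>. v (x - s * \<tau>)) 0 - deriv (\<lambda>\<xi>. u (\<xi> - s * 0)) x = 0"
    and "deriv (\<lambda>\<tau>. u (x - s * \<tau>)) 0 + deriv (\<lambda>\<xi>. p (v (\<xi> - s * 0))) x = - \<kappa> * (deriv ^^ 3) (\<lambda>\<xi>. v (\<xi> - s * 0)) x" for x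
    using sol unfolding korteweg_solution_def by blast+
  then have e1: "deriv u x = - s * deriv v x"
    and e2: "- s * deriv u x + deriv p (v x) * deriv v x = - \<kappa> * deriv (deriv (deriv v)) x" for x
    by (simp_all add: t_deriv[OF dv] t_deriv[OF du] DERIV_imp_deriv[OF dpv] numeral_3_eq_3)
  show "deriv u x = - s * deriv v x" by (rule e1)
  have uv: "u x + s * v x = uinf + s * vinf" for x
  proof (rule constant_limit[of "\<lambda>x. u x + s * v x"])
    show "((\<lambda>x. u x + s * v x) has_real_derivative 0) (at x)" for x
      using DERIV_add[OF du[of x] DERIV_cmult[OF dv[of x], of s]] e1[of x] by simp
    show "((\<lambda>x. u x + s * v x) \<longlongrightarrow> uinf + s * vinf) at_top" by (intro tendsto_intros lim)
  qed
  then show "u x = uinf - s * (v x - vinf)" by (simp add: algebra_simps)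
  have c0: "\<kappa> * deriv (deriv v) x + p (v x) - s * u x = \<kappa> * deriv (deriv v) 0 + p (v 0) - s * u 0" for x
  proof (rule DERIV_isconst_all[of "\<lambda>x. \<kappa> * deriv (deriv v) x + p (v x) - s * u x"], rule allI)
    fix x
    have "((\<lambda>x. \<kappa> * deriv (deriv v) x + p (v x) - s * u x) has_real_derivative
       \<kappa> * deriv (deriv (deriv v)) x + deriv p (v x) * deriv v x - s * deriv u x) (at x)"
      by (intro DERIV_diff DERIV_add DERIV_cmult dv3 dpv du)
    then show "((\<lambda>x. \<kappa> * deriv (deriv v) x + p (v x) - s * u x) has_real_derivative 0) (at x)"
      using e2[of x] by (simp add: algebra_simps)
  qed
  define C where "C = \<kappa> * deriv (deriv v) 0 + p (v 0) - s * u 0"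
  have v2: "deriv (deriv v) x = (C - p (v x) + s * u x) / \<kappa>" for x
    using c0[of x] kap unfolding C_def[symmetric] by (simp add: field_simps)
  have "isCont p vinf" using DERIV_isCont[OF dp] .
  then have pv: "((\<lambda>x. p (v x)) \<longlongrightarrow> p vinf) at_top" using isCont_tendsto_compose lim(1) by blast
  have "((\<lambda>x. (C - p (v x) + s * u x) / \<kappa>) \<longlongrightarrow> (C - p vinf + s * uinf) / \<kappa>) at_top"
    using kap by (intro tendsto_intros pv lim) auto
  then have "(deriv (deriv v) \<longlongrightarrow> (C - p vinf + s * uinf) / \<kappa>) at_top"
    by (rule Lim_transform_eventually) (simp add: v2)
  from second_derivative_limit_zero[OF dv dv2 lim(1) this] have "C = p vinf - s * uinf"
    using kap by simp
  then have "deriv (deriv v) x = (p vinf - p (v x) + s * (u x - uinf)) / \<kappa>"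
    using v2[of x] by (simp add: algebra_simps)
  also have "u x - uinf = - s * (v x - vinf)" using uv[of x] by (simp add: algebra_simps)
  finally show "deriv (deriv v) x = - (s\<^sup>2 * (v x - vinf) + (p (v x) - p vinf)) / \<kappa>"
    by (simp add: algebra_simps power2_eq_square)
  show "\<exists>x. v x \<noteq> vinf"
  proof (rule ccontr)
    assume "\<not> ?thesis"
    then have "v x = vinf" for x by simp
    moreover from this have "u x = uinf" for x using uv[of x] by simp
    ultimately show False using nc by (auto simp: constant_on_def)
  qed
qed

text \<open>The margin 1 on both sides makes the upper limit an interior point whichever side of
  \<open>b\<close> it lies on.\<close>

lemma has_derivative_LBINT_upper:
  fixes f :: "real \<Rightarrow> real"
  assumes "continuous_on UNIV f"
  shows "((\<lambda>z. LBINT t=ereal b..ereal (b + z). f t) has_real_derivative f (b + z)) (at z)"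
proof -
  define l r where "l = min b (b + z) - 1" and "r = max b (b + z) + 1"
  have lr: "l \<le> b" "b \<le> r" "l < b + z" "b + z < r" by (auto simp: l_def r_def)
  have "((\<lambda>u. LBINT t=ereal b..ereal u. f t) has_vector_derivative f (b + z)) (at (b + z) within {l..r})"
    by (rule interval_integral_FTC2[OF lr(1,2)]) (use lr assms in \<open>auto intro: continuous_on_subset\<close>)
  moreover have "at (b + z) within {l..r} = at (b + z)" by (rule at_within_interior) (use lr in simp)
  ultimately have "((\<lambda>u. LBINT t=ereal b..ereal u. f t) has_real_derivative f (b + z)) (at (b + z))"
    by (simp add: has_real_derivative_iff_has_vector_derivative)
  moreover have "((\<lambda>z. b + z) has_real_derivative 1) (at z)" by (auto intro!: derivative_eq_intros)
  ultimately show ?thesis using DERIV_chain2[of "\<lambda>u. LBINT t=ereal b..ereal u. f t" "f (b + z)" "\<lambda>z. b + z" z 1 UNIV] by simp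
qed

theorem theorem1p2:
  fixes p :: "real \<Rightarrow> real" and \<kappa> vinf uinf sbar \<delta> :: real
    and vbar ubar :: "real \<Rightarrow> real" and vs us :: "real \<Rightarrow> real \<Rightarrow> real"
  assumes "smooth_on UNIV p" and "\<kappa> > 0"
    and profile: "soliton_profile p \<kappa> vinf uinf sbar vbar ubar"
    and saddle: "sbar\<^sup>2 + deriv p vinf < 0"
    and family: "soliton_family p \<kappa> vinf uinf sbar \<delta> vs us"
    and through: "vs sbar = vbar" "us sbar = ubar"
  shows "\<exists>c::real. c \<noteq> 0 \<and>
    (\<forall>r W1 W2 W3 W4. evans_basis p \<kappa> vinf sbar vbar ubar r W1 W2 W3 W4 \<longrightarrow>
       (deriv ^^ 2) (evans_function W1 W2 W3 W4) 0 =
         of_real (c * (deriv ^^ 2) (moment_of_instability p \<kappa> vinf uinf vs us) sbar))"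
proof -
  note p = \<open>smooth_on UNIV p\<close> and kap = \<open>\<kappa> > 0\<close>
  define c where "c = sqrt (- deriv p vinf)"
  have dpneg: "sbar\<^sup>2 < - deriv p vinf" using saddle by linarith
  then have c2: "c\<^sup>2 = - deriv p vinf" unfolding c_def by (intro real_sqrt_pow2) (use zero_le_power2[of sbar] in linarith)
  have c0: "c > 0" unfolding c_def by (rule real_sqrt_gt_zero) (use dpneg zero_le_power2[of sbar] in linarith)
  have sc: "\<bar>sbar\<bar> < c" by (rule power2_less_imp_less) (use dpneg c2 c0 in auto)
  define I where "I = {sbar - \<delta><..<sbar + \<delta>}"
  define V where "V = (\<lambda>(s, x). vs s x)"
  have del: "\<delta> > 0" and smV: "smooth_on (I \<times> UNIV) V"
    and prof: "\<And>s. s \<in> I \<Longrightarrow> soliton_profile p \<kappa> vinf uinf s (vs s) (us s)"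
    using family unfolding soliton_family_def I_def V_def by auto
  note ode = soliton_profile_ode[OF p kap prof]
  note V1 = smooth_on_partials[OF smV] and V2 = smooth_on_partials[OF smooth_on_partials(2)[OF smV]]
  define g where "g = (\<lambda>z. p (vinf + z) - p vinf)"
  define g' where "g' = (\<lambda>z. deriv p (vinf + z))"
  define g'' where "g'' = (\<lambda>z. deriv (deriv p) (vinf + z))"
  define G where "G = (\<lambda>z. LBINT t=ereal vinf..ereal (vinf + z). (p t - p vinf))"
  define y where "y = (\<lambda>s x. vs s x - vinf)"
  define y1 where "y1 = (\<lambda>s x. partial2 V (s, x))"
  define w where "w = (\<lambda>s x. partial1 V (s, x))"
  define w1 where "w1 = (\<lambda>s x. partial1 (partial2 V) (s, x))"
  have smv: "smooth_on UNIV (vs s)" if "s \<in> I" for s using prof[OF that] by (simp add: soliton_profile_def)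
  have dvs: "deriv (vs s) = y1 s" if "s \<in> I" for s
  proof
    fix x
    have "((\<lambda>x. V (s, x)) has_real_derivative y1 s x) (at x)"
      unfolding y1_def by (rule V1(5)) (use that in simp)
    then have "(vs s has_real_derivative y1 s x) (at x)" by (simp add: V_def)
    then show "deriv (vs s) x = y1 s x" by (rule DERIV_imp_deriv)
  qed
  have dy1: "(y s has_real_derivative y1 s x) (at x)" if "s \<in> I" for s x
    unfolding y_def using DERIV_diff[OF smooth_on_real_deriv(1)[OF smv[OF that], of x] DERIV_const[of vinf]] dvs[OF that] by simp
  have y2: "deriv (y1 s) x = - (s\<^sup>2 * y s x + g (y s x)) / \<kappa>" if "s \<in> I" for s x
    using ode(3)[OF that, of x] dvs[OF that] by (simp add: y_def g_def)
  have dy2: "(y1 s has_real_derivative - (s\<^sup>2 * y s x + g (y s x)) / \<kappa>) (at x)" if "s \<in> I" for s x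
    using smooth_on_real_deriv(1)[OF smooth_on_real_deriv(2)[OF smv[OF that]], of x] y2[OF that, of x] dvs[OF that] by simp
  have dg: "(g has_real_derivative g' z) (at z)" "(g' has_real_derivative g'' z) (at z)" for z
  proof -
    have sh: "((\<lambda>z. vinf + z) has_real_derivative 1) (at z)" by (auto intro!: derivative_eq_intros)
    have "((\<lambda>z. p (vinf + z)) has_real_derivative deriv p (vinf + z) * 1) (at z)"
      by (rule DERIV_chain2[OF smooth_on_real_deriv(1)[OF p] sh])
    from DERIV_diff[OF this DERIV_const[of "p vinf"]]
    show "(g has_real_derivative g' z) (at z)" by (simp add: g_def g'_def)
    have "((\<lambda>z. deriv p (vinf + z)) has_real_derivative deriv (deriv p) (vinf + z) * 1) (at z)"
      by (rule DERIV_chain2[OF smooth_on_real_deriv(1)[OF smooth_on_real_deriv(2)[OF p]] sh])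
    then show "(g' has_real_derivative g'' z) (at z)" by (simp add: g''_def g'_def)
  qed
  have cg: "continuous_on A g'" "continuous_on A g''" for A
    unfolding g'_def g''_def
    by (rule continuous_on_compose2[OF smooth_on_real_deriv(3)[OF smooth_on_real_deriv(2)[OF p]]], auto intro!: continuous_intros)
      (rule continuous_on_compose2[OF smooth_on_real_deriv(3)[OF smooth_on_real_deriv(2)[OF smooth_on_real_deriv(2)[OF p]]]], auto intro!: continuous_intros)
  have sI: "sbar \<in> I" using del by (simp add: I_def)
  interpret F: homoclinic_family \<kappa> sbar \<delta> g g' G y y1 w w1 I
  proof
    show "(G has_real_derivative g z) (at z)" for z
      unfolding G_def g_def
      by (rule has_derivative_LBINT_upper[of "\<lambda>t. p t - p vinf"])
        (intro continuous_intros smooth_on_real_deriv(3)[OF p])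
    show "G 0 = 0" "g 0 = 0" by (simp_all add: G_def g_def)
    show "sbar\<^sup>2 + g' 0 < 0" using saddle by (simp add: g'_def)
    show "(w s has_real_derivative w1 s x) (at x)" if "s \<in> I" for s x
      using mixed_partials[OF smV[unfolded I_def] that[unfolded I_def], of x] by (simp add: w_def[abs_def] w1_def)
    show "((\<lambda>s. y s x) has_real_derivative w s x) (at s)" if "s \<in> I" for s x
      using DERIV_diff[OF V1(4)[of s x] DERIV_const[of vinf]] that by (simp add: y_def w_def V_def)
    show "((\<lambda>s. y1 s x) has_real_derivative w1 s x) (at s)" if "s \<in> I" for s x
      using V2(4)[of s x] that by (simp add: y1_def w1_def)
    have "continuous_on (I \<times> UNIV) (\<lambda>z. V z - vinf)" by (intro continuous_intros V1(3))
    then show "continuous_on (I \<times> UNIV) (\<lambda>(s, x). y s x)" by (simp add: y_def V_def case_prod_beta)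
    show "continuous_on (I \<times> UNIV) (\<lambda>(s, x). y1 s x)" using V2(3) by (simp add: y1_def case_prod_eta)
    show "continuous_on (I \<times> UNIV) (\<lambda>(s, x). w s x)" using smooth_on_partials(3)[OF V1(1)] by (simp add: w_def case_prod_eta)
    show "continuous_on (I \<times> UNIV) (\<lambda>(s, x). w1 s x)" using smooth_on_partials(3)[OF V2(1)] by (simp add: w1_def case_prod_eta)
    show "(y s \<longlongrightarrow> 0) at_top" "(y s \<longlongrightarrow> 0) at_bot" if "s \<in> I" for s
    proof -
      have "(vs s \<longlongrightarrow> vinf) at_top" "(vs s \<longlongrightarrow> vinf) at_bot" using prof[OF that] by (simp_all add: soliton_profile_def)
      from this[THEN LIM_zero] show "(y s \<longlongrightarrow> 0) at_top" "(y s \<longlongrightarrow> 0) at_bot" by (simp_all add: y_def)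
    qed
    show "\<exists>x. y sbar x \<noteq> 0" using ode(4)[OF sI] by (simp add: y_def)
    show "\<kappa> > 0" "\<delta> > 0" by (rule kap, rule del)
    show "I = {sbar - \<delta><..<sbar + \<delta>}" by (rule I_def)
    show "(g has_real_derivative g' z) (at z)" for z by (rule dg(1))
    show "continuous_on UNIV g'" by (rule cg(1))
    show "(y s has_real_derivative y1 s x) (at x)" if "s \<in> I" for s x by (rule dy1[OF that])
    show "(y1 s has_real_derivative - (s\<^sup>2 * y s x + g (y s x)) / \<kappa>) (at x)" if "s \<in> I" for s x by (rule dy2[OF that])
  qed
  obtain d where d: "d > 0" "d < \<delta>"
    and int: "\<And>s. \<bar>s - sbar\<bar> \<le> d \<Longrightarrow> integrable lborel (\<lambda>x. (y s x)\<^sup>2) \<and> integrable lborel (\<lambda>x. (y1 s x)\<^sup>2)"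
    and D1: "\<And>s. \<bar>s - sbar\<bar> < d \<Longrightarrow> ((\<lambda>s. \<kappa> * (\<integral>x. (y1 s x)\<^sup>2 \<partial>lborel)) has_real_derivative - s * (\<integral>x. (y s x)\<^sup>2 \<partial>lborel)) (at s)"
    and D2: "((\<lambda>s. - s * (\<integral>x. (y s x)\<^sup>2 \<partial>lborel)) has_real_derivative - (\<integral>x. 2 * sbar * y sbar x * w sbar x + (y sbar x)\<^sup>2 \<partial>lborel)) (at sbar)"
    by (rule F.second_derivative_of_kinetic_integral) (rule that; assumption)
  define m where "m = moment_of_instability p \<kappa> vinf uinf vs us"
  have moment: "m s = \<kappa> * (\<integral>x. (y1 s x)\<^sup>2 \<partial>lborel)" if s: "\<bar>s - sbar\<bar> < d" for s
  proof -
    have sI': "s \<in> I" using s d by (auto simp: I_def abs_less_iff)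
    have i: "integrable lborel (\<lambda>x. (y s x)\<^sup>2)" "integrable lborel (\<lambda>x. (y1 s x)\<^sup>2)" using int[of s] s by auto
    have u: "us s x - uinf = - s * y s x" for x using ode(1)[OF sI', of x] by (simp add: y_def)
    \<comment> \<open>The energy identity replaces the potential by the two quadratic terms. The s^2
      y^2 contribution is then cancelled by s times the momentum, leaving the gradient term
      only.\<close>
    have e: "(us s x - uinf)\<^sup>2 / 2 - (LBINT z = ereal vinf..ereal (vs s x). (p z - p vinf)) + \<kappa> * (deriv (vs s) x)\<^sup>2 / 2
       = s\<^sup>2 * (y s x)\<^sup>2 + \<kappa> * (y1 s x)\<^sup>2" for x
    proof -
      have "G (y s x) = (LBINT z = ereal vinf..ereal (vs s x). (p z - p vinf))" by (simp add: G_def y_def)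
      then show ?thesis using F.energy_zero[OF sI', of x] unfolding u dvs[OF sI'] by (simp add: power_mult_distrib)
    qed
    have "energy p \<kappa> vinf uinf (vs s) (us s) = s\<^sup>2 * (\<integral>x. (y s x)\<^sup>2 \<partial>lborel) + \<kappa> * (\<integral>x. (y1 s x)\<^sup>2 \<partial>lborel)"
      unfolding energy_def e using i by simp
    moreover have "momentum vinf uinf (vs s) (us s) = - s * (\<integral>x. (y s x)\<^sup>2 \<partial>lborel)"
    proof -
      have "(us s x - uinf) * (vs s x - vinf) = - s * (y s x)\<^sup>2" for x
        unfolding u by (simp add: y_def power2_eq_square)
      then show ?thesis unfolding momentum_def by simp
    qed
    ultimately show ?thesis by (simp add: m_def moment_of_instability_def power2_eq_square)
  qed
  \<comment> \<open>The formula for the moment holds only near \<open>sbar\<close>; an open interval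
    lets derivatives be transferred to it.\<close>
  define J where "J = {sbar - d<..<sbar + d}"
  have J: "open J" "sbar \<in> J" "\<And>s. s \<in> J \<Longrightarrow> \<bar>s - sbar\<bar> < d" using d by (auto simp: J_def)
  have m1: "deriv m s = - s * (\<integral>x. (y s x)\<^sup>2 \<partial>lborel)" if s: "s \<in> J" for s
    by (rule DERIV_imp_deriv, rule has_field_derivative_transform_within_open[OF D1[OF J(3)[OF s]] J(1) s])
      (rule moment[OF J(3), symmetric])
  have m2: "(deriv ^^ 2) m sbar = - (\<integral>x. 2 * sbar * y sbar x * w sbar x + (y sbar x)\<^sup>2 \<partial>lborel)"
  proof -
    have "(deriv m has_real_derivative - (\<integral>x. 2 * sbar * y sbar x * w sbar x + (y sbar x)\<^sup>2 \<partial>lborel)) (at sbar)"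
      by (rule has_field_derivative_transform_within_open[OF D2 J(1,2)]) (rule m1[symmetric])
    from DERIV_imp_deriv[OF this] show ?thesis by (simp add: numeral_2_eq_2)
  qed
  obtain dd C k where k: "0 < k" and C0: "C \<ge> 0" and dd: "0 < dd"
    and le: "\<And>s x. \<bar>s - sbar\<bar> \<le> dd \<Longrightarrow> \<bar>y s x\<bar> \<le> C * exp (- (k * \<bar>x\<bar>))"
    "\<And>s x. \<bar>s - sbar\<bar> \<le> dd \<Longrightarrow> \<bar>y1 s x\<bar> \<le> C * exp (- (k * \<bar>x\<bar>))"
    "\<And>s x. \<bar>s - sbar\<bar> \<le> dd \<Longrightarrow> \<bar>w s x\<bar> \<le> C * exp (- (k * \<bar>x\<bar>))"
    "\<And>s x. \<bar>s - sbar\<bar> \<le> dd \<Longrightarrow> \<bar>w1 s x\<bar> \<le> C * exp (- (k * \<bar>x\<bar>))"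
    by (rule F.decay) (rule that; assumption)
  define y2 where "y2 = (\<lambda>x. - (sbar\<^sup>2 * y sbar x + g (y sbar x)) / \<kappa>)"
  define a where "a = alpha p vbar"
  have a: "a x = g' (y sbar x)" for x by (simp add: a_def alpha_def g'_def y_def through)
  have da: "(a has_real_derivative g'' (y sbar x) * y1 sbar x) (at x)" for x
    using DERIV_chain2[OF dg(2) dy1[OF sI]] a by (simp add: fun_eq_iff[symmetric] a[abs_def])
  have da': "(alpha p vbar has_real_derivative deriv (alpha p vbar) x) (at x)" for x
    using da[of x] DERIV_imp_deriv[OF da[of x]] unfolding a_def by simp
  have dy3: "(y2 has_real_derivative - ((sbar\<^sup>2 + a x) * y1 sbar x) / \<kappa>) (at x)" for x
  proof -
    have "((\<lambda>x. g (y sbar x)) has_real_derivative g' (y sbar x) * y1 sbar x) (at x)"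
      by (rule DERIV_chain2[OF dg(1) dy1[OF sI]])
    then show ?thesis unfolding y2_def a
      using kap by (auto intro!: derivative_eq_intros dy1[OF sI] simp: field_simps)
  qed
  have dw2: "(w1 sbar has_real_derivative - ((sbar\<^sup>2 + a x) * w sbar x + 2 * sbar * y sbar x) / \<kappa>) (at x)" for x
  proof -
    note V3 = smooth_on_partials[OF V2(2)]
    \<comment> \<open>The profile equation holds for all speeds in \<open>I\<close> and may be
      differentiated in s at \<open>sbar\<close>; interchanging partials then gives the equation for
      \<open>w1\<close>.\<close>
    have eq: "partial2 (partial2 V) (s, x) = - (s\<^sup>2 * y s x + g (y s x)) / \<kappa>" if "s \<in> I" for s
      using DERIV_unique[OF V2(5)[of s x] dy2[OF that, of x, unfolded y1_def]] that by simp
    have "((\<lambda>s. partial2 (partial2 V) (s, x)) has_real_derivative partial1 (partial2 (partial2 V)) (sbar, x)) (at sbar)"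
      by (rule V3(4)) (use sI in simp)
    then have "((\<lambda>s. - (s\<^sup>2 * y s x + g (y s x)) / \<kappa>) has_real_derivative partial1 (partial2 (partial2 V)) (sbar, x)) (at sbar)"
      by (rule has_field_derivative_transform_within_open[OF _ F.open_I sI]) (rule eq)
    moreover have "((\<lambda>s. - (s\<^sup>2 * y s x + g (y s x)) / \<kappa>) has_real_derivative - ((sbar\<^sup>2 + a x) * w sbar x + 2 * sbar * y sbar x) / \<kappa>) (at sbar)"
    proof -
      have "((\<lambda>s. g (y s x)) has_real_derivative g' (y sbar x) * w sbar x) (at sbar)"
        by (rule DERIV_chain2[OF dg(1) F.ds(1)[OF sI]])
      then show ?thesis unfolding a
        using kap by (auto intro!: derivative_eq_intros F.ds(1)[OF sI] simp: field_simps)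
    qed
    ultimately have "partial1 (partial2 (partial2 V)) (sbar, x) = - ((sbar\<^sup>2 + a x) * w sbar x + 2 * sbar * y sbar x) / \<kappa>"
      by (rule DERIV_unique)
    then show ?thesis
      using mixed_partials[OF smooth_on_partials(2)[OF smV, unfolded I_def] sI[unfolded I_def], of x]
      by (simp add: w1_def[abs_def])
  qed
  have ydC: "\<bar>y sbar x\<bar> \<le> C" for x
  proof -
    have "C * exp (- (k * \<bar>x\<bar>)) \<le> C * 1" using C0 k by (intro mult_left_mono) auto
    then show ?thesis using le(1)[of sbar x] dd by simp
  qed
  have cpt: "\<exists>B. \<forall>t\<in>{-C..C}. \<bar>q t\<bar> \<le> B" if "continuous_on {-C..C} q" for q :: "real \<Rightarrow> real"
  proof -
    have "compact (q ` {-C..C})" by (intro compact_continuous_image that) simp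
    then show ?thesis using compact_imp_bounded bounded_iff by (metis image_eqI real_norm_def)
  qed
  obtain B1 where B1: "\<And>t. t \<in> {-C..C} \<Longrightarrow> \<bar>g' t\<bar> \<le> B1" using cpt[OF cg(1)] by blast
  obtain B2 where B2: "\<And>t. t \<in> {-C..C} \<Longrightarrow> \<bar>g'' t\<bar> \<le> B2" using cpt[OF cg(2)] by blast
  have B0: "0 \<le> B1" "0 \<le> B2" using B1[of 0] B2[of 0] C0 by auto
  have gle: "\<bar>g (y sbar x)\<bar> \<le> B1 * \<bar>y sbar x\<bar>" for x
    by (rule abs_le_deriv_bound[OF dg(1) F.g(2)]) (rule B1, use ydC[of x] in auto)
  have ale: "\<bar>a x + c\<^sup>2\<bar> \<le> B2 * \<bar>y sbar x\<bar>" for x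
  proof -
    have "\<bar>g' (y sbar x) - g' 0\<bar> \<le> B2 * \<bar>y sbar x\<bar>"
    proof (rule abs_le_deriv_bound[of "\<lambda>z. g' z - g' 0" g''])
      show "((\<lambda>z. g' z - g' 0) has_real_derivative g'' t) (at t)" for t
        using DERIV_diff[OF dg(2)[of t] DERIV_const[of "g' 0"]] by simp
      show "\<bar>g'' t\<bar> \<le> B2" if "\<bar>t\<bar> \<le> \<bar>y sbar x\<bar>" for t by (rule B2) (use that ydC[of x] in auto)
    qed simp
    then show ?thesis unfolding a c2 by (simp add: g'_def)
  qed
  \<comment> \<open>One constant for all six bounds: \<open>B2 * C\<close> for the coefficient, the
    last term for \<open>y2\<close>, and \<open>C\<close> for the other four functions.\<close>
  define K where "K = C + B2 * C + (sbar\<^sup>2 + B1) / \<kappa> * C"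
  have KC: "C \<le> K" "B2 * C \<le> K" "(sbar\<^sup>2 + B1) / \<kappa> * C \<le> K"
  proof -
    have "0 \<le> B2 * C" "0 \<le> (sbar\<^sup>2 + B1) / \<kappa> * C" using B0 C0 kap by auto
    then show "C \<le> K" "B2 * C \<le> K" "(sbar\<^sup>2 + B1) / \<kappa> * C \<le> K" using C0 unfolding K_def by linarith+
  qed
  have up: "r \<le> K * exp (- (k * \<bar>x\<bar>))" if "r \<le> R * \<bar>y sbar x\<bar>" "R * C \<le> K" "0 \<le> R" for r R x
  proof -
    have "R * \<bar>y sbar x\<bar> \<le> R * (C * exp (- (k * \<bar>x\<bar>)))" using le(1)[of sbar x] dd that(3) by (intro mult_left_mono) auto
    also have "\<dots> \<le> K * exp (- (k * \<bar>x\<bar>))" using mult_right_mono[OF that(2), of "exp (- (k * \<bar>x\<bar>))"] by (simp add: mult.assoc)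
    finally show ?thesis using that(1) by linarith
  qed
  have up1: "r \<le> K * exp (- (k * \<bar>x\<bar>))" if "r \<le> C * exp (- (k * \<bar>x\<bar>))" for r x
    by (rule order_trans[OF that mult_right_mono[OF KC(1)]]) simp
  have zd: "\<bar>sbar - sbar\<bar> \<le> dd" using dd by simp
  interpret lin: linearized \<kappa> sbar c k K a "y sbar" "y1 sbar" y2 "w sbar" "w1 sbar"
  proof
    show "continuous_on UNIV a" by (rule DERIV_continuous_on[OF has_field_derivative_at_within[OF da]])
    show "\<bar>a x + c\<^sup>2\<bar> \<le> K * exp (- (k * \<bar>x\<bar>))" for x by (rule up[OF ale KC(2) B0(2)])
    show "\<bar>y2 x\<bar> \<le> K * exp (- (k * \<bar>x\<bar>))" for x
    proof (rule up[OF _ KC(3)])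
      have "\<bar>sbar\<^sup>2 * y sbar x + g (y sbar x)\<bar> \<le> sbar\<^sup>2 * \<bar>y sbar x\<bar> + B1 * \<bar>y sbar x\<bar>"
        by (rule order_trans[OF abs_triangle_ineq]) (use gle[of x] in \<open>simp add: abs_mult\<close>)
      then have "\<bar>sbar\<^sup>2 * y sbar x + g (y sbar x)\<bar> / \<kappa> \<le> (sbar\<^sup>2 * \<bar>y sbar x\<bar> + B1 * \<bar>y sbar x\<bar>) / \<kappa>"
        by (rule divide_right_mono) (use kap in simp)
      then show "\<bar>y2 x\<bar> \<le> (sbar\<^sup>2 + B1) / \<kappa> * \<bar>y sbar x\<bar>"
        unfolding y2_def abs_divide abs_minus_cancel abs_of_pos[OF kap] by (simp add: distrib_right)
      show "0 \<le> (sbar\<^sup>2 + B1) / \<kappa>" using B0 kap by simp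
    qed
    show "\<bar>y sbar x\<bar> \<le> K * exp (- (k * \<bar>x\<bar>))" "\<bar>y1 sbar x\<bar> \<le> K * exp (- (k * \<bar>x\<bar>))"
      "\<bar>w sbar x\<bar> \<le> K * exp (- (k * \<bar>x\<bar>))" "\<bar>w1 sbar x\<bar> \<le> K * exp (- (k * \<bar>x\<bar>))" for x
      by (rule up1, rule le[OF zd])+
    show "(y1 sbar has_real_derivative y2 x) (at x)" for x using dy2[OF sI] by (simp add: y2_def)
  qed (rule kap sc k dy1[OF sI] dy3 F.dx(3)[OF sI] dw2)+
  \<comment> \<open>If the profile derivative and its x-derivative both vanished at 0, that point
    would be stationary and the profile trivial.\<close>
  have nondeg: "y1 sbar 0 \<noteq> 0 \<or> y2 0 \<noteq> 0"
  proof (rule ccontr)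
    assume "\<not> ?thesis"
    then have "y1 sbar 0 = 0" "sbar\<^sup>2 * y sbar 0 + g (y sbar 0) = 0" using kap by (auto simp: y2_def)
    then have "y sbar x = 0" for x using F.stationary_point_trivial[OF sI] by blast
    then show False using F.nonzero by blast
  qed
  have dv: "deriv vbar = y1 sbar" using dvs[OF sI] through by simp
  have dv2: "deriv (y1 sbar) = y2" using y2[OF sI] by (auto simp: y2_def)
  have evans: "(deriv ^^ 2) (evans_function W1 W2 W3 W4) 0 = of_real (4 * c * (sbar\<^sup>2 - c\<^sup>2) / \<kappa>\<^sup>2 * (deriv ^^ 2) m sbar)"
    if basis: "evans_basis p \<kappa> vinf sbar vbar ubar r W1 W2 W3 W4" for r W1 W2 W3 W4
    unfolding m2
  proof (rule lin.evans_second_derivative[OF basis a_def da' c_def])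
    show "deriv ubar x = - sbar * y1 sbar x" for x
      using ode(2)[OF sI, of x] dvs[OF sI] through by simp
    show "deriv vbar x = y1 sbar x" for x by (simp add: dv)
    show "(deriv ^^ 2) vbar x = y2 x" for x by (simp add: numeral_2_eq_2 dv dv2)
    show "(deriv ^^ 3) vbar x = - ((sbar\<^sup>2 + a x) * y1 sbar x) / \<kappa>" for x
      using DERIV_imp_deriv[OF dy3[of x]] by (simp add: numeral_3_eq_3 dv dv2)
  qed (rule nondeg)
  \<comment> \<open>The saddle condition says sbar^2 < c^2. The constant involves only p'(vinf),
    \<open>sbar\<close> and \<open>\<kappa>\<close>, so it is chosen before the Evans basis.\<close>
  have "4 * c * (sbar\<^sup>2 - c\<^sup>2) / \<kappa>\<^sup>2 \<noteq> 0" using c0 kap dpneg c2 by simp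
  then show ?thesis using evans unfolding m_def by blast
qed

end
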